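(* A totally umbilical biharmonic surface in a 3-dimensional Riemannian manifold (any such manifold) must have constant mean curvature.
   Context: All manifolds and maps are smooth. A map $\varphi:(M,g)\to(N,h)$ of Riemannian manifolds is biharmonic if for every compact $\Omega\subset M$ its restriction to $\Omega$ is a critical point of the bienergy $E^2(\varphi,\Omega)=\frac12\int_\Omega|\tau(\varphi)|^2dx$, where $\tau(\varphi)=\mathrm{Trace}_g\nabla d\varphi$ is the tension field. A surface is biharmonic if the isometric immersion defining it is a biharmonic map. With $\xi$ a local unit normal and $A$ the shape operator, the mean curvature is $H=\frac12\mathrm{trace}\,A$ and the mean curvature vector is $H\xi$. The surface is totally umbilical if at every point the two principal curvatures coincide, i.e. $A=\lambda\,\mathrm{Id}$ for a function $\lambda$.
   Formalization: The surface is assumed connected; on a disconnected one (e.g. a great sphere together with the small sphere of radius 1/√2 in the 3-sphere) the mean curvature is constant only on each component. Constancy is meant up to the choice of sign of the unit normal. *)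

theory Defs
  imports "HOL-Analysis.Analysis"
begin

section \<open>Smooth functions between Euclidean spaces\<close>

text \<open>Meant for open \<open>S\<close> only, as the derivatives are taken in the whole space.\<close>

primrec Ck_on :: "nat \<Rightarrow> 'a::euclidean_space set \<Rightarrow> ('a \<Rightarrow> 'b::real_normed_vector) \<Rightarrow> bool" where
  "Ck_on 0 S f \<longleftrightarrow> continuous_on S f"
| "Ck_on (Suc k) S f \<longleftrightarrow>
     (\<forall>x\<in>S. f differentiable (at x)) \<and>
     (\<forall>v. Ck_on k S (\<lambda>x. frechet_derivative f (at x) v))"

definition smooth_on :: "'a::euclidean_space set \<Rightarrow> ('a \<Rightarrow> 'b::real_normed_vector) \<Rightarrow> bool" where
  "smooth_on S f \<longleftrightarrow> (\<forall>k. Ck_on k S f)"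

definition partial :: "'n::finite \<Rightarrow> (real^'n \<Rightarrow> 'b::real_normed_vector) \<Rightarrow> real^'n \<Rightarrow> 'b" where
  "partial i f x = frechet_derivative f (at x) (axis i 1)"

definition jacobian :: "(real^'m \<Rightarrow> real^'n) \<Rightarrow> real^'m::finite \<Rightarrow> real^'m^'n::finite" where
  "jacobian f x = matrix (frechet_derivative f (at x))"

section \<open>Smooth manifolds\<close>

text \<open>The manifold is a whole type, Hausdorff and second countable by its sort, with a (not
  necessarily maximal) atlas. A chart is a pair of its domain and its coordinate map; the values of
  the coordinate map outside the domain are irrelevant.\<close>

type_synonym ('p, 'n) chart = "'p set \<times> ('p \<Rightarrow> real^'n)"

definition chart_range :: "('p, 'n::finite) chart \<Rightarrow> (real^'n) set" where
  "chart_range \<kappa> = snd \<kappa> ` fst \<kappa>"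

definition chart_inv :: "('p, 'n::finite) chart \<Rightarrow> real^'n \<Rightarrow> 'p" where
  "chart_inv \<kappa> = inv_into (fst \<kappa>) (snd \<kappa>)"

definition is_chart :: "('p::topological_space, 'n::finite) chart \<Rightarrow> bool" where
  "is_chart \<kappa> \<longleftrightarrow> open (fst \<kappa>) \<and> open (chart_range \<kappa>) \<and>
     homeomorphism (fst \<kappa>) (chart_range \<kappa>) (snd \<kappa>) (chart_inv \<kappa>)"

definition transition :: "('p, 'n::finite) chart \<Rightarrow> ('p, 'n) chart \<Rightarrow> real^'n \<Rightarrow> real^'n" where
  "transition \<kappa> \<kappa>' = snd \<kappa>' \<circ> chart_inv \<kappa>"

definition smooth_atlas ::
  "('p::{t2_space,second_countable_topology}, 'n::finite) chart set \<Rightarrow> bool" where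
  "smooth_atlas A \<longleftrightarrow>
     (\<forall>\<kappa>\<in>A. is_chart \<kappa>) \<and> (\<Union>\<kappa>\<in>A. fst \<kappa>) = UNIV \<and>
     (\<forall>\<kappa>\<in>A. \<forall>\<kappa>'\<in>A. smooth_on (snd \<kappa> ` (fst \<kappa> \<inter> fst \<kappa>')) (transition \<kappa> \<kappa>'))"

definition chart_at :: "('p, 'n) chart set \<Rightarrow> 'p \<Rightarrow> ('p, 'n::finite) chart" where
  "chart_at A p = (SOME \<kappa>. \<kappa> \<in> A \<and> p \<in> fst \<kappa>)"

definition local_rep ::
  "('p, 'm::finite) chart \<Rightarrow> ('q, 'n::finite) chart \<Rightarrow> ('p \<Rightarrow> 'q) \<Rightarrow> real^'m \<Rightarrow> real^'n" where
  "local_rep \<kappa> \<nu> \<phi> = snd \<nu> \<circ> \<phi> \<circ> chart_inv \<kappa>"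

definition smooth_map ::
  "('p::topological_space, 'm::finite) chart set \<Rightarrow> ('q::topological_space, 'n::finite) chart set
   \<Rightarrow> ('p \<Rightarrow> 'q) \<Rightarrow> bool" where
  "smooth_map A B \<phi> \<longleftrightarrow> continuous_on UNIV \<phi> \<and>
     (\<forall>\<kappa>\<in>A. \<forall>\<nu>\<in>B. smooth_on (snd \<kappa> ` (fst \<kappa> \<inter> \<phi> -` fst \<nu>)) (local_rep \<kappa> \<nu> \<phi>))"

section \<open>Riemannian metrics\<close>

text \<open>A metric is given classically, by its component matrices \<open>(g\<^sub>i\<^sub>j)\<close> in the charts of the atlas,
  as functions of the coordinates, subject to the transformation law of covariant 2-tensors.\<close>

type_synonym ('p, 'n) chart_metric = "('p, 'n) chart \<Rightarrow> real^'n \<Rightarrow> real^'n^'n"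

definition riemannian_metric ::
  "('p, 'n::finite) chart set \<Rightarrow> ('p, 'n) chart_metric \<Rightarrow> bool" where
  "riemannian_metric A g \<longleftrightarrow>
     (\<forall>\<kappa>\<in>A. smooth_on (chart_range \<kappa>) (g \<kappa>) \<and>
        (\<forall>x\<in>chart_range \<kappa>. transpose (g \<kappa> x) = g \<kappa> x \<and>
           (\<forall>v. v \<noteq> 0 \<longrightarrow> v \<bullet> (g \<kappa> x *v v) > 0))) \<and>
     (\<forall>\<kappa>\<in>A. \<forall>\<kappa>'\<in>A. \<forall>x\<in>snd \<kappa> ` (fst \<kappa> \<inter> fst \<kappa>').
        g \<kappa> x = transpose (jacobian (transition \<kappa> \<kappa>') x) ** g \<kappa>' (transition \<kappa> \<kappa>' x)
                ** jacobian (transition \<kappa> \<kappa>') x)"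

definition riemannian_manifold ::
  "('p::{t2_space,second_countable_topology}, 'n::finite) chart set \<Rightarrow> ('p, 'n) chart_metric \<Rightarrow> bool"
  where "riemannian_manifold A g \<longleftrightarrow> smooth_atlas A \<and> riemannian_metric A g"

text \<open>The Riemannian volume: the Borel measure with density \<open>sqrt (det g)\<close> in every chart.\<close>

definition riemannian_volume ::
  "('p::topological_space, 'n::finite) chart set \<Rightarrow> ('p, 'n) chart_metric \<Rightarrow> 'p measure" where
  "riemannian_volume A g = (THE \<mu>. sets \<mu> = sets borel \<and>
     (\<forall>\<kappa>\<in>A. \<forall>S\<in>sets borel. S \<subseteq> fst \<kappa> \<longrightarrow>
        emeasure \<mu> S = (\<integral>\<^sup>+x\<in>snd \<kappa> ` S. ennreal (sqrt (det (g \<kappa> x))) \<partial>lborel)))"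

section \<open>Coordinate formulas\<close>

text \<open>Here \<open>G\<close> and \<open>K\<close> are the component matrices of the metrics of the source and of the target in
  fixed charts, and \<open>F\<close> is a map in these charts.\<close>

definition metric_inner :: "(real^'n \<Rightarrow> real^'n^'n) \<Rightarrow> real^'n \<Rightarrow> real^'n \<Rightarrow> real^'n::finite \<Rightarrow> real" where
  "metric_inner K y u v = u \<bullet> (K y *v v)"

text \<open>\<open>christoffel G x k i j\<close> is the Levi-Civita symbol with upper index \<open>k\<close>.\<close>

definition christoffel :: "(real^'n \<Rightarrow> real^'n^'n) \<Rightarrow> real^'n \<Rightarrow> 'n \<Rightarrow> 'n \<Rightarrow> 'n::finite \<Rightarrow> real" where
  "christoffel G x k i j = 1/2 * (\<Sum>l\<in>UNIV. matrix_inv (G x) $ k $ l *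
     (partial i (\<lambda>y. G y $ j $ l) x + partial j (\<lambda>y. G y $ i $ l) x
      - partial l (\<lambda>y. G y $ i $ j) x))"

text \<open>The components of \<open>\<nabla>dF (\<partial>\<^sub>i, \<partial>\<^sub>j)\<close>.\<close>

definition hessian_map ::
  "(real^'m \<Rightarrow> real^'m^'m) \<Rightarrow> (real^'n \<Rightarrow> real^'n^'n) \<Rightarrow> (real^'m \<Rightarrow> real^'n) \<Rightarrow>
   real^'m::finite \<Rightarrow> 'm \<Rightarrow> 'm \<Rightarrow> real^'n::finite" where
  "hessian_map G K F x i j = (\<chi> a.
     partial i (partial j (\<lambda>y. F y $ a)) x
     - (\<Sum>k\<in>UNIV. christoffel G x k i j * partial k (\<lambda>y. F y $ a) x)
     + (\<Sum>b\<in>UNIV. \<Sum>c\<in>UNIV. christoffel K (F x) a b c *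
          partial i (\<lambda>y. F y $ b) x * partial j (\<lambda>y. F y $ c) x))"

definition tension ::
  "(real^'m \<Rightarrow> real^'m^'m) \<Rightarrow> (real^'n \<Rightarrow> real^'n^'n) \<Rightarrow> (real^'m \<Rightarrow> real^'n) \<Rightarrow>
   real^'m::finite \<Rightarrow> real^'n::finite" where
  "tension G K F x = (\<Sum>i\<in>UNIV. \<Sum>j\<in>UNIV. matrix_inv (G x) $ i $ j *\<^sub>R hessian_map G K F x i j)"

text \<open>The derivative in direction \<open>\<partial>\<^sub>i\<close> of a vector field \<open>X\<close> along \<open>F\<close>, with respect to the connection
  induced by the Levi-Civita connection of the target.\<close>

definition cov_deriv ::
  "(real^'n \<Rightarrow> real^'n^'n) \<Rightarrow> (real^'m \<Rightarrow> real^'n) \<Rightarrow> (real^'m \<Rightarrow> real^'n) \<Rightarrow>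
   real^'m::finite \<Rightarrow> 'm \<Rightarrow> real^'n::finite" where
  "cov_deriv K F X x i = (\<chi> a. partial i (\<lambda>y. X y $ a) x
     + (\<Sum>b\<in>UNIV. \<Sum>c\<in>UNIV. christoffel K (F x) a b c * partial i (\<lambda>y. F y $ b) x * X x $ c))"

text \<open>The matrix of the shape operator \<open>A\<close> determined by \<open>\<langle>A v, w\<rangle> = - \<langle>\<nabla>\<^sub>v X, dF w\<rangle>\<close>, that is,
  \<open>dF (A v)\<close> is minus the tangential part of \<open>\<nabla>\<^sub>v X\<close>.\<close>

definition shape_matrix ::
  "(real^'m \<Rightarrow> real^'m^'m) \<Rightarrow> (real^'n \<Rightarrow> real^'n^'n) \<Rightarrow> (real^'m \<Rightarrow> real^'n) \<Rightarrow>
   (real^'m \<Rightarrow> real^'n) \<Rightarrow> real^'m::finite \<Rightarrow> real^'m^'m" where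
  "shape_matrix G K F X x = (\<chi> j i. - (\<Sum>k\<in>UNIV. matrix_inv (G x) $ j $ k *
     metric_inner K (F x) (cov_deriv K F X x i) (partial k F x)))"

section \<open>Biharmonic maps\<close>

text \<open>The value does not depend on the choice of the charts at \<open>p\<close> and \<open>\<phi> p\<close>.\<close>

definition tension_norm_sq ::
  "('p, 'm::finite) chart set \<Rightarrow> ('p, 'm) chart_metric \<Rightarrow>
   ('q, 'n::finite) chart set \<Rightarrow> ('q, 'n) chart_metric \<Rightarrow> ('p \<Rightarrow> 'q) \<Rightarrow> 'p \<Rightarrow> real" where
  "tension_norm_sq A g B h \<phi> p =
     (let \<kappa> = chart_at A p; \<nu> = chart_at B (\<phi> p);
          t = tension (g \<kappa>) (h \<nu>) (local_rep \<kappa> \<nu> \<phi>) (snd \<kappa> p)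
      in metric_inner (h \<nu>) (snd \<nu> (\<phi> p)) t t)"

definition bienergy ::
  "('p::topological_space, 'm::finite) chart set \<Rightarrow> ('p, 'm) chart_metric \<Rightarrow>
   ('q, 'n::finite) chart set \<Rightarrow> ('q, 'n) chart_metric \<Rightarrow> 'p set \<Rightarrow> ('p \<Rightarrow> 'q) \<Rightarrow> real" where
  "bienergy A g B h \<Omega> \<phi> =
     1/2 * set_lebesgue_integral (riemannian_volume A g) \<Omega> (tension_norm_sq A g B h \<phi>)"

text \<open>A smooth variation of \<open>\<phi>\<close> through maps \<open>M \<rightarrow> N\<close>, supported in \<open>\<Omega>\<close>.\<close>

definition variation_in ::
  "('p::topological_space, 'm::finite) chart set \<Rightarrow> ('q::topological_space, 'n::finite) chart set \<Rightarrow>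
   'p set \<Rightarrow> ('p \<Rightarrow> 'q) \<Rightarrow> real \<Rightarrow> (real \<Rightarrow> 'p \<Rightarrow> 'q) \<Rightarrow> bool" where
  "variation_in A B \<Omega> \<phi> \<epsilon> \<Phi> \<longleftrightarrow>
     \<epsilon> > 0 \<and> \<Phi> 0 = \<phi> \<and>
     (\<forall>t\<in>{-\<epsilon><..<\<epsilon>}. \<forall>p. p \<notin> \<Omega> \<longrightarrow> \<Phi> t p = \<phi> p) \<and>
     continuous_on ({-\<epsilon><..<\<epsilon>} \<times> UNIV) (\<lambda>(t, p). \<Phi> t p) \<and>
     (\<forall>\<kappa>\<in>A. \<forall>\<nu>\<in>B.
        smooth_on {(t, x). t \<in> {-\<epsilon><..<\<epsilon>} \<and> x \<in> chart_range \<kappa> \<and> \<Phi> t (chart_inv \<kappa> x) \<in> fst \<nu>}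
          (\<lambda>(t, x). local_rep \<kappa> \<nu> (\<Phi> t) x))"

definition biharmonic ::
  "('p::topological_space, 'm::finite) chart set \<Rightarrow> ('p, 'm) chart_metric \<Rightarrow>
   ('q::topological_space, 'n::finite) chart set \<Rightarrow> ('q, 'n) chart_metric \<Rightarrow> ('p \<Rightarrow> 'q) \<Rightarrow> bool" where
  "biharmonic A g B h \<phi> \<longleftrightarrow> smooth_map A B \<phi> \<and>
     (\<forall>\<Omega> \<epsilon> \<Phi>. compact \<Omega> \<longrightarrow> variation_in A B \<Omega> \<phi> \<epsilon> \<Phi> \<longrightarrow>
        ((\<lambda>t. bienergy A g B h \<Omega> (\<Phi> t)) has_real_derivative 0) (at 0))"

section \<open>Surfaces in 3-manifolds\<close>

text \<open>The condition \<open>\<phi>\<^sup>* h = g\<close>; it makes \<open>\<phi>\<close> an immersion, as \<open>g\<close> is positive definite.\<close>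

definition isometric_immersion ::
  "('p::topological_space, 'm::finite) chart set \<Rightarrow> ('p, 'm) chart_metric \<Rightarrow>
   ('q::topological_space, 'n::finite) chart set \<Rightarrow> ('q, 'n) chart_metric \<Rightarrow> ('p \<Rightarrow> 'q) \<Rightarrow> bool" where
  "isometric_immersion A g B h \<phi> \<longleftrightarrow> smooth_map A B \<phi> \<and>
     (\<forall>\<kappa>\<in>A. \<forall>\<nu>\<in>B. \<forall>x\<in>snd \<kappa> ` (fst \<kappa> \<inter> \<phi> -` fst \<nu>).
        g \<kappa> x = transpose (jacobian (local_rep \<kappa> \<nu> \<phi>) x) ** h \<nu> (local_rep \<kappa> \<nu> \<phi> x)
                ** jacobian (local_rep \<kappa> \<nu> \<phi>) x)"

text \<open>\<open>\<xi> \<nu> p\<close> are the components, in the chart \<open>\<nu>\<close> of the target, of a vector at \<open>\<phi> p\<close>.\<close>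

definition unit_normal_on ::
  "('p::topological_space, 'm::finite) chart set \<Rightarrow>
   ('q::topological_space, 'n::finite) chart set \<Rightarrow> ('q, 'n) chart_metric \<Rightarrow> ('p \<Rightarrow> 'q) \<Rightarrow>
   'p set \<Rightarrow> (('q, 'n) chart \<Rightarrow> 'p \<Rightarrow> real^'n) \<Rightarrow> bool" where
  "unit_normal_on A B h \<phi> V \<xi> \<longleftrightarrow> open V \<and>
     (\<forall>\<nu>\<in>B. \<forall>\<nu>'\<in>B. \<forall>p\<in>V. \<phi> p \<in> fst \<nu> \<inter> fst \<nu>' \<longrightarrow>
        \<xi> \<nu>' p = jacobian (transition \<nu> \<nu>') (snd \<nu> (\<phi> p)) *v \<xi> \<nu> p) \<and>
     (\<forall>\<kappa>\<in>A. \<forall>\<nu>\<in>B.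
        smooth_on (snd \<kappa> ` (fst \<kappa> \<inter> V \<inter> \<phi> -` fst \<nu>)) (\<xi> \<nu> \<circ> chart_inv \<kappa>)) \<and>
     (\<forall>\<kappa>\<in>A. \<forall>\<nu>\<in>B. \<forall>p \<in> fst \<kappa> \<inter> V \<inter> \<phi> -` fst \<nu>.
        metric_inner (h \<nu>) (snd \<nu> (\<phi> p)) (\<xi> \<nu> p) (\<xi> \<nu> p) = 1 \<and>
        (\<forall>i. metric_inner (h \<nu>) (snd \<nu> (\<phi> p)) (\<xi> \<nu> p)
               (partial i (local_rep \<kappa> \<nu> \<phi>) (snd \<kappa> p)) = 0))"

text \<open>The matrix of the shape operator at \<open>p\<close> with respect to \<open>\<xi>\<close>, in the coordinate basis of \<open>\<kappa>\<close>.\<close>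

definition shape_operator ::
  "('p, 'm::finite) chart_metric \<Rightarrow> ('q, 'n::finite) chart_metric \<Rightarrow> ('p \<Rightarrow> 'q) \<Rightarrow>
   (('q, 'n) chart \<Rightarrow> 'p \<Rightarrow> real^'n) \<Rightarrow> ('p, 'm) chart \<Rightarrow> ('q, 'n) chart \<Rightarrow> 'p \<Rightarrow> real^'m^'m" where
  "shape_operator g h \<phi> \<xi> \<kappa> \<nu> p =
     shape_matrix (g \<kappa>) (h \<nu>) (local_rep \<kappa> \<nu> \<phi>) (\<xi> \<nu> \<circ> chart_inv \<kappa>) (snd \<kappa> p)"

definition mean_curvature ::
  "('p, 2) chart set \<Rightarrow> ('p, 2) chart_metric \<Rightarrow> ('q, 3) chart set \<Rightarrow> ('q, 3) chart_metric \<Rightarrow>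
   ('p \<Rightarrow> 'q) \<Rightarrow> (('q, 3) chart \<Rightarrow> 'p \<Rightarrow> real^3) \<Rightarrow> 'p \<Rightarrow> real" where
  "mean_curvature A g B h \<phi> \<xi> p =
     1/2 * trace (shape_operator g h \<phi> \<xi> (chart_at A p) (chart_at B (\<phi> p)) p)"

text \<open>A unit normal near a point always exists, and is unique up to sign.\<close>

definition totally_umbilical ::
  "('p::topological_space, 2) chart set \<Rightarrow> ('p, 2) chart_metric \<Rightarrow>
   ('q::topological_space, 3) chart set \<Rightarrow> ('q, 3) chart_metric \<Rightarrow> ('p \<Rightarrow> 'q) \<Rightarrow> bool" where
  "totally_umbilical A g B h \<phi> \<longleftrightarrow>
     (\<forall>p. \<exists>V \<xi> l. p \<in> V \<and> unit_normal_on A B h \<phi> V \<xi> \<and>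
        (\<forall>q\<in>V. \<forall>\<kappa>\<in>A. \<forall>\<nu>\<in>B. q \<in> fst \<kappa> \<longrightarrow> \<phi> q \<in> fst \<nu> \<longrightarrow>
           shape_operator g h \<phi> \<xi> \<kappa> \<nu> q = l q *\<^sub>R mat 1))"

text \<open>The mean curvature is defined by a local unit normal, hence only up to sign: one constant serves
  for the whole surface, and for each unit normal on a connected open set the sign is fixed.\<close>

definition constant_mean_curvature ::
  "('p::topological_space, 2) chart set \<Rightarrow> ('p, 2) chart_metric \<Rightarrow>
   ('q::topological_space, 3) chart set \<Rightarrow> ('q, 3) chart_metric \<Rightarrow> ('p \<Rightarrow> 'q) \<Rightarrow> bool" where
  "constant_mean_curvature A g B h \<phi> \<longleftrightarrow>
     (\<exists>c. \<forall>V \<xi>. unit_normal_on A B h \<phi> V \<xi> \<longrightarrow> connected V \<longrightarrow>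
        (\<forall>p\<in>V. mean_curvature A g B h \<phi> \<xi> p = c) \<or>
        (\<forall>p\<in>V. mean_curvature A g B h \<phi> \<xi> p = - c))"

end

theory Submission
  imports Defs
begin

text \<open>Only variations tangent to the surface are needed. Let \<open>\<psi>\<^sub>t(x) = x + t \<eta>(x) e\<^sub>k\<close> in a chart, with a
  bump function \<open>\<eta>\<close>. For an umbilical immersion \<open>\<nabla>d\<phi> = H g \<xi>\<close>, hence
  \<open>\<tau>(\<phi> \<circ> \<psi>\<^sub>t) = d\<phi>(\<tau>(\<psi>\<^sub>t)) + H(\<psi>\<^sub>t) |d\<psi>\<^sub>t|\<^sup>2 \<xi>\<close> and
  \<open>|\<tau>(\<phi> \<circ> \<psi>\<^sub>t)|\<^sup>2 = |\<tau>(\<psi>\<^sub>t)|\<^sup>2 + H(\<psi>\<^sub>t)\<^sup>2 |d\<psi>\<^sub>t|\<^sup>4\<close>. The first summand is of second order in \<open>t\<close>, because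
  \<open>\<psi>\<^sub>0\<close> is the identity, and \<open>|d\<psi>\<^sub>t|\<^sup>2 = 2 + 2 t div X + o(t)\<close> for \<open>X = \<eta> e\<^sub>k\<close>. So the derivative of the bienergy
  at \<open>t = 0\<close> is the integral of \<open>2 X(H\<^sup>2) + 4 H\<^sup>2 div X\<close>, that is of \<open>- 2 X(H\<^sup>2)\<close> after partial integration.
  As it vanishes for all \<open>\<eta>\<close> and \<open>k\<close>, the function \<open>H\<^sup>2\<close> is locally constant. Neither the Codazzi equation
  nor the normal part of the biharmonic equation enters.\<close>

section \<open>Smooth functions\<close>

text \<open>Precomposing with \<open>\<psi> t\<close> keeps all values inside the image of the
  surface, so one pair of charts serves for the whole variation and umbilicity can be used at the
  moved point \<open>\<psi> t x\<close>. The bienergy becomes an integral over a cube whose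
  integrand is smooth in \<open>t\<close> and \<open>x\<close> together and can be differentiated
  under the integral sign. The outcome depends on the dimension: for an umbilical hypersurface of
  dimension m the same computation gives m(m - 4)/2 times the integral of X(H^2), which is the
  factor -2 for m = 2 and would say nothing for m = 4. The definitions carry choices: charts picked
  at each point, a volume given by a description, a normal fixed up to sign. The first two are
  settled by invariance under isometric coordinate changes and by unique existence of the volume.
  The third disappears in |\<tau>|^2 / 4, which equals H^2 and is defined globally. Connectedness of
  the surface makes it constant, and continuity of H then fixes the sign on each connected
  \<open>V\<close>.\<close>

lemma Ck_on_subset: "Ck_on k S f \<Longrightarrow> T \<subseteq> S \<Longrightarrow> Ck_on k T f"
  by (induction k arbitrary: f) (auto intro: continuous_on_subset)

text \<open>The recursion speaks of the class of the derivatives only, so descending one order needs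
  an induction whose base is that differentiability implies continuity.\<close>

lemma Ck_on_SucD: "Ck_on (Suc k) S f \<Longrightarrow> Ck_on k S f"
proof (induction k arbitrary: f)
  case 0
  then have "f differentiable at x within S" if "x \<in> S" for x
    using that by (auto intro: differentiable_at_withinI)
  then show ?case
    by (simp add: continuous_on_eq_continuous_within differentiable_imp_continuous_within)
next
  case (Suc k)
  then show ?case by auto
qed

lemma Ck_on_imp_continuous_on: "Ck_on k S f \<Longrightarrow> continuous_on S f"
proof (induction k)
  case (Suc k)
  then show ?case using Ck_on_SucD by blast
qed simp

text \<open>The derivative at a point depends on the values nearby; on an open set, agreement
  therefore passes to all derivatives.\<close>

lemma Ck_on_cong:
  assumes "open S" "\<And>x. x \<in> S \<Longrightarrow> f x = g x" "Ck_on k S f"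
  shows "Ck_on k S g"
  using assms(2,3)
proof (induction k arbitrary: f g)
  case 0
  then show ?case by (auto cong: continuous_on_cong)
next
  case (Suc k)
  have d: "(g has_derivative frechet_derivative f (at x)) (at x)" if "x \<in> S" for x
  proof -
    have "(f has_derivative frechet_derivative f (at x)) (at x)"
      using Suc.prems(2) that by (auto simp: frechet_derivative_works)
    then show ?thesis
      by (rule has_derivative_transform_within_open[OF _ assms(1) that]) (use Suc.prems in auto)
  qed
  then have "frechet_derivative g (at x) = frechet_derivative f (at x)" if "x \<in> S" for x
    using frechet_derivative_at[OF d[OF that]] by simp
  then have "Ck_on k S (\<lambda>x. frechet_derivative g (at x) v)" for v
    using Suc.IH[of "\<lambda>x. frechet_derivative f (at x) v" "\<lambda>x. frechet_derivative g (at x) v"] Suc.prems(2)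
    by auto
  then show ?case
    using d by (auto simp: differentiable_def)
qed

text \<open>The derivative may be given by any formula \<open>f'\<close>; the closure properties
  below differentiate by the usual rules and apply the induction hypothesis to that formula.\<close>

lemma Ck_on_SucI:
  assumes "open S" "\<And>x. x \<in> S \<Longrightarrow> (f has_derivative f' x) (at x)" "\<And>v. Ck_on k S (\<lambda>x. f' x v)"
  shows "Ck_on (Suc k) S f"
proof -
  have "frechet_derivative f (at x) = f' x" if "x \<in> S" for x
    using frechet_derivative_at[OF assms(2)[OF that]] by simp
  then have "Ck_on k S (\<lambda>x. frechet_derivative f (at x) v)" for v
    by (intro Ck_on_cong[OF assms(1) _ assms(3)[of v]]) auto
  then show ?thesis
    using assms(2) by (auto simp: differentiable_def)
qed

lemma Ck_on_Suc_has_derivative: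
  "Ck_on (Suc k) S f \<Longrightarrow> x \<in> S \<Longrightarrow> (f has_derivative frechet_derivative f (at x)) (at x)"
  by (auto simp: frechet_derivative_works)

text \<open>Serves for gluing: the variation of the surface and functions cut off to zero are given
  by different formulas on different open sets.\<close>

lemma Ck_on_local:
  assumes "\<And>x. x \<in> S \<Longrightarrow> \<exists>U. open U \<and> x \<in> U \<and> Ck_on k U f"
  shows "Ck_on k S f"
  using assms
proof (induction k arbitrary: f)
  case 0
  have "continuous (at x within S) f" if x: "x \<in> S" for x
  proof -
    obtain U where "open U" "x \<in> U" "continuous_on U f" using 0[OF x] by auto
    then have "continuous (at x) f" by (simp add: continuous_on_eq_continuous_at)
    then show ?thesis by (rule continuous_at_imp_continuous_at_within)
  qed
  then show ?case by (simp add: continuous_on_eq_continuous_within)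
next
  case (Suc k)
  have "Ck_on k S (\<lambda>x. frechet_derivative f (at x) v)" for v
    by (rule Suc.IH) (use Suc.prems in fastforce)
  moreover have "f differentiable at x" if "x \<in> S" for x
    using Suc.prems[OF that] by auto
  ultimately show ?case by auto
qed

lemma Ck_on_const: "Ck_on k S (\<lambda>x. c)"
proof (induction k arbitrary: c)
  case (Suc k)
  have "frechet_derivative (\<lambda>x. c) (at x) = (\<lambda>v. 0)" for x :: 'a
    by (rule frechet_derivative_at[symmetric]) simp
  then show ?case using Suc by simp
qed simp

lemma Ck_on_bounded_linear:
  assumes "bounded_linear L"
  shows "Ck_on k S L"
proof (cases k)
  case 0
  then show ?thesis using assms by (simp add: linear_continuous_on)
next
  case (Suc j)
  have "frechet_derivative L (at x) = L" for x
    by (rule frechet_derivative_at[symmetric]) (rule bounded_linear_imp_has_derivative[OF assms])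
  then show ?thesis using Suc assms
    by (auto simp: Ck_on_const intro: bounded_linear_imp_differentiable)
qed

lemma Ck_on_add:
  assumes "open S" "Ck_on k S f" "Ck_on k S g"
  shows "Ck_on k S (\<lambda>x. f x + g x)"
  using assms(2,3)
proof (induction k arbitrary: f g)
  case (Suc k)
  show ?case
  proof (rule Ck_on_SucI[OF assms(1)])
    show "((\<lambda>x. f x + g x) has_derivative
      (\<lambda>v. frechet_derivative f (at x) v + frechet_derivative g (at x) v)) (at x)" if "x \<in> S" for x
      using Suc.prems that by (intro has_derivative_add Ck_on_Suc_has_derivative)
    show "Ck_on k S (\<lambda>x. frechet_derivative f (at x) v + frechet_derivative g (at x) v)" for v
      by (rule Suc.IH) (use Suc.prems in auto)
  qed
qed (auto intro: continuous_on_add)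

lemma Ck_on_bilinear:
  assumes B: "bounded_bilinear B" and "open S" "Ck_on k S f" "Ck_on k S g"
  shows "Ck_on k S (\<lambda>x. B (f x) (g x))"
  using assms(3,4)
proof (induction k arbitrary: f g)
  case 0
  then show ?case using bounded_bilinear.continuous_on[OF B] by auto
next
  case (Suc k)
  show ?case
  proof (rule Ck_on_SucI[OF \<open>open S\<close>])
    fix x assume "x \<in> S"
    then show "((\<lambda>x. B (f x) (g x)) has_derivative
       (\<lambda>v. B (f x) (frechet_derivative g (at x) v) + B (frechet_derivative f (at x) v) (g x))) (at x)"
      using Suc.prems by (intro bounded_bilinear.FDERIV[OF B]) (auto simp: frechet_derivative_works)
  next
    fix v
    show "Ck_on k S (\<lambda>x. B (f x) (frechet_derivative g (at x) v) + B (frechet_derivative f (at x) v) (g x))"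
    proof (intro Ck_on_add assms(2) Suc.IH)
      show "Ck_on k S f" "Ck_on k S g" using Suc.prems by (auto dest: Ck_on_SucD simp del: Ck_on.simps)
    qed (use Suc.prems in auto)
  qed
qed

lemma Ck_on_bounded_linear_compose:
  assumes "bounded_linear L" "open S" "Ck_on k S f"
  shows "Ck_on k S (\<lambda>x. L (f x))"
  using assms(3)
proof (induction k arbitrary: f)
  case 0
  then show ?case using bounded_linear.continuous_on[OF assms(1)] by auto
next
  case (Suc k)
  show ?case
  proof (rule Ck_on_SucI[OF assms(2)])
    show "((\<lambda>x. L (f x)) has_derivative (\<lambda>v. L (frechet_derivative f (at x) v))) (at x)" if "x \<in> S" for x
      using Suc.prems that by (intro bounded_linear.has_derivative[OF assms(1)] Ck_on_Suc_has_derivative)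
    show "Ck_on k S (\<lambda>x. L (frechet_derivative f (at x) v))" for v
      by (rule Suc.IH) (use Suc.prems in auto)
  qed
qed

lemma Ck_on_sum:
  assumes "open S" "\<And>i. i \<in> I \<Longrightarrow> Ck_on k S (f i)"
  shows "Ck_on k S (\<lambda>x. \<Sum>i\<in>I. f i x)"
  using assms(2) by (induction I rule: infinite_finite_induct) (simp_all add: Ck_on_add Ck_on_const assms(1))

lemma Ck_on_compose:
  assumes "open S" "open T" "Ck_on k S f" "Ck_on k T g" "f ` S \<subseteq> T"
  shows "Ck_on k S (\<lambda>x. g (f x))"
  using assms(3-)
proof (induction k arbitrary: f g)
  case 0
  then show ?case by (auto intro: continuous_on_compose2)
next
  case (Suc k)
  \<comment> \<open>Expanding the direction in a basis of the middle space leaves composites with a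
    fixed direction \<open>b\<close>. These are covered by the induction hypothesis, whereas the
    direction produced by the derivative of \<open>f\<close> varies with \<open>x\<close>.\<close>
  have D: "frechet_derivative g (at (f x)) w =
      (\<Sum>b\<in>Basis. (w \<bullet> b) *\<^sub>R frechet_derivative g (at (f x)) b)" if "x \<in> S" for x w
  proof -
    have "f x \<in> T" using Suc.prems that by auto
    then have "linear (frechet_derivative g (at (f x)))"
      using Suc.prems by (auto intro: linear_frechet_derivative)
    then have "(\<Sum>b\<in>Basis. (w \<bullet> b) *\<^sub>R frechet_derivative g (at (f x)) b)
       = frechet_derivative g (at (f x)) (\<Sum>b\<in>Basis. (w \<bullet> b) *\<^sub>R b)"
      by (simp add: linear_sum linear_scale)
    then show ?thesis by (simp add: euclidean_representation)
  qed
  show ?case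
  proof (rule Ck_on_SucI[OF \<open>open S\<close>])
    fix x assume x: "x \<in> S"
    have "((g \<circ> f) has_derivative frechet_derivative g (at (f x)) \<circ> frechet_derivative f (at x)) (at x)"
      using Suc.prems x by (intro diff_chain_at) (auto simp: frechet_derivative_works)
    then show "((\<lambda>x. g (f x)) has_derivative
       (\<lambda>v. \<Sum>b\<in>Basis. (frechet_derivative f (at x) v \<bullet> b) *\<^sub>R frechet_derivative g (at (f x)) b)) (at x)"
      by (subst D[OF x, symmetric]) (simp add: o_def)
  next
    fix v
    show "Ck_on k S (\<lambda>x. \<Sum>b\<in>Basis. (frechet_derivative f (at x) v \<bullet> b) *\<^sub>R frechet_derivative g (at (f x)) b)"
    proof (intro Ck_on_sum \<open>open S\<close> Ck_on_bilinear[OF bounded_bilinear_scaleR])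
      fix b :: 'b
      show "Ck_on k S (\<lambda>x. frechet_derivative f (at x) v \<bullet> b)"
        using Suc.prems by (intro Ck_on_bounded_linear_compose[OF bounded_linear_inner_left] \<open>open S\<close>) auto
      show "Ck_on k S (\<lambda>x. frechet_derivative g (at (f x)) b)"
      proof (rule Suc.IH)
        show "Ck_on k S f" using Suc.prems(1) by (rule Ck_on_SucD)
      qed (use Suc.prems in auto)
    qed
  qed
qed

text \<open>The derivative of 1/f is built from 1/f and the derivative of f, so class k of 1/f
  already gives class k + 1. The square root below works alike.\<close>

lemma Ck_on_inverse:
  fixes f :: "'a::euclidean_space \<Rightarrow> real"
  assumes "open S" "Ck_on k S f" "\<And>x. x \<in> S \<Longrightarrow> f x \<noteq> 0"
  shows "Ck_on k S (\<lambda>x. inverse (f x))"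
  using assms(2)
proof (induction k)
  case 0
  then show ?case using assms by (auto intro: continuous_on_inverse)
next
  case (Suc k)
  have I: "Ck_on k S (\<lambda>x. inverse (f x))" using Suc.IH Ck_on_SucD[OF Suc.prems] by blast
  show ?case
  proof (rule Ck_on_SucI[OF assms(1)])
    show "((\<lambda>x. inverse (f x)) has_derivative
      (\<lambda>v. - (inverse (f x) * frechet_derivative f (at x) v * inverse (f x)))) (at x)" if "x \<in> S" for x
      using assms(3)[OF that] Suc.prems that by (intro Deriv.has_derivative_inverse Ck_on_Suc_has_derivative)
    show "Ck_on k S (\<lambda>x. - (inverse (f x) * frechet_derivative f (at x) v * inverse (f x)))" for v
      by (intro Ck_on_bounded_linear_compose[OF bounded_linear_minus[OF bounded_linear_ident]]
          Ck_on_bilinear[OF bounded_bilinear_mult] I assms(1)) (use Suc.prems in auto)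
  qed
qed

lemma Ck_on_sqrt:
  fixes f :: "'a::euclidean_space \<Rightarrow> real"
  assumes "open S" "Ck_on k S f" "\<And>x. x \<in> S \<Longrightarrow> f x > 0"
  shows "Ck_on k S (\<lambda>x. sqrt (f x))"
  using assms(2)
proof (induction k)
  case 0
  then show ?case by (auto intro: continuous_on_real_sqrt)
next
  case (Suc k)
  show ?case
  proof (rule Ck_on_SucI[OF assms(1)])
    fix x assume "x \<in> S"
    then show "((\<lambda>x. sqrt (f x)) has_derivative
        (\<lambda>v. frechet_derivative f (at x) v * ((1/2) * inverse (sqrt (f x))))) (at x)"
      using Suc.prems assms(3) by (auto intro!: derivative_eq_intros simp: frechet_derivative_works)
  next
    fix v
    show "Ck_on k S (\<lambda>x. frechet_derivative f (at x) v * ((1/2) * inverse (sqrt (f x))))"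
    proof (intro Ck_on_bilinear[OF bounded_bilinear_mult] Ck_on_const Ck_on_inverse assms(1))
      show "Ck_on k S (\<lambda>x. sqrt (f x))" using Suc.IH Ck_on_SucD[OF Suc.prems] by blast
      show "sqrt (f x) \<noteq> 0" if "x \<in> S" for x using assms(3)[OF that] by simp
    qed (use Suc.prems in auto)
  qed
qed

section \<open>Closure properties of smooth functions\<close>

lemma smooth_on_subset: "smooth_on S f \<Longrightarrow> T \<subseteq> S \<Longrightarrow> smooth_on T f"
  unfolding smooth_on_def using Ck_on_subset by blast

lemma smooth_on_cong:
  "open S \<Longrightarrow> (\<And>x. x \<in> S \<Longrightarrow> f x = g x) \<Longrightarrow> smooth_on S f \<Longrightarrow> smooth_on S g"
  unfolding smooth_on_def by (meson Ck_on_cong)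

lemma smooth_on_local:
  "(\<And>x. x \<in> S \<Longrightarrow> \<exists>U. open U \<and> x \<in> U \<and> smooth_on U f) \<Longrightarrow> smooth_on S f"
  unfolding smooth_on_def by (rule allI, rule Ck_on_local) blast

lemma smooth_on_imp_continuous_on: "smooth_on S f \<Longrightarrow> continuous_on S f"
  unfolding smooth_on_def using Ck_on_imp_continuous_on[of 0] by blast

lemma smooth_on_imp_differentiable: "smooth_on S f \<Longrightarrow> x \<in> S \<Longrightarrow> f differentiable at x"
  unfolding smooth_on_def using Ck_on.simps(2) by blast

lemma smooth_on_has_derivative:
  "smooth_on S f \<Longrightarrow> x \<in> S \<Longrightarrow> (f has_derivative frechet_derivative f (at x)) (at x)"
  by (simp add: frechet_derivative_works[symmetric] smooth_on_imp_differentiable)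

lemma smooth_on_frechet_derivative: "smooth_on S f \<Longrightarrow> smooth_on S (\<lambda>x. frechet_derivative f (at x) v)"
  unfolding smooth_on_def using Ck_on.simps(2) by blast

lemma smooth_on_const: "smooth_on S (\<lambda>x. c)"
  by (simp add: smooth_on_def Ck_on_const)

lemma smooth_on_bounded_linear: "bounded_linear L \<Longrightarrow> smooth_on S L"
  by (simp add: smooth_on_def Ck_on_bounded_linear)

lemma smooth_on_bounded_linear_compose:
  "bounded_linear L \<Longrightarrow> open S \<Longrightarrow> smooth_on S f \<Longrightarrow> smooth_on S (\<lambda>x. L (f x))"
  by (simp add: smooth_on_def Ck_on_bounded_linear_compose)

lemma smooth_on_id: "smooth_on S (\<lambda>x. x)"
  by (rule smooth_on_bounded_linear) (rule bounded_linear_ident)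

lemma smooth_on_add: "open S \<Longrightarrow> smooth_on S f \<Longrightarrow> smooth_on S g \<Longrightarrow> smooth_on S (\<lambda>x. f x + g x)"
  by (simp add: smooth_on_def Ck_on_add)

lemma smooth_on_minus: "open S \<Longrightarrow> smooth_on S f \<Longrightarrow> smooth_on S (\<lambda>x. - f x)"
  by (rule smooth_on_bounded_linear_compose[OF bounded_linear_minus[OF bounded_linear_ident]])

lemma smooth_on_diff: "open S \<Longrightarrow> smooth_on S f \<Longrightarrow> smooth_on S g \<Longrightarrow> smooth_on S (\<lambda>x. f x - g x)"
  using smooth_on_add[OF _ _ smooth_on_minus] by fastforce

lemma smooth_on_scaleR:
  "open S \<Longrightarrow> smooth_on S f \<Longrightarrow> smooth_on S g \<Longrightarrow> smooth_on S (\<lambda>x. f x *\<^sub>R g x)"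
  by (simp add: smooth_on_def Ck_on_bilinear[OF bounded_bilinear_scaleR])

lemma smooth_on_mult:
  fixes f g :: "_ \<Rightarrow> real"
  shows "open S \<Longrightarrow> smooth_on S f \<Longrightarrow> smooth_on S g \<Longrightarrow> smooth_on S (\<lambda>x. f x * g x)"
  by (simp add: smooth_on_def Ck_on_bilinear[OF bounded_bilinear_mult])

lemma smooth_on_inner:
  "open S \<Longrightarrow> smooth_on S f \<Longrightarrow> smooth_on S g \<Longrightarrow> smooth_on S (\<lambda>x. f x \<bullet> g x)"
  by (simp add: smooth_on_def Ck_on_bilinear[OF bounded_bilinear_inner])

lemma smooth_on_sum:
  "open S \<Longrightarrow> (\<And>i. i \<in> I \<Longrightarrow> smooth_on S (f i)) \<Longrightarrow> smooth_on S (\<lambda>x. \<Sum>i\<in>I. f i x)"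
  by (simp add: smooth_on_def Ck_on_sum)

lemma smooth_on_prod:
  fixes f :: "_ \<Rightarrow> _ \<Rightarrow> real"
  shows "open S \<Longrightarrow> (\<And>i. i \<in> I \<Longrightarrow> smooth_on S (f i)) \<Longrightarrow> smooth_on S (\<lambda>x. \<Prod>i\<in>I. f i x)"
  by (induction I rule: infinite_finite_induct) (simp_all add: smooth_on_const smooth_on_mult)

lemma smooth_on_power:
  fixes f :: "_ \<Rightarrow> real"
  shows "open S \<Longrightarrow> smooth_on S f \<Longrightarrow> smooth_on S (\<lambda>x. f x ^ n)"
  by (induction n) (simp_all add: smooth_on_const smooth_on_mult)

lemma smooth_on_inverse:
  fixes f :: "_ \<Rightarrow> real"
  shows "open S \<Longrightarrow> smooth_on S f \<Longrightarrow> (\<And>x. x \<in> S \<Longrightarrow> f x \<noteq> 0) \<Longrightarrow> smooth_on S (\<lambda>x. inverse (f x))"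
  by (simp add: smooth_on_def Ck_on_inverse)

lemma smooth_on_divide:
  fixes f g :: "_ \<Rightarrow> real"
  shows "open S \<Longrightarrow> smooth_on S f \<Longrightarrow> smooth_on S g \<Longrightarrow> (\<And>x. x \<in> S \<Longrightarrow> g x \<noteq> 0) \<Longrightarrow>
    smooth_on S (\<lambda>x. f x / g x)"
  unfolding divide_inverse by (intro smooth_on_mult smooth_on_inverse)

lemma smooth_on_sqrt:
  "open S \<Longrightarrow> smooth_on S f \<Longrightarrow> (\<And>x. x \<in> S \<Longrightarrow> f x > 0) \<Longrightarrow> smooth_on S (\<lambda>x. sqrt (f x))"
  by (simp add: smooth_on_def Ck_on_sqrt)

lemma smooth_on_compose:
  "smooth_on T g \<Longrightarrow> open S \<Longrightarrow> open T \<Longrightarrow> smooth_on S f \<Longrightarrow> f ` S \<subseteq> T \<Longrightarrow> smooth_on S (\<lambda>x. g (f x))"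
  unfolding smooth_on_def using Ck_on_compose by blast

lemma smooth_on_vec_nth: "open S \<Longrightarrow> smooth_on S f \<Longrightarrow> smooth_on S (\<lambda>x. f x $ i)"
  by (rule smooth_on_bounded_linear_compose[OF bounded_linear_vec_nth])

lemma smooth_on_fst: "open S \<Longrightarrow> smooth_on S f \<Longrightarrow> smooth_on S (\<lambda>x. fst (f x))"
  by (rule smooth_on_bounded_linear_compose[OF bounded_linear_fst])

lemma smooth_on_snd: "open S \<Longrightarrow> smooth_on S f \<Longrightarrow> smooth_on S (\<lambda>x. snd (f x))"
  by (rule smooth_on_bounded_linear_compose[OF bounded_linear_snd])

lemma smooth_on_det:
  fixes M :: "_ \<Rightarrow> real^'n^'n"
  assumes "open S" "\<And>i j. smooth_on S (\<lambda>x. M x $ i $ j)"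
  shows "smooth_on S (\<lambda>x. det (M x))"
  unfolding det_def by (intro smooth_on_sum smooth_on_mult smooth_on_const smooth_on_prod assms)

section \<open>Inverse matrices\<close>

lemma invertible_matrix_inv:
  fixes M :: "real^'n^'n"
  assumes "invertible M"
  shows "M ** matrix_inv M = mat 1" "matrix_inv M ** M = mat 1"
  using someI_ex[OF assms[unfolded invertible_def]] by (simp_all add: matrix_inv_def)

text \<open>Cramer's rule for the columns of the inverse. It exhibits the entries as quotients of
  determinants, hence as smooth functions of the entries of the matrix.\<close>

lemma matrix_inv_nth:
  fixes M :: "real^'n^'n"
  assumes "det M \<noteq> 0"
  shows "matrix_inv M $ k $ l = det (\<chi> i j. if j = k then axis l 1 $ i else M $ i $ j) / det M"
proof -
  have inv: "invertible M" using assms by (simp add: invertible_det_nz)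
  have "M *v (matrix_inv M *v axis l 1) = axis l 1"
    using invertible_matrix_inv(1)[OF inv] by (simp add: matrix_vector_mul_assoc)
  then have "matrix_inv M *v axis l 1 =
      (\<chi> k. det (\<chi> i j. if j = k then axis l 1 $ i else M $ i $ j) / det M)"
    using cramer[OF assms] by blast
  then show ?thesis
    by (metis (no_types, lifting) matrix_vector_mult_basis column_def vec_lambda_beta)
qed

lemma smooth_on_matrix_inv:
  fixes M :: "_ \<Rightarrow> real^'n^'n"
  assumes "open S" "\<And>i j. smooth_on S (\<lambda>x. M x $ i $ j)" "\<And>x. x \<in> S \<Longrightarrow> det (M x) \<noteq> 0"
  shows "smooth_on S (\<lambda>x. matrix_inv (M x) $ k $ l)"
proof (rule smooth_on_cong[OF assms(1)])
  show "det (\<chi> i j. if j = k then axis l 1 $ i else M x $ i $ j) / det (M x) = matrix_inv (M x) $ k $ l"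
    if "x \<in> S" for x using matrix_inv_nth[OF assms(3)[OF that]] by simp
  have "smooth_on S (\<lambda>x. if j = k then axis l 1 $ i else M x $ i $ j)" for i j
    using assms(2) by (cases "j = k") (auto intro: smooth_on_const)
  then show "smooth_on S (\<lambda>x. det (\<chi> i j. if j = k then axis l 1 $ i else M x $ i $ j) / det (M x))"
    by (intro smooth_on_divide smooth_on_det assms) (auto simp: assms)
qed

section \<open>Partial derivatives and bump functions\<close>

lemma partial_eqI: "(f has_derivative f') (at x) \<Longrightarrow> partial i f x = f' (axis i 1)"
  unfolding partial_def using frechet_derivative_at[of f f' x] by simp

lemma frechet_derivative_partial:
  assumes "f differentiable at x"
  shows "frechet_derivative f (at x) v = (\<Sum>i\<in>UNIV. v $ i *\<^sub>R partial i f x)"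
proof -
  have l: "linear (frechet_derivative f (at x))" using assms by (rule linear_frechet_derivative)
  have "frechet_derivative f (at x) v = frechet_derivative f (at x) (\<Sum>i\<in>UNIV. v $ i *\<^sub>R axis i 1)"
    using basis_expansion[of v] by (simp add: scalar_mult_eq_scaleR)
  then show ?thesis
    by (simp add: linear_sum[OF l] linear_scale[OF l] partial_def)
qed

lemma has_derivative_partial:
  assumes "f differentiable at x"
  shows "(f has_derivative (\<lambda>v. \<Sum>i\<in>UNIV. v $ i *\<^sub>R partial i f x)) (at x)"
  unfolding frechet_derivative_partial[OF assms, symmetric] using assms by (simp add: frechet_derivative_works)

lemma smooth_on_partial: "smooth_on S f \<Longrightarrow> smooth_on S (partial i f)"
  unfolding partial_def by (rule smooth_on_frechet_derivative)

lemma differentiable_vec_nth: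
  "F differentiable at x \<Longrightarrow> (\<lambda>y. F y $ a) differentiable at x"
  unfolding differentiable_def using bounded_linear.has_derivative[OF bounded_linear_vec_nth] by blast

lemma partial_vec_nth:
  assumes "F differentiable at x"
  shows "partial i F x $ a = partial i (\<lambda>y. F y $ a) x"
proof -
  have "(F has_derivative frechet_derivative F (at x)) (at x)"
    using assms by (simp add: frechet_derivative_works)
  from bounded_linear.has_derivative[OF bounded_linear_vec_nth this, of a]
  show ?thesis by (simp add: partial_eqI) (simp add: partial_def)
qed

lemma partial_cong:
  assumes "open U" "x \<in> U" "\<And>y. y \<in> U \<Longrightarrow> f y = g y" "f differentiable at x"
  shows "partial i f x = partial i g x"
  unfolding partial_def using frechet_derivative_transform_within_open[OF assms(4,1,2,3)] by simp

lemma partial_const [simp]: "partial i (\<lambda>y. c) x = 0"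
  by (subst partial_eqI[where f' = "\<lambda>v. 0"]) auto

lemma partial_id_nth [simp]: "partial i (\<lambda>y. y $ a) x = (if i = a then 1 else 0)"
  by (subst partial_eqI[where f' = "\<lambda>v. v $ a"])
     (auto intro!: bounded_linear_imp_has_derivative bounded_linear_vec_nth simp: axis_def)

lemma partial_add:
  assumes "f differentiable at x" "g differentiable at x"
  shows "partial i (\<lambda>y. f y + g y) x = partial i f x + partial i g x"
  using partial_eqI[OF has_derivative_add[OF assms[unfolded frechet_derivative_works]]]
  by (simp add: partial_def)

lemma partial_diff:
  assumes "f differentiable at x" "g differentiable at x"
  shows "partial i (\<lambda>y. f y - g y) x = partial i f x - partial i g x"
  using partial_eqI[OF has_derivative_diff[OF assms[unfolded frechet_derivative_works]]]
  by (simp add: partial_def)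

lemma partial_mult:
  fixes f g :: "real^'n \<Rightarrow> real"
  assumes "f differentiable at x" "g differentiable at x"
  shows "partial i (\<lambda>y. f y * g y) x = partial i f x * g x + f x * partial i g x"
  using partial_eqI[OF has_derivative_mult[OF assms[unfolded frechet_derivative_works]]]
  by (simp add: partial_def)

lemma partial_sum:
  assumes "\<And>b. b \<in> I \<Longrightarrow> f b differentiable at x"
  shows "partial i (\<lambda>y. \<Sum>b\<in>I. f b y) x = (\<Sum>b\<in>I. partial i (f b) x)"
  using partial_eqI[OF has_derivative_sum[of I f "\<lambda>b. frechet_derivative (f b) (at x)" "at x"]] assms
  by (simp add: partial_def frechet_derivative_works)

lemma partial_compose_vector:
  fixes F :: "real^'m \<Rightarrow> real^'n" and S :: "real^'n \<Rightarrow> 'b::real_normed_vector"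
  assumes "F differentiable at x" "S differentiable at (F x)"
  shows "partial i (\<lambda>y. S (F y)) x = (\<Sum>b\<in>UNIV. partial i F x $ b *\<^sub>R partial b S (F x))"
proof -
  have "((S \<circ> F) has_derivative (frechet_derivative S (at (F x)) \<circ> frechet_derivative F (at x))) (at x)"
    using assms by (intro diff_chain_at) (simp_all add: frechet_derivative_works)
  from partial_eqI[OF this, of i]
  have "partial i (\<lambda>y. S (F y)) x = frechet_derivative S (at (F x)) (partial i F x)"
    by (simp add: o_def partial_def[of i F])
  then show ?thesis by (simp add: frechet_derivative_partial[OF assms(2)])
qed

lemma partial_compose:
  fixes F :: "real^'m \<Rightarrow> real^'n" and f :: "real^'n \<Rightarrow> real"
  assumes "F differentiable at x" "f differentiable at (F x)"
  shows "partial i (\<lambda>y. f (F y)) x = (\<Sum>b\<in>UNIV. partial b f (F x) * partial i (\<lambda>y. F y $ b) x)"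
  by (simp add: partial_compose_vector[OF assms] partial_vec_nth[OF assms(1)] mult.commute)

section \<open>Symmetry of second derivatives\<close>

lemma smooth_on_has_real_derivative_line:
  fixes f :: "'a::euclidean_space \<Rightarrow> real"
  assumes "smooth_on U f" "x + t *\<^sub>R v \<in> U"
  shows "((\<lambda>t. f (x + t *\<^sub>R v)) has_real_derivative frechet_derivative f (at (x + t *\<^sub>R v)) v) (at t)"
proof -
  have l: "((\<lambda>t. x + t *\<^sub>R v) has_derivative (\<lambda>d. 0 + d *\<^sub>R v)) (at t)"
    by (intro has_derivative_add has_derivative_const has_derivative_scaleR_left has_derivative_ident)
  have "linear (frechet_derivative f (at (x + t *\<^sub>R v)))"
    using assms by (intro linear_frechet_derivative smooth_on_imp_differentiable)
  then have "frechet_derivative f (at (x + t *\<^sub>R v)) \<circ> (\<lambda>d. 0 + d *\<^sub>R v) =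
      (*) (frechet_derivative f (at (x + t *\<^sub>R v)) v)"
    by (auto simp: fun_eq_iff linear_scale)
  then show ?thesis
    using diff_chain_at[OF l smooth_on_has_derivative[OF assms]]
    by (simp add: has_field_derivative_def o_def)
qed

text \<open>The mean value theorem is applied twice, first in direction \<open>u\<close> to the
  difference of two parallel edges, then in direction \<open>v\<close> to the derivative. The second
  difference on the left is symmetric in \<open>u\<close> and \<open>v\<close>.\<close>

lemma second_difference_mean_value:
  fixes f :: "'a::euclidean_space \<Rightarrow> real"
  assumes U: "open U" and f: "smooth_on U f" and h: "h > 0"
    and sub: "\<And>s t. 0 \<le> s \<Longrightarrow> s \<le> h \<Longrightarrow> 0 \<le> t \<Longrightarrow> t \<le> h \<Longrightarrow> x + s *\<^sub>R u + t *\<^sub>R v \<in> U"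
  shows "\<exists>s t. 0 < s \<and> s < h \<and> 0 < t \<and> t < h \<and>
    f (x + h *\<^sub>R u + h *\<^sub>R v) - f (x + h *\<^sub>R u) - f (x + h *\<^sub>R v) + f x =
    h * (h * frechet_derivative (\<lambda>y. frechet_derivative f (at y) u) (at (x + s *\<^sub>R u + t *\<^sub>R v)) v)"
proof -
  let ?g = "\<lambda>s. f (x + h *\<^sub>R v + s *\<^sub>R u) - f (x + s *\<^sub>R u)"
  let ?D = "\<lambda>y. frechet_derivative f (at y) u"
  have "(?g has_real_derivative ?D (x + h *\<^sub>R v + s *\<^sub>R u) - ?D (x + s *\<^sub>R u)) (at s)"
    if "0 \<le> s" "s \<le> h" for s
    using sub[of s h] sub[of s 0] that h
    by (intro DERIV_diff smooth_on_has_real_derivative_line[OF f]) (auto simp: algebra_simps)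
  from MVT2[OF h this] obtain s where s: "0 < s" "s < h"
    "?g h - ?g 0 = h * (?D (x + h *\<^sub>R v + s *\<^sub>R u) - ?D (x + s *\<^sub>R u))" by auto
  have "((\<lambda>t. ?D (x + s *\<^sub>R u + t *\<^sub>R v)) has_real_derivative
      frechet_derivative ?D (at (x + s *\<^sub>R u + t *\<^sub>R v)) v) (at t)" if "0 \<le> t" "t \<le> h" for t
    using sub[of s t] s that by (intro smooth_on_has_real_derivative_line[OF smooth_on_frechet_derivative[OF f]]) auto
  from MVT2[OF h this] obtain t where t: "0 < t" "t < h"
    "?D (x + s *\<^sub>R u + h *\<^sub>R v) - ?D (x + s *\<^sub>R u + 0 *\<^sub>R v) =
      h * frechet_derivative ?D (at (x + s *\<^sub>R u + t *\<^sub>R v)) v" by auto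
  have "x + h *\<^sub>R v + s *\<^sub>R u = x + s *\<^sub>R u + h *\<^sub>R v" for s by (simp add: algebra_simps)
  with s t show ?thesis by (intro exI[of _ s] exI[of _ t]) (auto simp: algebra_simps)
qed

text \<open>Both mixed derivatives, each at some point of a small parallelogram, are given by the
  same second difference; continuity moves these points to \<open>x\<close>.\<close>

lemma frechet_derivative_commute:
  fixes f :: "'a::euclidean_space \<Rightarrow> real"
  assumes U: "open U" and f: "smooth_on U f" and x: "x \<in> U"
  shows "frechet_derivative (\<lambda>y. frechet_derivative f (at y) u) (at x) v =
         frechet_derivative (\<lambda>y. frechet_derivative f (at y) v) (at x) u"
proof -
  define P where "P u v y = frechet_derivative (\<lambda>y. frechet_derivative f (at y) u) (at y) v" for u v y
  have cont: "isCont (P u v) x" for u v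
  proof -
    have "continuous_on U (P u v)" unfolding P_def
      by (intro smooth_on_imp_continuous_on smooth_on_frechet_derivative f)
    then show ?thesis using U x continuous_on_eq_continuous_at by blast
  qed
  have "\<bar>P u v x - P v u x\<bar> \<le> 0 + e" if e: "e > 0" for e
  proof -
    have "\<forall>\<^sub>F y in nhds x. y \<in> U" using U x by (rule eventually_nhds_in_open)
    moreover have "\<forall>\<^sub>F y in nhds x. dist (P u v y) (P u v x) < e / 2" for u v
      using tendstoD[OF cont[of u v, unfolded isCont_def tendsto_at_iff_tendsto_nhds], of "e / 2"] e by simp
    ultimately have "\<forall>\<^sub>F y in nhds x. y \<in> U \<and> dist (P u v y) (P u v x) < e / 2 \<and> dist (P v u y) (P v u x) < e / 2"
      by (intro eventually_conj) auto
    then obtain d where d: "d > 0" and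
      near: "\<And>y. dist y x < d \<Longrightarrow> y \<in> U \<and> dist (P u v y) (P u v x) < e / 2 \<and> dist (P v u y) (P v u x) < e / 2"
      unfolding eventually_nhds_metric by blast
    \<comment> \<open>With this side length the parallelogram lies within distance \<open>d\<close>
      of \<open>x\<close>; the summand 1 keeps the denominator positive when both directions
      vanish.\<close>
    define h where "h = d / (2 * (norm u + norm v + 1))"
    have n: "norm u + norm v + 1 > 0" using norm_ge_zero[of u] norm_ge_zero[of v] by linarith
    have h: "h > 0" unfolding h_def using d n by simp
    have close: "dist (x + s *\<^sub>R u + t *\<^sub>R v) x < d" if "0 \<le> s" "s \<le> h" "0 \<le> t" "t \<le> h" for s t
    proof -
      have "norm (s *\<^sub>R u + t *\<^sub>R v) \<le> s * norm u + t * norm v"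
        using norm_triangle_ineq[of "s *\<^sub>R u" "t *\<^sub>R v"] that by simp
      also have "\<dots> \<le> h * norm u + h * norm v"
        using that by (intro add_mono mult_right_mono) auto
      also have "\<dots> < 2 * (h * (norm u + norm v + 1))"
        using h by (simp add: algebra_simps add_nonneg_pos)
      also have "\<dots> = d" unfolding h_def using n by (simp add: field_simps)
      finally show ?thesis by (simp add: dist_norm)
    qed
    have subU: "x + s *\<^sub>R u + t *\<^sub>R v \<in> U" "x + t *\<^sub>R v + s *\<^sub>R u \<in> U"
      if "0 \<le> s" "s \<le> h" "0 \<le> t" "t \<le> h" for s t
      using near[OF close[OF that]] by (auto simp: algebra_simps)
    obtain s t where st: "0 < s" "s < h" "0 < t" "t < h"
      "f (x + h *\<^sub>R u + h *\<^sub>R v) - f (x + h *\<^sub>R u) - f (x + h *\<^sub>R v) + f x = h * (h * P u v (x + s *\<^sub>R u + t *\<^sub>R v))"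
      using second_difference_mean_value[OF U f h subU(1)] unfolding P_def by blast
    obtain s' t' where st': "0 < s'" "s' < h" "0 < t'" "t' < h"
      "f (x + h *\<^sub>R v + h *\<^sub>R u) - f (x + h *\<^sub>R v) - f (x + h *\<^sub>R u) + f x = h * (h * P v u (x + s' *\<^sub>R v + t' *\<^sub>R u))"
      using second_difference_mean_value[OF U f h subU(2)] unfolding P_def by blast
    have "x + h *\<^sub>R u + h *\<^sub>R v = x + h *\<^sub>R v + h *\<^sub>R u" by (simp add: algebra_simps)
    then have "h * (h * P u v (x + s *\<^sub>R u + t *\<^sub>R v)) = h * (h * P v u (x + s' *\<^sub>R v + t' *\<^sub>R u))"
      using st(5) st'(5) by (simp only:)
    then have "P u v (x + s *\<^sub>R u + t *\<^sub>R v) = P v u (x + s' *\<^sub>R v + t' *\<^sub>R u)"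
      using h by simp
    moreover have "dist (P u v (x + s *\<^sub>R u + t *\<^sub>R v)) (P u v x) < e / 2"
      using near[OF close] st by simp
    moreover have "dist (P v u (x + s' *\<^sub>R v + t' *\<^sub>R u)) (P v u x) < e / 2"
      using near[OF close[of t' s']] st' by (simp add: algebra_simps)
    ultimately show ?thesis unfolding dist_real_def by linarith
  qed
  then have "\<bar>P u v x - P v u x\<bar> \<le> 0" by (rule field_le_epsilon)
  then show ?thesis by (simp add: P_def)
qed

lemma partial_commute:
  fixes f :: "real^'n \<Rightarrow> real"
  assumes "open U" "smooth_on U f" "x \<in> U"
  shows "partial i (partial j f) x = partial j (partial i f) x"
  unfolding partial_def using frechet_derivative_commute[OF assms] by blast

text \<open>The linear span of this family is closed under differentiation, so all members are smooth.\<close>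

definition flat :: "nat \<Rightarrow> real \<Rightarrow> real" where
  "flat n s = (if s > 0 then exp (- 1 / s) / s ^ n else 0)"

lemma flat_has_derivative:
  "(flat n has_real_derivative flat (n + 2) s - real n * flat (n + 1) s) (at s)"
proof (cases "s = 0")
  case True
  have "((\<lambda>h. (flat n h - flat n 0) / (h - 0)) \<longlongrightarrow> 0) (at_right 0)"
  proof (rule Lim_transform_eventually)
    \<comment> \<open>For y = 1/h the difference quotient is y^(n+1) / exp y, and the exponential
      wins.\<close>
    show "((\<lambda>h. inverse h ^ Suc n / exp (inverse h)) \<longlongrightarrow> 0) (at_right (0::real))"
      by (rule filterlim_compose[OF tendsto_power_div_exp_0 filterlim_inverse_at_top_right])
    show "\<forall>\<^sub>F h in at_right 0. inverse h ^ Suc n / exp (inverse h) = (flat n h - flat n 0) / (h - 0)"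
      by (simp add: flat_def eventually_at_filter exp_minus field_simps)
  qed
  moreover have "((\<lambda>h. (flat n h - flat n 0) / (h - 0)) \<longlongrightarrow> 0) (at_left 0)"
    by (rule Lim_transform_eventually[of "\<lambda>h. 0"]) (auto simp: flat_def eventually_at_filter)
  ultimately have "((\<lambda>h. (flat n h - flat n 0) / (h - 0)) \<longlongrightarrow> 0) (at 0)"
    by (simp add: filterlim_split_at)
  then show ?thesis using True by (simp add: has_field_derivative_iff flat_def)
next
  case False
  show ?thesis
  proof (cases "s > 0")
    case True
    have "((\<lambda>s. exp (- 1 / s) / s ^ n) has_real_derivative flat (n + 2) s - real n * flat (n + 1) s) (at s)"
      using True
      by (auto intro!: derivative_eq_intros simp: flat_def)
         (cases n; simp add: field_simps power2_eq_square)
    then show ?thesis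
      by (rule has_field_derivative_transform_within_open[where S = "{0<..}"]) (use True in \<open>auto simp: flat_def\<close>)
  next
    case neg: False
    have "((\<lambda>s. 0) has_real_derivative flat (n + 2) s - real n * flat (n + 1) s) (at s)"
      using neg by (auto simp: flat_def)
    then show ?thesis
      by (rule has_field_derivative_transform_within_open[where S = "{..<0}"])
         (use False neg in \<open>auto simp: flat_def\<close>)
  qed
qed

lemma smooth_on_flat: "smooth_on UNIV (flat n)"
proof -
  have "Ck_on k UNIV (flat n)" for k
  proof (induction k arbitrary: n)
    case 0
    have "isCont (flat n) s" for s using flat_has_derivative by (rule DERIV_isCont)
    then show ?case by (simp add: continuous_on_eq_continuous_at)
  next
    case (Suc k)
    show ?case
    proof (rule Ck_on_SucI)
      show "(flat n has_derivative (\<lambda>v. (flat (n + 2) s + - real n * flat (n + 1) s) * v)) (at s)" for s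
        using flat_has_derivative[of n s] by (simp add: has_field_derivative_def)
      show "Ck_on k UNIV (\<lambda>s. (flat (n + 2) s + - real n * flat (n + 1) s) * v)" for v
        by (intro Ck_on_bilinear[OF bounded_bilinear_mult] Ck_on_add Ck_on_const Suc) auto
    qed simp
  qed
  then show ?thesis by (simp add: smooth_on_def)
qed

lemma ex_bump:
  fixes x0 :: "'a::euclidean_space"
  assumes "r > 0"
  obtains \<eta> :: "'a \<Rightarrow> real" where "smooth_on UNIV \<eta>" "\<And>x. \<eta> x \<ge> 0" "\<And>x. \<eta> x \<le> 1" "\<eta> x0 > 0"
    "\<And>x. dist x x0 \<ge> r \<Longrightarrow> \<eta> x = 0"
proof
  \<comment> \<open>The squared distance keeps the argument smooth at \<open>x0\<close>; for s > 0
    the value exp(-1/s) lies between 0 and 1.\<close>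
  let ?\<eta> = "\<lambda>x. flat 0 (r\<^sup>2 - (x - x0) \<bullet> (x - x0))"
  show "smooth_on UNIV ?\<eta>"
    by (rule smooth_on_compose[OF smooth_on_flat])
       (auto intro!: smooth_on_diff smooth_on_inner smooth_on_const smooth_on_id)
  show "?\<eta> x \<ge> 0" "?\<eta> x \<le> 1" for x by (simp_all add: flat_def)
  show "?\<eta> x0 > 0" using assms by (simp add: flat_def)
  show "?\<eta> x = 0" if "dist x x0 \<ge> r" for x
  proof -
    have "r\<^sup>2 \<le> (norm (x - x0))\<^sup>2" using that assms by (intro power_mono) (auto simp: dist_norm)
    then show ?thesis by (simp add: flat_def power2_norm_eq_inner)
  qed
qed

section \<open>The Hessian of a map in coordinates\<close>

definition posdef :: "real^'n^'n \<Rightarrow> bool" where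
  "posdef M \<longleftrightarrow> transpose M = M \<and> (\<forall>v. v \<noteq> 0 \<longrightarrow> v \<bullet> (M *v v) > 0)"

definition metric_on :: "(real^'n) set \<Rightarrow> (real^'n \<Rightarrow> real^'n^'n) \<Rightarrow> bool" where
  "metric_on V K \<longleftrightarrow> open V \<and> smooth_on V K \<and> (\<forall>y\<in>V. posdef (K y))"

text \<open>The pullback condition in components, for arbitrary dimensions: it covers the immersion
  of the surface as well as coordinate changes, for which it is the transformation law of the
  metric.\<close>

definition isometric_on ::
  "(real^'m) set \<Rightarrow> (real^'m \<Rightarrow> real^'m^'m) \<Rightarrow> (real^'n \<Rightarrow> real^'n^'n) \<Rightarrow> (real^'m \<Rightarrow> real^'n) \<Rightarrow> bool" where
  "isometric_on U G K F \<longleftrightarrow>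
     (\<forall>y\<in>U. \<forall>i j. G y $ i $ j = metric_inner K (F y) (partial i F y) (partial j F y))"

lemma posdef_nth_commute: "posdef M \<Longrightarrow> M $ i $ j = M $ j $ i"
proof -
  assume "posdef M"
  then have "transpose M $ j $ i = M $ j $ i" by (simp add: posdef_def)
  then show ?thesis by (simp add: transpose_def)
qed

lemma posdef_invertible:
  fixes M :: "real^'n^'n"
  assumes "posdef M" shows "invertible M"
proof -
  have "v = 0" if "M *v v = 0" for v
    using assms that unfolding posdef_def by (metis inner_zero_right less_irrefl)
  then show ?thesis
    using invertible_left_inverse matrix_left_invertible_ker by blast
qed

lemma posdef_det: "posdef M \<Longrightarrow> det M \<noteq> 0"
  using posdef_invertible invertible_det_nz by blast

lemma matrix_inv_sums:
  fixes M :: "real^'n^'n"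
  assumes "invertible M"
  shows "(\<Sum>k\<in>UNIV. M $ i $ k * matrix_inv M $ k $ j) = (if i = j then 1 else 0)"
    "(\<Sum>k\<in>UNIV. matrix_inv M $ i $ k * M $ k $ j) = (if i = j then 1 else 0)"
proof -
  have "(M ** matrix_inv M) $ i $ j = mat 1 $ i $ j" "(matrix_inv M ** M) $ i $ j = mat 1 $ i $ j"
    by (simp_all add: invertible_matrix_inv assms)
  then show "(\<Sum>k\<in>UNIV. M $ i $ k * matrix_inv M $ k $ j) = (if i = j then 1 else 0)"
    "(\<Sum>k\<in>UNIV. matrix_inv M $ i $ k * M $ k $ j) = (if i = j then 1 else 0)"
    by (simp_all add: matrix_matrix_mult_def mat_def)
qed

lemma metric_inner_sum: "metric_inner K y u v = (\<Sum>a\<in>UNIV. \<Sum>b\<in>UNIV. K y $ a $ b * u $ a * v $ b)"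
  by (simp add: metric_inner_def inner_vec_def matrix_vector_mult_def sum_distrib_left mult_ac)

lemma metric_inner_linear:
  "metric_inner K y (u + u') v = metric_inner K y u v + metric_inner K y u' v"
  "metric_inner K y (u - u') v = metric_inner K y u v - metric_inner K y u' v"
  "metric_inner K y u (v + v') = metric_inner K y u v + metric_inner K y u v'"
  "metric_inner K y u (v - v') = metric_inner K y u v - metric_inner K y u v'"
  "metric_inner K y (c *\<^sub>R u) v = c * metric_inner K y u v"
  "metric_inner K y u (c *\<^sub>R v) = c * metric_inner K y u v"
  by (simp_all add: metric_inner_def inner_add_left inner_diff_left matrix_vector_right_distrib
      matrix_vector_mult_diff_distrib inner_add_right inner_diff_right matrix_vector_mult_scaleR)

lemma metric_inner_sum_left: "metric_inner K y (\<Sum>i\<in>I. f i) v = (\<Sum>i\<in>I. metric_inner K y (f i) v)"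
  by (simp add: metric_inner_def inner_sum_left)

lemma metric_inner_sum_right: "metric_inner K y v (\<Sum>i\<in>I. f i) = (\<Sum>i\<in>I. metric_inner K y v (f i))"
  by (induction I rule: infinite_finite_induct) (simp_all add: metric_inner_linear, simp_all add: metric_inner_def)

lemma metric_inner_commute: "posdef (K y) \<Longrightarrow> metric_inner K y u v = metric_inner K y v u"
  unfolding metric_inner_sum
  by (subst sum.swap) (simp add: posdef_nth_commute[of "K y"] mult_ac)

lemma metric_inner_pos: "posdef (K y) \<Longrightarrow> v \<noteq> 0 \<Longrightarrow> metric_inner K y v v > 0"
  by (simp add: posdef_def metric_inner_def)

lemma metric_inner_eq_0: "posdef (K y) \<Longrightarrow> metric_inner K y v v = 0 \<Longrightarrow> v = 0"
  using metric_inner_pos by fastforce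

text \<open>\<open>dmetric K y u\<close> is the derivative of the bilinear form \<open>K\<close> in direction \<open>u\<close>, and \<open>gam\<close> is the bilinear
  map whose components are the Christoffel symbols.\<close>

definition dmetric :: "(real^'n \<Rightarrow> real^'n^'n) \<Rightarrow> real^'n \<Rightarrow> real^'n \<Rightarrow> real^'n \<Rightarrow> real^'n \<Rightarrow> real" where
  "dmetric K y u v w = (\<Sum>c\<in>UNIV. \<Sum>a\<in>UNIV. \<Sum>b\<in>UNIV. partial c (\<lambda>y. K y $ a $ b) y * u $ c * v $ a * w $ b)"

definition gam :: "(real^'n \<Rightarrow> real^'n^'n) \<Rightarrow> real^'n \<Rightarrow> real^'n \<Rightarrow> real^'n \<Rightarrow> real^'n" where
  "gam K y u v = (\<chi> a. \<Sum>b\<in>UNIV. \<Sum>c\<in>UNIV. christoffel K y a b c * u $ b * v $ c)"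

lemma metric_on_differentiable:
  assumes "metric_on V K" "y \<in> V"
  shows "K differentiable at y" "(\<lambda>y. K y $ a $ b) differentiable at y"
  using assms by (auto simp: metric_on_def intro!: differentiable_vec_nth smooth_on_imp_differentiable)

lemma metric_on_posdef: "metric_on V K \<Longrightarrow> y \<in> V \<Longrightarrow> posdef (K y)"
  by (simp add: metric_on_def)

lemma partial_metric_commute:
  assumes "metric_on V K" "y \<in> V"
  shows "partial c (\<lambda>y. K y $ a $ b) y = partial c (\<lambda>y. K y $ b $ a) y"
  using assms by (intro partial_cong[of V]) (auto simp: metric_on_def posdef_nth_commute
      intro!: metric_on_differentiable[OF assms])

lemma dmetric_commute:
  assumes "metric_on V K" "y \<in> V"
  shows "dmetric K y u v w = dmetric K y u w v"
  unfolding dmetric_def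
  by (subst (2) sum.swap) (simp add: partial_metric_commute[OF assms, of _ _ _] mult_ac)

section \<open>The Levi-Civita connection and the induced connection\<close>

lemma christoffel_commute:
  assumes "metric_on V K" "y \<in> V"
  shows "christoffel K y k i j = christoffel K y k j i"
  unfolding christoffel_def partial_metric_commute[OF assms, of _ i j] by (simp add: add.commute)

lemma gam_commute:
  assumes "metric_on V K" "y \<in> V"
  shows "gam K y u v = gam K y v u"
  unfolding gam_def
  by (subst sum.swap) (simp add: christoffel_commute[OF assms] mult_ac)

text \<open>Lowering the upper index cancels the inverse matrix and leaves the Christoffel symbols
  of the first kind.\<close>

lemma christoffel_lower:
  assumes "metric_on V K" "y \<in> V"
  shows "(\<Sum>a\<in>UNIV. K y $ d $ a * christoffel K y a b c) =
    1/2 * (partial b (\<lambda>y. K y $ c $ d) y + partial c (\<lambda>y. K y $ b $ d) y - partial d (\<lambda>y. K y $ b $ c) y)"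
proof -
  let ?P = "\<lambda>l. partial b (\<lambda>y. K y $ c $ l) y + partial c (\<lambda>y. K y $ b $ l) y - partial l (\<lambda>y. K y $ b $ c) y"
  have "(\<Sum>a\<in>UNIV. K y $ d $ a * christoffel K y a b c) =
    (\<Sum>a\<in>UNIV. \<Sum>l\<in>UNIV. 1/2 * (K y $ d $ a * matrix_inv (K y) $ a $ l * ?P l))"
    unfolding christoffel_def by (simp add: sum_distrib_left mult_ac)
  also have "\<dots> = (\<Sum>l\<in>UNIV. 1/2 * ((\<Sum>a\<in>UNIV. K y $ d $ a * matrix_inv (K y) $ a $ l) * ?P l))"
    by (subst sum.swap) (simp add: sum_distrib_left sum_distrib_right)
  also have "\<dots> = (\<Sum>l\<in>UNIV. if d = l then 1/2 * ?P l else 0)"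
    by (rule sum.cong) (simp_all add: matrix_inv_sums(1)[OF posdef_invertible[OF metric_on_posdef[OF assms]]])
  finally show ?thesis by simp
qed

text \<open>The Koszul formula for constant vector fields: the three terms of the lowered
  Christoffel symbols become values of \<open>dmetric\<close>.\<close>

lemma metric_inner_gam:
  assumes "metric_on V K" "y \<in> V"
  shows "metric_inner K y (gam K y u v) w = 1/2 * (dmetric K y u v w + dmetric K y v u w - dmetric K y w u v)"
proof -
  let ?g = "\<lambda>d a b c. K y $ d $ a * christoffel K y a b c"
  let ?t = "\<lambda>d b c. u $ b * v $ c * w $ d" and ?P = "\<lambda>c a b. partial c (\<lambda>y. K y $ a $ b) y"
  have "metric_inner K y (gam K y u v) w = (\<Sum>a\<in>UNIV. \<Sum>d\<in>UNIV. \<Sum>b\<in>UNIV. \<Sum>c\<in>UNIV. ?g d a b c * ?t d b c)"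
    unfolding metric_inner_sum gam_def
    by (simp add: sum_distrib_left sum_distrib_right posdef_nth_commute[OF metric_on_posdef[OF assms]] mult_ac)
  also have "\<dots> = (\<Sum>d\<in>UNIV. \<Sum>a\<in>UNIV. \<Sum>b\<in>UNIV. \<Sum>c\<in>UNIV. ?g d a b c * ?t d b c)"
    by (rule sum.swap)
  also have "\<dots> = (\<Sum>d\<in>UNIV. \<Sum>b\<in>UNIV. \<Sum>a\<in>UNIV. \<Sum>c\<in>UNIV. ?g d a b c * ?t d b c)"
    by (rule sum.cong[OF refl], rule sum.swap)
  also have "\<dots> = (\<Sum>d\<in>UNIV. \<Sum>b\<in>UNIV. \<Sum>c\<in>UNIV. \<Sum>a\<in>UNIV. ?g d a b c * ?t d b c)"
    by (rule sum.cong[OF refl], rule sum.cong[OF refl], rule sum.swap)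
  also have "\<dots> = (\<Sum>d\<in>UNIV. \<Sum>b\<in>UNIV. \<Sum>c\<in>UNIV. (\<Sum>a\<in>UNIV. ?g d a b c) * ?t d b c)"
    by (simp only: sum_distrib_right)
  also have "\<dots> = (\<Sum>d\<in>UNIV. \<Sum>b\<in>UNIV. \<Sum>c\<in>UNIV.
     1/2 * (?P b c d * u $ b * v $ c * w $ d + ?P c b d * v $ c * u $ b * w $ d - ?P d b c * w $ d * u $ b * v $ c))"
    unfolding christoffel_lower[OF assms] by (simp add: algebra_simps)
  also have "\<dots> = 1/2 * ((\<Sum>d\<in>UNIV. \<Sum>b\<in>UNIV. \<Sum>c\<in>UNIV. ?P b c d * u $ b * v $ c * w $ d)
     + (\<Sum>d\<in>UNIV. \<Sum>b\<in>UNIV. \<Sum>c\<in>UNIV. ?P c b d * v $ c * u $ b * w $ d)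
     - (\<Sum>d\<in>UNIV. \<Sum>b\<in>UNIV. \<Sum>c\<in>UNIV. ?P d b c * w $ d * u $ b * v $ c))"
    by (simp add: sum.distrib sum_subtractf sum_distrib_left[symmetric] sum_divide_distrib[symmetric])
  also have "(\<Sum>d\<in>UNIV. \<Sum>b\<in>UNIV. \<Sum>c\<in>UNIV. ?P b c d * u $ b * v $ c * w $ d) = dmetric K y u v w"
    unfolding dmetric_def by (subst sum.swap) (rule sum.cong[OF refl], rule sum.swap)
  also have "(\<Sum>d\<in>UNIV. \<Sum>b\<in>UNIV. \<Sum>c\<in>UNIV. ?P c b d * v $ c * u $ b * w $ d) =
     (\<Sum>d\<in>UNIV. \<Sum>c\<in>UNIV. \<Sum>b\<in>UNIV. ?P c b d * v $ c * u $ b * w $ d)"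
    by (rule sum.cong[OF refl], rule sum.swap)
  also have "\<dots> = dmetric K y v u w"
    unfolding dmetric_def by (subst sum.swap) (rule sum.cong[OF refl], rule sum.swap)
  also have "(\<Sum>d\<in>UNIV. \<Sum>b\<in>UNIV. \<Sum>c\<in>UNIV. ?P d b c * w $ d * u $ b * v $ c) = dmetric K y w u v"
    unfolding dmetric_def ..
  finally show ?thesis .
qed

text \<open>Metric compatibility of the connection: of the six terms of two Koszul formulas, the
  four that do not differentiate in direction \<open>u\<close> cancel by symmetry.\<close>

lemma metric_inner_gam_compatible:
  assumes "metric_on V K" "y \<in> V"
  shows "metric_inner K y (gam K y u v) w + metric_inner K y v (gam K y u w) = dmetric K y u v w"
proof -
  have "metric_inner K y v (gam K y u w) = metric_inner K y (gam K y u w) v"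
    by (rule metric_inner_commute) (rule metric_on_posdef[OF assms])
  then show ?thesis
    using dmetric_commute[OF assms, of u w v] dmetric_commute[OF assms, of w u v] dmetric_commute[OF assms, of v u w]
    by (simp add: metric_inner_gam[OF assms] field_simps)
qed

lemma cov_deriv_gam:
  assumes "F differentiable at x" "X differentiable at x"
  shows "cov_deriv K F X x i = partial i X x + gam K (F x) (partial i F x) (X x)"
  by (simp add: vec_eq_iff cov_deriv_def gam_def partial_vec_nth assms)

text \<open>The product rule for the induced connection. The chain rule brings in
  \<open>dmetric\<close> in direction dF, which metric compatibility splits into the Christoffel
  terms of the two covariant derivatives.\<close>

lemma partial_metric_inner:
  assumes K: "metric_on V K" "F x \<in> V"
    and d: "F differentiable at x" "X differentiable at x" "Y differentiable at x"
  shows "partial i (\<lambda>y. metric_inner K (F y) (X y) (Y y)) x =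
    metric_inner K (F x) (cov_deriv K F X x i) (Y x) + metric_inner K (F x) (X x) (cov_deriv K F Y x i)"
proof -
  note dn = differentiable_vec_nth[OF d(2)] differentiable_vec_nth[OF d(3)]
  have dK: "(\<lambda>y. K (F y) $ a $ b) differentiable at x" for a b
    using differentiable_chain_at[OF d(1) metric_on_differentiable(2)[OF K]] by (simp add: o_def)
  let ?dK = "\<lambda>a b. partial i (\<lambda>y. K (F y) $ a $ b) x * X x $ a * Y x $ b"
  let ?t = "\<lambda>a b c. partial c (\<lambda>y. K y $ a $ b) (F x) * partial i F x $ c * X x $ a * Y x $ b"
  have "partial i (\<lambda>y. metric_inner K (F y) (X y) (Y y)) x =
    (\<Sum>a\<in>UNIV. \<Sum>b\<in>UNIV. partial i (\<lambda>y. K (F y) $ a $ b * X y $ a * Y y $ b) x)"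
    unfolding metric_inner_sum
    by (subst partial_sum; intro sum.cong refl differentiable_sum ballI differentiable_mult dK dn finite_class.finite_UNIV)
      (intro partial_sum differentiable_mult dK dn)
  also have "\<dots> = (\<Sum>a\<in>UNIV. \<Sum>b\<in>UNIV. ?dK a b +
      K (F x) $ a $ b * partial i X x $ a * Y x $ b + K (F x) $ a $ b * X x $ a * partial i Y x $ b)"
    by (intro sum.cong refl)
       (simp add: partial_mult differentiable_mult dK dn partial_vec_nth[OF d(2)] partial_vec_nth[OF d(3)] algebra_simps)
  also have "\<dots> = (\<Sum>a\<in>UNIV. \<Sum>b\<in>UNIV. ?dK a b) +
      metric_inner K (F x) (partial i X x) (Y x) + metric_inner K (F x) (X x) (partial i Y x)"
    by (simp add: metric_inner_sum sum.distrib)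
  also have "(\<Sum>a\<in>UNIV. \<Sum>b\<in>UNIV. ?dK a b) = (\<Sum>a\<in>UNIV. \<Sum>b\<in>UNIV. \<Sum>c\<in>UNIV. ?t a b c)"
    by (simp add: partial_compose[OF d(1) metric_on_differentiable(2)[OF K]] sum_distrib_right partial_vec_nth[OF d(1)])
  also have "\<dots> = (\<Sum>a\<in>UNIV. \<Sum>c\<in>UNIV. \<Sum>b\<in>UNIV. ?t a b c)"
    by (rule sum.cong[OF refl], rule sum.swap)
  also have "\<dots> = dmetric K (F x) (partial i F x) (X x) (Y x)"
    unfolding dmetric_def by (rule sum.swap)
  also have "\<dots> = metric_inner K (F x) (gam K (F x) (partial i F x) (X x)) (Y x)
      + metric_inner K (F x) (X x) (gam K (F x) (partial i F x) (Y x))"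
    by (rule metric_inner_gam_compatible[OF K, symmetric])
  finally show ?thesis
    by (simp add: cov_deriv_gam d metric_inner_linear)
qed

section \<open>Hessians of maps and their composition\<close>

lemma hessian_map_cov_deriv:
  assumes F: "open U" "smooth_on U F" "x \<in> U"
  shows "hessian_map G K F x i j =
    cov_deriv K F (partial j F) x i - (\<Sum>k\<in>UNIV. christoffel G x k i j *\<^sub>R partial k F x)"
proof -
  have d: "F differentiable at y" if "y \<in> U" for y
    using F that smooth_on_imp_differentiable by blast
  have "partial i (partial j (\<lambda>y. F y $ a)) x = partial i (\<lambda>y. partial j F y $ a) x" for a
  proof (rule partial_cong[OF F(1,3)])
    show "partial j (\<lambda>y. F y $ a) y = partial j F y $ a" if "y \<in> U" for y
      using d[OF that] by (simp add: partial_vec_nth)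
    show "partial j (\<lambda>y. F y $ a) differentiable at x"
      using F by (intro smooth_on_imp_differentiable[of U] smooth_on_partial smooth_on_vec_nth)
  qed
  then show ?thesis
    by (simp add: vec_eq_iff hessian_map_def cov_deriv_def partial_vec_nth[OF d[OF F(3)]])
qed

lemma hessian_map_vector:
  assumes F: "open U" "smooth_on U F" "x \<in> U"
  shows "hessian_map G K F x i j = partial i (partial j F) x
     - (\<Sum>k\<in>UNIV. christoffel G x k i j *\<^sub>R partial k F x) + gam K (F x) (partial i F x) (partial j F x)"
  using F by (simp add: hessian_map_cov_deriv[OF F] cov_deriv_gam smooth_on_imp_differentiable[of U] smooth_on_partial)

lemma partial_commute_vector:
  fixes F :: "real^'m \<Rightarrow> real^'n"
  assumes F: "open U" "smooth_on U F" "x \<in> U"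
  shows "partial i (partial j F) x = partial j (partial i F) x"
proof -
  have d: "F differentiable at y" if "y \<in> U" for y
    using F that smooth_on_imp_differentiable by blast
  have "partial i (partial j F) x $ a = partial i (partial j (\<lambda>y. F y $ a)) x" for a i j
  proof -
    have d': "partial j F differentiable at x"
      using F by (intro smooth_on_imp_differentiable[of U] smooth_on_partial)
    have "partial i (\<lambda>y. partial j F y $ a) x = partial i (partial j (\<lambda>y. F y $ a)) x"
      by (rule partial_cong[OF F(1,3)]) (simp_all add: d partial_vec_nth differentiable_vec_nth d')
    then show ?thesis by (simp add: partial_vec_nth[OF d'])
  qed
  then show ?thesis
    using partial_commute[OF F(1) smooth_on_vec_nth[OF F(1,2)] F(3)] by (simp add: vec_eq_iff)
qed

text \<open>The induced connection and the connection of \<open>G\<close> have the same tangential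
  part, so their difference, the second fundamental form, is normal. For equal dimensions this will
  force it to vanish.\<close>

lemma hessian_map_isometric:
  fixes F :: "real^'m \<Rightarrow> real^'n"
  assumes F: "open U" "smooth_on U F" "x \<in> U" "F ` U \<subseteq> V" and K: "metric_on V K" and G: "metric_on U G"
    and iso: "isometric_on U G K F"
  shows "metric_inner K (F x) (hessian_map G K F x i j) (partial k F x) = 0"
proof -
  have FV: "F x \<in> V" using F by auto
  have d: "F differentiable at x" "partial i F differentiable at x" for i
    using F smooth_on_imp_differentiable smooth_on_partial by blast+
  have comm: "metric_inner K (F x) u v = metric_inner K (F x) v u" for u v
    by (rule metric_inner_commute) (rule metric_on_posdef[OF K FV])
  \<comment> \<open>Since \<open>D i j\<close> is symmetric, its tangential part is given by the Koszul formula.\<close>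
  define D where "D i j = cov_deriv K F (partial j F) x i" for i j
  have Dsym: "D i j = D j i" for i j
    unfolding D_def cov_deriv_gam[OF d] using partial_commute_vector[OF F(1,2,3)] gam_commute[OF K FV] by metis
  have dG: "partial k (\<lambda>y. G y $ i $ j) x =
      metric_inner K (F x) (D k i) (partial j F x) + metric_inner K (F x) (D k j) (partial i F x)" for i j k
  proof -
    have "partial k (\<lambda>y. G y $ i $ j) x = partial k (\<lambda>y. metric_inner K (F y) (partial i F y) (partial j F y)) x"
      using iso F by (intro partial_cong[of U]) (auto simp: isometric_on_def intro!: metric_on_differentiable[OF G])
    then show ?thesis
      by (simp add: partial_metric_inner[OF K FV d(1) d(2) d(2)] D_def comm)
  qed
  have "(\<Sum>a\<in>UNIV. christoffel G x a i j * metric_inner K (F x) (partial a F x) (partial k F x)) =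
      (\<Sum>a\<in>UNIV. G x $ k $ a * christoffel G x a i j)"
    using iso F(3) by (intro sum.cong refl) (simp add: isometric_on_def comm mult.commute)
  also have "\<dots> = metric_inner K (F x) (D i j) (partial k F x)"
    unfolding christoffel_lower[OF G F(3)] dG Dsym[of j i] Dsym[of k i] Dsym[of k j] by simp
  finally show ?thesis
    by (simp add: hessian_map_cov_deriv[OF F(1,2,3)] metric_inner_linear metric_inner_sum_left D_def)
qed

text \<open>Weingarten's equation, from differentiating the orthogonality of \<open>X\<close> to the
  tangent vectors. The metric \<open>G\<close> is arbitrary because its Christoffel symbols
  contribute only tangential vectors, which are orthogonal to \<open>X\<close>.\<close>

lemma metric_inner_cov_deriv_normal:
  assumes F: "open U" "smooth_on U F" "x \<in> U" "F ` U \<subseteq> V" and K: "metric_on V K"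
    and X: "smooth_on U X" "\<And>y i. y \<in> U \<Longrightarrow> metric_inner K (F y) (X y) (partial i F y) = 0"
  shows "metric_inner K (F x) (cov_deriv K F X x i) (partial j F x) = - metric_inner K (F x) (X x) (hessian_map G K F x i j)"
proof -
  have FV: "F x \<in> V" using F by auto
  have d: "F differentiable at x" "partial j F differentiable at x" "X differentiable at x"
    using F X smooth_on_imp_differentiable smooth_on_partial by blast+
  have "0 = partial i (\<lambda>y. 0 :: real) x" by simp
  also have "\<dots> = partial i (\<lambda>y. metric_inner K (F y) (X y) (partial j F y)) x"
    using F X(2) by (intro partial_cong[of U]) auto
  also have "\<dots> = metric_inner K (F x) (cov_deriv K F X x i) (partial j F x)
      + metric_inner K (F x) (X x) (cov_deriv K F (partial j F) x i)"
    by (rule partial_metric_inner[OF K FV d(1,3,2)])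
  finally show ?thesis
    using X(2)[OF F(3)] by (simp add: hessian_map_cov_deriv[OF F(1,2,3)] metric_inner_linear metric_inner_sum_right)
qed

lemma gam_sum:
  "gam K y (\<Sum>i\<in>I. a i *\<^sub>R u i) v = (\<Sum>i\<in>I. a i *\<^sub>R gam K y (u i) v)"
  "gam K y v (\<Sum>i\<in>I. a i *\<^sub>R u i) = (\<Sum>i\<in>I. a i *\<^sub>R gam K y v (u i))"
proof -
  have 1: "linear (\<lambda>u. gam K y u v)" "linear (gam K y v)" for v
    by (auto intro!: linearI simp: gam_def vec_eq_iff algebra_simps sum.distrib sum_distrib_left)
  show "gam K y (\<Sum>i\<in>I. a i *\<^sub>R u i) v = (\<Sum>i\<in>I. a i *\<^sub>R gam K y (u i) v)"
    using linear_sum[OF 1(1), of "\<lambda>i. a i *\<^sub>R u i" I v] by (simp add: linear_scale[OF 1(1)])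
  show "gam K y v (\<Sum>i\<in>I. a i *\<^sub>R u i) = (\<Sum>i\<in>I. a i *\<^sub>R gam K y v (u i))"
    using linear_sum[OF 1(2), of v "\<lambda>i. a i *\<^sub>R u i" I] by (simp add: linear_scale[OF 1(2)])
qed

lemma partial_scaleR:
  assumes "f differentiable at x" "g differentiable at x"
  shows "partial i (\<lambda>y. f y *\<^sub>R g y) x = partial i f x *\<^sub>R g x + f x *\<^sub>R partial i g x"
  using partial_eqI[OF has_derivative_scaleR[OF assms[unfolded frechet_derivative_works]]]
  by (simp add: partial_def)

text \<open>The Christoffel symbols of the intermediate metric \<open>K\<close> enter the two sums
  with opposite signs, so \<open>K\<close> can be chosen freely; later it is the metric of the
  surface or of the middle chart.\<close>

lemma hessian_map_compose:
  fixes F :: "real^'m \<Rightarrow> real^'n" and S :: "real^'n \<Rightarrow> real^'p"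
  assumes F: "open U" "smooth_on U F" "x \<in> U" "F ` U \<subseteq> V" and S: "open V" "smooth_on V S"
  shows "hessian_map G L (\<lambda>y. S (F y)) x i j =
    (\<Sum>b\<in>UNIV. hessian_map G K F x i j $ b *\<^sub>R partial b S (F x)) +
    (\<Sum>b\<in>UNIV. \<Sum>c\<in>UNIV. (partial i F x $ b * partial j F x $ c) *\<^sub>R hessian_map K L S (F x) b c)"
proof -
  have FV: "F x \<in> V" using F by auto
  have SF: "smooth_on U (\<lambda>y. S (F y))" by (rule smooth_on_compose[OF S(2) F(1) S(1) F(2,4)])
  have dF: "F differentiable at y" "partial j F differentiable at y"
     "(\<lambda>y. partial j F y $ b) differentiable at y" if "y \<in> U" for y j b
    using that by (auto intro!: differentiable_vec_nth smooth_on_imp_differentiable[OF F(2)]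
        smooth_on_imp_differentiable[OF smooth_on_partial[OF F(2)]])
  have dS: "S differentiable at (F y)" "partial b S differentiable at (F y)" if "y \<in> U" for y b
    using F(4) that by (auto intro!: smooth_on_imp_differentiable[OF S(2)]
        smooth_on_imp_differentiable[OF smooth_on_partial[OF S(2)]])
  have dSF: "(\<lambda>y. partial b S (F y)) differentiable at y" if "y \<in> U" for y b
    using differentiable_chain_at[OF dF(1) dS(2)] that by (simp add: o_def)
  have p: "partial j (\<lambda>y. S (F y)) y = (\<Sum>b\<in>UNIV. partial j F y $ b *\<^sub>R partial b S (F y))" if "y \<in> U" for y j
    by (rule partial_compose_vector[OF dF(1)[OF that] dS(1)[OF that]])
  have "partial i (partial j (\<lambda>y. S (F y))) x = partial i (\<lambda>y. \<Sum>b\<in>UNIV. partial j F y $ b *\<^sub>R partial b S (F y)) x"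
    by (rule partial_cong[OF F(1,3) p smooth_on_imp_differentiable[OF smooth_on_partial[OF SF] F(3)]])
  also have "\<dots> = (\<Sum>b\<in>UNIV. partial i (partial j F) x $ b *\<^sub>R partial b S (F x) +
      partial j F x $ b *\<^sub>R (\<Sum>c\<in>UNIV. partial i F x $ c *\<^sub>R partial c (partial b S) (F x)))"
    using F(3) by (subst partial_sum)
      (auto intro!: differentiable_scaleR dF dSF sum.cong simp: partial_scaleR dF dSF partial_vec_nth partial_compose_vector dS)
  also have "\<dots> = (\<Sum>b\<in>UNIV. partial i (partial j F) x $ b *\<^sub>R partial b S (F x)) +
     (\<Sum>c\<in>UNIV. \<Sum>b\<in>UNIV. (partial i F x $ b * partial j F x $ c) *\<^sub>R partial b (partial c S) (F x))"
    by (simp add: sum.distrib scaleR_sum_right mult.commute)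
  also have "(\<Sum>c\<in>UNIV. \<Sum>b\<in>UNIV. (partial i F x $ b * partial j F x $ c) *\<^sub>R partial b (partial c S) (F x)) =
     (\<Sum>b\<in>UNIV. \<Sum>c\<in>UNIV. (partial i F x $ b * partial j F x $ c) *\<^sub>R partial b (partial c S) (F x))"
    by (rule sum.swap)
  finally have 1: "partial i (partial j (\<lambda>y. S (F y))) x = (\<Sum>b\<in>UNIV. partial i (partial j F) x $ b *\<^sub>R partial b S (F x)) +
     (\<Sum>b\<in>UNIV. \<Sum>c\<in>UNIV. (partial i F x $ b * partial j F x $ c) *\<^sub>R partial b (partial c S) (F x))" .
  have 2: "gam L (S (F x)) (partial i (\<lambda>y. S (F y)) x) (partial j (\<lambda>y. S (F y)) x) =
     (\<Sum>b\<in>UNIV. \<Sum>c\<in>UNIV. (partial i F x $ b * partial j F x $ c) *\<^sub>R gam L (S (F x)) (partial b S (F x)) (partial c S (F x)))"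
    by (simp add: p[OF F(3)] gam_sum scaleR_sum_right) (subst sum.swap, simp add: mult.commute)
  \<comment> \<open>These are the contributions of \<open>K\<close> to the two sums; by this
    identity they cancel.\<close>
  have 3: "(\<Sum>b\<in>UNIV. \<Sum>c\<in>UNIV. (partial i F x $ b * partial j F x $ c) *\<^sub>R (\<Sum>k\<in>UNIV. christoffel K (F x) k b c *\<^sub>R partial k S (F x)))
     = (\<Sum>k\<in>UNIV. gam K (F x) (partial i F x) (partial j F x) $ k *\<^sub>R partial k S (F x))" (is "?l = ?r")
  proof -
    let ?t = "\<lambda>b c k. (christoffel K (F x) k b c * partial i F x $ b * partial j F x $ c) *\<^sub>R partial k S (F x)"
    have "?l = (\<Sum>b\<in>UNIV. \<Sum>c\<in>UNIV. \<Sum>k\<in>UNIV. ?t b c k)"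
      by (simp add: scaleR_sum_right mult_ac)
    also have "\<dots> = (\<Sum>b\<in>UNIV. \<Sum>k\<in>UNIV. \<Sum>c\<in>UNIV. ?t b c k)"
      by (rule sum.cong[OF refl], rule sum.swap)
    also have "\<dots> = (\<Sum>k\<in>UNIV. \<Sum>b\<in>UNIV. \<Sum>c\<in>UNIV. ?t b c k)"
      by (rule sum.swap)
    finally show ?thesis by (simp add: gam_def scaleR_sum_left)
  qed
  have 4: "(\<Sum>k\<in>UNIV. christoffel G x k i j *\<^sub>R partial k (\<lambda>y. S (F y)) x) =
     (\<Sum>b\<in>UNIV. (\<Sum>k\<in>UNIV. christoffel G x k i j *\<^sub>R partial k F x) $ b *\<^sub>R partial b S (F x))"
    by (simp add: p[OF F(3)] scaleR_sum_right scaleR_sum_left) (rule sum.swap)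
  show ?thesis
    unfolding hessian_map_vector[OF F(1) SF F(3)] hessian_map_vector[OF F(1-3)] hessian_map_vector[OF S FV] 1 2 4
    by (simp only: scaleR_left_distrib scaleR_left_diff_distrib scaleR_right_distrib scaleR_right_diff_distrib
      sum.distrib sum_subtractf vector_add_component vector_minus_component 3) simp
qed

section \<open>Tension fields\<close>

text \<open>A positive definite Gram matrix makes the vectors independent, hence spanning by their
  number, so \<open>Z\<close> is orthogonal to itself.\<close>

lemma orthogonal_to_frame_eq_0:
  fixes u :: "'n \<Rightarrow> real^'n" and Z :: "real^'n"
  assumes K: "posdef (K y)" and G: "posdef G" "\<And>i j. G $ i $ j = metric_inner K y (u i) (u j)"
    and Z: "\<And>k. metric_inner K y Z (u k) = 0"
  shows "Z = 0"
proof -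
  define L where "L c = (\<Sum>i\<in>UNIV. c $ i *\<^sub>R u i)" for c :: "real^'n"
  have lin: "linear L"
    unfolding L_def by (intro linearI) (simp_all add: scaleR_add_left sum.distrib scaleR_sum_right)
  have "c = 0" if "L c = 0" for c
  proof -
    have "c \<bullet> (G *v c) = metric_inner K y (L c) (L c)"
      unfolding L_def by (simp add: metric_inner_sum_left metric_inner_sum_right metric_inner_linear
          inner_vec_def matrix_vector_mult_def G(2) mult_ac metric_inner_commute[of K y, OF K])
    also have "\<dots> = 0" by (simp add: that metric_inner_def)
    finally show ?thesis using G(1) unfolding posdef_def by (metis less_irrefl)
  qed
  then have "inj L" using lin by (simp add: linear_injective_0)
  then have "surj L" using lin by (simp add: linear_injective_imp_surjective)
  then obtain c where c: "Z = L c" by (metis surjD)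
  have "metric_inner K y Z Z = (\<Sum>i\<in>UNIV. c $ i * metric_inner K y Z (u i))"
    by (subst (2) c) (simp add: L_def metric_inner_sum_right metric_inner_linear)
  also have "\<dots> = 0" by (simp add: Z)
  finally show ?thesis by (rule metric_inner_eq_0[of K y, OF K])
qed

text \<open>Two tangent vectors and the unit normal span the three-dimensional space. This is the
  place where codimension one enters.\<close>

lemma orthogonal_to_hypersurface_frame:
  fixes u :: "2 \<Rightarrow> real^3" and \<xi> Z :: "real^3"
  assumes K: "posdef (K y)" and G: "posdef G" "\<And>i j. G $ i $ j = metric_inner K y (u i) (u j)"
    and \<xi>: "metric_inner K y \<xi> \<xi> = 1" "\<And>k. metric_inner K y \<xi> (u k) = 0"
    and Z: "\<And>k. metric_inner K y Z (u k) = 0"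
  shows "Z = metric_inner K y Z \<xi> *\<^sub>R \<xi>"
proof -
  \<comment> \<open>The first two coefficients are gathered into a vector of the plane, to which
    positive definiteness of \<open>G\<close> can be applied.\<close>
  define L where "L c = (\<Sum>i\<in>UNIV. vector [c $ 1, c $ 2] $ i *\<^sub>R u i) + c $ 3 *\<^sub>R \<xi>" for c :: "real^3"
  have comm: "metric_inner K y v w = metric_inner K y w v" for v w by (rule metric_inner_commute) (rule K)
  have lin: "linear L"
    unfolding L_def by (intro linearI) (simp_all add: sum_2 scaleR_add_left scaleR_add_right)
  have "c = 0" if "L c = 0" for c
  proof -
    have "c $ 3 = metric_inner K y (L c) \<xi>"
      by (simp add: L_def sum_2 metric_inner_linear \<xi>(1) comm[of "u _" \<xi>] \<xi>(2))
    then have c3: "c $ 3 = 0" by (simp add: that metric_inner_def)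
    let ?c = "vector [c $ 1, c $ 2] :: real^2"
    have "?c \<bullet> (G *v ?c) = metric_inner K y (L c) (L c)"
      unfolding L_def c3 by (simp add: sum_2 metric_inner_linear inner_vec_def matrix_vector_mult_def G(2) algebra_simps)
    also have "\<dots> = 0" by (simp add: that metric_inner_def)
    finally have "?c = 0" using G(1) unfolding posdef_def by (metis less_irrefl)
    then have "?c $ 1 = 0" "?c $ 2 = 0" by simp_all
    then have "c $ 1 = 0" "c $ 2 = 0" by simp_all
    then show ?thesis using c3 by (simp add: vec_eq_iff forall_3)
  qed
  then have "inj L" using lin by (simp add: linear_injective_0)
  then have "surj L" using lin by (simp add: linear_injective_imp_surjective)
  define W where "W = Z - metric_inner K y Z \<xi> *\<^sub>R \<xi>"
  obtain c where c: "W = L c" using \<open>surj L\<close> by (metis surjD)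
  have W: "metric_inner K y W (u k) = 0" "metric_inner K y W \<xi> = 0" for k
    by (simp_all add: W_def metric_inner_linear Z \<xi>)
  have "metric_inner K y W W = metric_inner K y W (L c)" by (simp add: c)
  also have "\<dots> = 0" by (simp add: L_def sum_2 metric_inner_linear W)
  finally have "W = 0" by (rule metric_inner_eq_0[of K y, OF K])
  then show ?thesis by (simp add: W_def)
qed

text \<open>In equal dimensions no normal direction is left for the second fundamental form. Applied
  to coordinate changes, this makes the tension field independent of charts.\<close>

lemma hessian_map_isometry_eq_0:
  fixes F :: "real^'n \<Rightarrow> real^'n"
  assumes F: "open U" "smooth_on U F" "x \<in> U" "F ` U \<subseteq> V" and K: "metric_on V K" and G: "metric_on U G"
    and iso: "isometric_on U G K F"
  shows "hessian_map G K F x i j = 0"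
proof (rule orthogonal_to_frame_eq_0)
  show "posdef (K (F x))" using F K by (auto intro: metric_on_posdef)
  show "posdef (G x)" using F G by (auto intro: metric_on_posdef)
  show "G x $ i $ j = metric_inner K (F x) (partial i F x) (partial j F x)" for i j
    using iso F by (simp add: isometric_on_def)
  show "metric_inner K (F x) (hessian_map G K F x i j) (partial k F x) = 0" for k
    by (rule hessian_map_isometric[OF assms])
qed

lemma tension_compose:
  fixes F :: "real^'m \<Rightarrow> real^'n" and S :: "real^'n \<Rightarrow> real^'p"
  assumes F: "open U" "smooth_on U F" "x \<in> U" "F ` U \<subseteq> V" and S: "open V" "smooth_on V S"
  shows "tension G L (\<lambda>y. S (F y)) x =
    (\<Sum>b\<in>UNIV. tension G K F x $ b *\<^sub>R partial b S (F x)) +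
    (\<Sum>b\<in>UNIV. \<Sum>c\<in>UNIV. (\<Sum>i\<in>UNIV. \<Sum>j\<in>UNIV. matrix_inv (G x) $ i $ j * partial i F x $ b * partial j F x $ c)
       *\<^sub>R hessian_map K L S (F x) b c)"
proof -
  let ?t = "\<lambda>i j b. (matrix_inv (G x) $ i $ j * hessian_map G K F x i j $ b) *\<^sub>R partial b S (F x)"
  let ?q = "\<lambda>i j b c. matrix_inv (G x) $ i $ j * partial i F x $ b * partial j F x $ c"
  let ?h = "hessian_map K L S (F x)"
  have "tension G L (\<lambda>y. S (F y)) x = (\<Sum>i\<in>UNIV. \<Sum>j\<in>UNIV. \<Sum>b\<in>UNIV. ?t i j b) +
    (\<Sum>i\<in>UNIV. \<Sum>j\<in>UNIV. \<Sum>b\<in>UNIV. \<Sum>c\<in>UNIV. ?q i j b c *\<^sub>R ?h b c)"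
    unfolding tension_def hessian_map_compose[OF assms, of _ _ _ _ K]
    by (simp add: scaleR_add_right sum.distrib scaleR_sum_right mult.assoc)
  also have "(\<Sum>i\<in>UNIV. \<Sum>j\<in>UNIV. \<Sum>b\<in>UNIV. ?t i j b) = (\<Sum>i\<in>UNIV. \<Sum>b\<in>UNIV. \<Sum>j\<in>UNIV. ?t i j b)"
    by (rule sum.cong[OF refl], rule sum.swap)
  also have "\<dots> = (\<Sum>b\<in>UNIV. tension G K F x $ b *\<^sub>R partial b S (F x))"
    by (subst sum.swap) (simp add: tension_def scaleR_sum_left)
  also have "(\<Sum>i\<in>UNIV. \<Sum>j\<in>UNIV. \<Sum>b\<in>UNIV. \<Sum>c\<in>UNIV. ?q i j b c *\<^sub>R ?h b c)
    = (\<Sum>i\<in>UNIV. \<Sum>b\<in>UNIV. \<Sum>j\<in>UNIV. \<Sum>c\<in>UNIV. ?q i j b c *\<^sub>R ?h b c)"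
    by (rule sum.cong[OF refl], rule sum.swap)
  also have "\<dots> = (\<Sum>b\<in>UNIV. \<Sum>i\<in>UNIV. \<Sum>c\<in>UNIV. \<Sum>j\<in>UNIV. ?q i j b c *\<^sub>R ?h b c)"
    by (subst sum.swap) (rule sum.cong[OF refl], rule sum.cong[OF refl], rule sum.swap)
  also have "\<dots> = (\<Sum>b\<in>UNIV. \<Sum>c\<in>UNIV. (\<Sum>i\<in>UNIV. \<Sum>j\<in>UNIV. ?q i j b c) *\<^sub>R ?h b c)"
    by (rule sum.cong[OF refl], subst sum.swap) (simp add: scaleR_sum_left)
  finally show ?thesis .
qed

lemma tension_isometry_target:
  fixes F :: "real^'m \<Rightarrow> real^'n" and S :: "real^'n \<Rightarrow> real^'n"
  assumes F: "open U" "smooth_on U F" "x \<in> U" "F ` U \<subseteq> V" and S: "smooth_on V S" "S ` V \<subseteq> W"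
    and "metric_on V K" "metric_on W L" "isometric_on V K L S"
  shows "tension G L (\<lambda>y. S (F y)) x = (\<Sum>b\<in>UNIV. tension G K F x $ b *\<^sub>R partial b S (F x))"
proof -
  have V: "open V" using assms by (simp add: metric_on_def)
  have "hessian_map K L S (F x) b c = 0" for b c
    using assms V by (intro hessian_map_isometry_eq_0[of V S _ W]) auto
  then show ?thesis by (simp add: tension_compose[OF F V S(1), of G L K])
qed

text \<open>By the composition law only the contraction of the Hessian of \<open>F\<close> with dT
  remains, and dT turns the inverse of \<open>G\<close> into the inverse of
  \<open>G'\<close>.\<close>

lemma tension_isometry_source:
  fixes F :: "real^'m \<Rightarrow> real^'n" and T :: "real^'m \<Rightarrow> real^'m"
  assumes T: "smooth_on U T" "x \<in> U" "T ` U \<subseteq> V" and F: "smooth_on V F"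
    and U: "metric_on U G" and V: "metric_on V G'" and iso: "isometric_on U G G' T"
  shows "tension G K (\<lambda>y. F (T y)) x = tension G' K F (T x)"
proof -
  have o: "open U" "open V" using U V by (simp_all add: metric_on_def)
  have h0: "hessian_map G G' T x i j = 0" for i j
    using assms o by (intro hessian_map_isometry_eq_0[of U T _ V]) auto
  let ?J = "\<chi> b i. partial i T x $ b" and ?I = "matrix_inv (G x)" and ?H = "G' (T x)"
  have iG: "invertible (G x)" "invertible ?H"
    using T U V by (auto intro!: posdef_invertible metric_on_posdef)
  have "G x $ i $ j = (transpose ?J ** ?H ** ?J) $ i $ j" for i j
  proof -
    have "G x $ i $ j = metric_inner G' (T x) (partial i T x) (partial j T x)"
      using iso T by (simp add: isometric_on_def)
    also have "\<dots> = (\<Sum>b\<in>UNIV. \<Sum>a\<in>UNIV. ?H $ a $ b * partial i T x $ a * partial j T x $ b)"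
      unfolding metric_inner_sum by (rule sum.swap)
    finally show ?thesis
      by (simp add: matrix_matrix_mult_def transpose_def sum_distrib_left sum_distrib_right mult_ac)
  qed
  then have GJ: "G x = transpose ?J ** ?H ** ?J" by (simp add: vec_eq_iff)
  have "det (G x) = det ?J * det ?H * det ?J" unfolding GJ by (simp add: det_mul)
  then have "det ?J \<noteq> 0" using iG(1) by (auto simp: invertible_det_nz)
  then have iJ: "invertible ?J" by (simp add: invertible_det_nz)
  \<comment> \<open>From G = J^T H J the inverse metrics satisfy J G^-1 J^T = H^-1; this comes from
    cancelling first J and then H on the right.\<close>
  have "(?J ** ?I ** transpose ?J ** ?H) ** ?J = ?J ** (?I ** G x)"
    unfolding GJ by (simp add: matrix_mul_assoc)
  also have "\<dots> = ?J" by (simp add: invertible_matrix_inv iG)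
  finally have "(?J ** ?I ** transpose ?J ** ?H) ** ?J ** matrix_inv ?J = mat 1"
    by (simp add: invertible_matrix_inv iJ)
  then have "?J ** ?I ** transpose ?J ** ?H = mat 1"
    by (simp add: matrix_mul_assoc[symmetric] invertible_matrix_inv iJ)
  then have "?J ** ?I ** transpose ?J ** ?H ** matrix_inv ?H = matrix_inv ?H"
    by simp
  then have "?J ** ?I ** transpose ?J = matrix_inv ?H"
    by (simp add: matrix_mul_assoc[symmetric] invertible_matrix_inv iG)
  moreover have "(?J ** ?I ** transpose ?J) $ b $ c = (\<Sum>i\<in>UNIV. \<Sum>j\<in>UNIV. ?I $ i $ j * partial i T x $ b * partial j T x $ c)" for b c
    by (subst sum.swap) (simp add: matrix_matrix_mult_def transpose_def sum_distrib_left sum_distrib_right mult_ac)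
  ultimately have J: "(\<Sum>i\<in>UNIV. \<Sum>j\<in>UNIV. ?I $ i $ j * partial i T x $ b * partial j T x $ c) = matrix_inv ?H $ b $ c" for b c
    by simp
  have "tension G G' T x = 0" by (simp add: tension_def h0)
  then show ?thesis
    unfolding tension_compose[OF o(1) T(1-3) o(2) F, of G K G'] by (simp add: J) (simp add: tension_def)
qed

lemma metric_inner_isometry:
  assumes "isometric_on V K L S" "y \<in> V"
  shows "metric_inner L (S y) (\<Sum>b\<in>UNIV. u $ b *\<^sub>R partial b S y) (\<Sum>b\<in>UNIV. v $ b *\<^sub>R partial b S y) = metric_inner K y u v"
  using assms by (simp add: metric_inner_sum_left metric_inner_sum_right metric_inner_linear isometric_on_def
      metric_inner_sum[of K] sum_distrib_left mult_ac) (rule sum.swap)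

lemma hessian_map_cong:
  assumes "open U" "x \<in> U" "\<And>y. y \<in> U \<Longrightarrow> F y = F' y" "smooth_on U F"
  shows "hessian_map G K F x i j = hessian_map G K F' x i j"
proof -
  have F': "smooth_on U F'" by (rule smooth_on_cong[OF assms(1,3,4)])
  have p: "partial i F y = partial i F' y" if "y \<in> U" for y i
    by (rule partial_cong[OF assms(1) that assms(3) smooth_on_imp_differentiable[OF assms(4) that]])
  have "partial i (partial j F) x = partial i (partial j F') x"
    by (rule partial_cong[OF assms(1,2) p smooth_on_imp_differentiable[OF smooth_on_partial[OF assms(4)] assms(2)]])
  then show ?thesis
    by (simp add: hessian_map_vector[OF assms(1,4,2)] hessian_map_vector[OF assms(1) F' assms(2)] p[OF assms(2)] assms(2,3))
qed

lemma tension_cong: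
  assumes "open U" "x \<in> U" "\<And>y. y \<in> U \<Longrightarrow> F y = F' y" "smooth_on U F"
  shows "tension G K F x = tension G K F' x"
  using hessian_map_cong[OF assms] by (simp add: tension_def)

text \<open>Tracing Weingarten's equation replaces the shape operator by the tension field, whose
  behaviour under isometric coordinate changes is already known.\<close>

lemma trace_shape_matrix:
  assumes "open U" "smooth_on U F" "x \<in> U" "F ` U \<subseteq> V" "metric_on V K"
    and "smooth_on U X" "\<And>y i. y \<in> U \<Longrightarrow> metric_inner K (F y) (X y) (partial i F y) = 0"
  shows "trace (shape_matrix G K F X x) = metric_inner K (F x) (X x) (tension G K F x)"
  by (simp add: trace_def shape_matrix_def tension_def metric_inner_sum_right metric_inner_linear
      metric_inner_cov_deriv_normal[OF assms, of _ _ G] sum_negf)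

text \<open>The Hessian is normal, hence a multiple of \<open>X x\<close>. Its component is found by
  lowering an index of the shape matrix, which turns the identity matrix into
  \<open>G x\<close>.\<close>

lemma umbilical_hessian_map:
  fixes F :: "real^2 \<Rightarrow> real^3"
  assumes F: "open U" "smooth_on U F" "x \<in> U" "F ` U \<subseteq> V" and K: "metric_on V K"
    and X: "smooth_on U X" "\<And>y i. y \<in> U \<Longrightarrow> metric_inner K (F y) (X y) (partial i F y) = 0"
      "metric_inner K (F x) (X x) (X x) = 1"
    and G: "metric_on U G" and iso: "isometric_on U G K F"
    and umb: "shape_matrix G K F X x = l *\<^sub>R mat 1"
  shows "hessian_map G K F x i j = (l * G x $ i $ j) *\<^sub>R X x"
proof -
  have pd: "posdef (K (F x))" "posdef (G x)"
    using F K G by (auto intro: metric_on_posdef)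
  have comm: "metric_inner K (F x) u v = metric_inner K (F x) v u" for u v
    by (rule metric_inner_commute) (rule pd)
  define b where "b i k = metric_inner K (F x) (hessian_map G K F x i k) (X x)" for i k
  have Gb: "(\<Sum>k\<in>UNIV. matrix_inv (G x) $ j $ k * b i k) = (if j = i then l else 0)" for i j
    using arg_cong[OF umb, of "\<lambda>M. M $ j $ i"]
    by (simp add: shape_matrix_def metric_inner_cov_deriv_normal[OF F K X(1,2), of _ _ G] b_def comm[of "X x"] mat_def sum_negf)
  have "(\<Sum>j\<in>UNIV. G x $ m $ j * (\<Sum>k\<in>UNIV. matrix_inv (G x) $ j $ k * b i k)) = l * G x $ m $ i" for m i
    unfolding Gb by (simp add: if_distrib cong: if_cong)
  moreover have "(\<Sum>j\<in>UNIV. G x $ m $ j * (\<Sum>k\<in>UNIV. matrix_inv (G x) $ j $ k * b i k)) = b i m" for m i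
  proof -
    have "(\<Sum>j\<in>UNIV. G x $ m $ j * (\<Sum>k\<in>UNIV. matrix_inv (G x) $ j $ k * b i k)) =
      (\<Sum>k\<in>UNIV. (\<Sum>j\<in>UNIV. G x $ m $ j * matrix_inv (G x) $ j $ k) * b i k)"
      by (simp add: sum_distrib_left sum_distrib_right mult.assoc) (rule sum.swap)
    then show ?thesis
      by (simp add: matrix_inv_sums[OF posdef_invertible[OF pd(2)]] if_distrib[of "\<lambda>t. t * _"] cong: if_cong)
  qed
  ultimately have "b i j = l * G x $ i $ j"
    using posdef_nth_commute[OF pd(2)] by metis
  moreover have "hessian_map G K F x i j = metric_inner K (F x) (hessian_map G K F x i j) (X x) *\<^sub>R X x"
  proof (rule orthogonal_to_hypersurface_frame[of K "F x", OF pd])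
    show "G x $ i $ j = metric_inner K (F x) (partial i F x) (partial j F x)" for i j
      using iso F by (simp add: isometric_on_def)
    show "metric_inner K (F x) (hessian_map G K F x i j) (partial k F x) = 0" for k
      by (rule hessian_map_isometric[OF F K G iso])
  qed (use X F(3) in auto)
  ultimately show ?thesis by (simp add: b_def)
qed

section \<open>Independence of the charts\<close>

lemma chart_inv_snd: "is_chart \<kappa> \<Longrightarrow> p \<in> fst \<kappa> \<Longrightarrow> chart_inv \<kappa> (snd \<kappa> p) = p"
  by (simp add: is_chart_def homeomorphism_def)

lemma snd_chart_inv: "is_chart \<kappa> \<Longrightarrow> x \<in> chart_range \<kappa> \<Longrightarrow> snd \<kappa> (chart_inv \<kappa> x) = x"
  by (simp add: is_chart_def homeomorphism_def)

lemma chart_inv_in: "is_chart \<kappa> \<Longrightarrow> x \<in> chart_range \<kappa> \<Longrightarrow> chart_inv \<kappa> x \<in> fst \<kappa>"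
  by (auto simp: is_chart_def homeomorphism_def)

lemma chart_snd_in: "p \<in> fst \<kappa> \<Longrightarrow> snd \<kappa> p \<in> chart_range \<kappa>"
  by (simp add: chart_range_def)

lemma is_chart_open: "is_chart \<kappa> \<Longrightarrow> open (fst \<kappa>)" "is_chart \<kappa> \<Longrightarrow> open (chart_range \<kappa>)"
  by (simp_all add: is_chart_def)

lemma continuous_on_chart: "is_chart \<kappa> \<Longrightarrow> continuous_on (fst \<kappa>) (snd \<kappa>)"
  by (simp add: is_chart_def homeomorphism_def)

lemma continuous_on_chart_inv: "is_chart \<kappa> \<Longrightarrow> continuous_on (chart_range \<kappa>) (chart_inv \<kappa>)"
  by (simp add: is_chart_def homeomorphism_def)

lemma chart_image:
  "is_chart \<kappa> \<Longrightarrow> snd \<kappa> ` (fst \<kappa> \<inter> W) = chart_range \<kappa> \<inter> chart_inv \<kappa> -` W"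
  by (auto simp: chart_inv_snd chart_snd_in) (metis IntI chart_inv_in image_eqI snd_chart_inv)

lemma open_chart_image: "is_chart \<kappa> \<Longrightarrow> open W \<Longrightarrow> open (snd \<kappa> ` (fst \<kappa> \<inter> W))"
  unfolding chart_image
  by (intro continuous_open_preimage continuous_on_chart_inv is_chart_open)

lemma smooth_atlas_is_chart: "smooth_atlas A \<Longrightarrow> \<kappa> \<in> A \<Longrightarrow> is_chart \<kappa>"
  by (simp add: smooth_atlas_def)

lemma chart_at:
  assumes "smooth_atlas A" shows "chart_at A p \<in> A" "p \<in> fst (chart_at A p)"
proof -
  have "p \<in> (\<Union>\<kappa>\<in>A. fst \<kappa>)" using assms unfolding smooth_atlas_def by blast
  then have "\<exists>\<kappa>. \<kappa> \<in> A \<and> p \<in> fst \<kappa>" by blast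
  from someI_ex[OF this] show "chart_at A p \<in> A" "p \<in> fst (chart_at A p)" by (simp_all add: chart_at_def)
qed

lemma smooth_on_transition:
  "smooth_atlas A \<Longrightarrow> \<kappa> \<in> A \<Longrightarrow> \<kappa>' \<in> A \<Longrightarrow> smooth_on (snd \<kappa> ` (fst \<kappa> \<inter> fst \<kappa>')) (transition \<kappa> \<kappa>')"
  by (simp add: smooth_atlas_def)

lemma metric_on_chart:
  assumes "riemannian_manifold A g" "\<kappa> \<in> A"
  shows "metric_on (chart_range \<kappa>) (g \<kappa>)"
  using assms unfolding riemannian_manifold_def riemannian_metric_def metric_on_def posdef_def smooth_atlas_def
  by (simp add: is_chart_open)

lemma metric_on_subset: "metric_on V K \<Longrightarrow> open U \<Longrightarrow> U \<subseteq> V \<Longrightarrow> metric_on U K"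
  unfolding metric_on_def using smooth_on_subset by blast

lemma jacobian_nth: "jacobian F x $ a $ i = partial i F x $ a"
  by (simp add: jacobian_def matrix_def partial_def)

lemma isometric_onI:
  assumes "\<And>x. x \<in> U \<Longrightarrow> G x = transpose (jacobian F x) ** K (F x) ** jacobian F x"
  shows "isometric_on U G K F"
proof (unfold isometric_on_def, intro ballI allI)
  fix x i j assume "x \<in> U"
  have "metric_inner K (F x) (partial i F x) (partial j F x) =
    (\<Sum>b\<in>UNIV. \<Sum>a\<in>UNIV. K (F x) $ a $ b * partial i F x $ a * partial j F x $ b)"
    unfolding metric_inner_sum by (rule sum.swap)
  then show "G x $ i $ j = metric_inner K (F x) (partial i F x) (partial j F x)"
    by (simp add: assms[OF \<open>x \<in> U\<close>] matrix_matrix_mult_def transpose_def jacobian_nth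
       sum_distrib_left sum_distrib_right mult_ac)
qed

lemma isometric_on_transition:
  assumes "riemannian_manifold A g" "\<kappa> \<in> A" "\<kappa>' \<in> A"
  shows "isometric_on (snd \<kappa> ` (fst \<kappa> \<inter> fst \<kappa>')) (g \<kappa>) (g \<kappa>') (transition \<kappa> \<kappa>')"
  using assms unfolding riemannian_manifold_def riemannian_metric_def by (intro isometric_onI) blast

lemma isometric_on_local_rep:
  assumes "isometric_immersion A g B h \<phi>" "\<kappa> \<in> A" "\<nu> \<in> B"
  shows "isometric_on (snd \<kappa> ` (fst \<kappa> \<inter> \<phi> -` fst \<nu>)) (g \<kappa>) (h \<nu>) (local_rep \<kappa> \<nu> \<phi>)"
  using assms unfolding isometric_immersion_def by (intro isometric_onI) blast

lemma isometric_on_subset: "isometric_on V G K F \<Longrightarrow> U \<subseteq> V \<Longrightarrow> isometric_on U G K F"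
  by (auto simp: isometric_on_def)

lemma local_rep_snd: "is_chart \<kappa> \<Longrightarrow> p \<in> fst \<kappa> \<Longrightarrow> local_rep \<kappa> \<nu> f (snd \<kappa> p) = snd \<nu> (f p)"
  by (simp add: local_rep_def chart_inv_snd)

lemma transition_snd: "is_chart \<kappa> \<Longrightarrow> p \<in> fst \<kappa> \<Longrightarrow> transition \<kappa> \<kappa>' (snd \<kappa> p) = snd \<kappa>' p"
  by (simp add: transition_def chart_inv_snd)

lemma unit_normal_onD:
  assumes "unit_normal_on A B h \<phi> V \<xi>" "p \<in> V" "\<nu> \<in> B" "\<phi> p \<in> fst \<nu>"
  shows "\<kappa> \<in> A \<Longrightarrow> p \<in> fst \<kappa> \<Longrightarrow> metric_inner (h \<nu>) (snd \<nu> (\<phi> p)) (\<xi> \<nu> p) (\<xi> \<nu> p) = 1"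
    "\<kappa> \<in> A \<Longrightarrow> p \<in> fst \<kappa> \<Longrightarrow>
      metric_inner (h \<nu>) (snd \<nu> (\<phi> p)) (\<xi> \<nu> p) (partial i (local_rep \<kappa> \<nu> \<phi>) (snd \<kappa> p)) = 0"
    "\<nu>' \<in> B \<Longrightarrow> \<phi> p \<in> fst \<nu>' \<Longrightarrow> \<xi> \<nu>' p = jacobian (transition \<nu> \<nu>') (snd \<nu> (\<phi> p)) *v \<xi> \<nu> p"
  using assms unfolding unit_normal_on_def by blast+

section \<open>Maps between Riemannian manifolds in different charts\<close>

locale riemannian_map =
  fixes A :: "('p::{t2_space,second_countable_topology}, 'm::finite) chart set" and g
    and B :: "('q::{t2_space,second_countable_topology}, 'n::finite) chart set" and h
    and f :: "'p \<Rightarrow> 'q"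
  assumes M: "riemannian_manifold A g" and N: "riemannian_manifold B h" and f: "smooth_map A B f"
begin

lemma at: "smooth_atlas A" "smooth_atlas B"
  using M N by (simp_all add: riemannian_manifold_def)

lemma open_vimage_chart: "\<nu> \<in> B \<Longrightarrow> open (f -` fst \<nu>)"
  using f is_chart_open(1)[OF smooth_atlas_is_chart[OF at(2)]] by (simp add: smooth_map_def open_vimage)

lemma charts_at:
  obtains \<kappa> \<nu> where "\<kappa> \<in> A" "p \<in> fst \<kappa>" "\<nu> \<in> B" "f p \<in> fst \<nu>" "is_chart \<kappa>" "is_chart \<nu>"
  by (rule that[OF chart_at[OF at(1)] chart_at[OF at(2)] smooth_atlas_is_chart[OF at(1) chart_at(1)[OF at(1)]]
        smooth_atlas_is_chart[OF at(2) chart_at(1)[OF at(2)]]])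

lemma unit_normal_charts:
  fixes V \<xi> \<kappa> \<nu>
  defines "U \<equiv> snd \<kappa> ` (fst \<kappa> \<inter> V \<inter> f -` fst \<nu>)"
  assumes \<xi>: "unit_normal_on A B h f V \<xi>" and \<kappa>: "\<kappa> \<in> A" and \<nu>: "\<nu> \<in> B"
  shows "open U" "smooth_on U (local_rep \<kappa> \<nu> f)" "local_rep \<kappa> \<nu> f ` U \<subseteq> chart_range \<nu>" "metric_on U (g \<kappa>)"
    "smooth_on U (\<xi> \<nu> \<circ> chart_inv \<kappa>)"
    "y \<in> U \<Longrightarrow> metric_inner (h \<nu>) (local_rep \<kappa> \<nu> f y) ((\<xi> \<nu> \<circ> chart_inv \<kappa>) y) (partial i (local_rep \<kappa> \<nu> f) y) = 0"
proof -
  note ch = smooth_atlas_is_chart[OF at(1) \<kappa>] smooth_atlas_is_chart[OF at(2) \<nu>]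
  have "open V" using \<xi> by (simp add: unit_normal_on_def)
  then show oU: "open U"
    unfolding U_def Int_assoc by (intro open_chart_image ch open_Int open_vimage_chart \<nu>)
  show "smooth_on U (local_rep \<kappa> \<nu> f)"
    by (rule smooth_on_subset[of "snd \<kappa> ` (fst \<kappa> \<inter> f -` fst \<nu>)"]) (use f \<kappa> \<nu> in \<open>auto simp: smooth_map_def U_def\<close>)
  show "local_rep \<kappa> \<nu> f ` U \<subseteq> chart_range \<nu>" using ch by (auto simp: local_rep_snd chart_snd_in U_def)
  show "metric_on U (g \<kappa>)"
    by (rule metric_on_subset[OF metric_on_chart[OF M \<kappa>] oU]) (auto simp: chart_range_def U_def)
  show "smooth_on U (\<xi> \<nu> \<circ> chart_inv \<kappa>)" using \<xi> \<kappa> \<nu> by (simp add: unit_normal_on_def U_def)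
  assume "y \<in> U"
  then obtain q where q: "q \<in> fst \<kappa>" "q \<in> V" "f q \<in> fst \<nu>" "y = snd \<kappa> q" unfolding U_def by blast
  then show "metric_inner (h \<nu>) (local_rep \<kappa> \<nu> f y) ((\<xi> \<nu> \<circ> chart_inv \<kappa>) y) (partial i (local_rep \<kappa> \<nu> f) y) = 0"
    using unit_normal_onD(2)[OF \<xi> q(2) \<nu> q(3) \<kappa> q(1)] ch by (simp add: local_rep_snd chart_inv_snd)
qed

text \<open>Near \<open>p\<close> the new representation is the old one between two transition maps,
  and these are isometries: the one in the source leaves the tension field alone, the one in the
  target maps it by its differential.\<close>

lemma tension_change_charts:
  assumes \<kappa>: "\<kappa> \<in> A" "\<kappa>' \<in> A" "p \<in> fst \<kappa>" "p \<in> fst \<kappa>'"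
    and \<nu>: "\<nu> \<in> B" "\<nu>' \<in> B" "f p \<in> fst \<nu>" "f p \<in> fst \<nu>'"
  shows "tension (g \<kappa>') (h \<nu>') (local_rep \<kappa>' \<nu>' f) (snd \<kappa>' p) =
    (\<Sum>b\<in>UNIV. tension (g \<kappa>) (h \<nu>) (local_rep \<kappa> \<nu> f) (snd \<kappa> p) $ b *\<^sub>R partial b (transition \<nu> \<nu>') (snd \<nu> (f p)))"
proof -
  have c: "is_chart \<kappa>" "is_chart \<kappa>'" "is_chart \<nu>" "is_chart \<nu>'"
    using at \<kappa> \<nu> smooth_atlas_is_chart by blast+
  note co = is_chart_open(1) open_vimage_chart[OF \<nu>(1)] open_vimage_chart[OF \<nu>(2)]
  let ?F = "local_rep \<kappa> \<nu> f" and ?T = "transition \<kappa>' \<kappa>" and ?S = "transition \<nu> \<nu>'"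
  let ?U = "snd \<kappa>' ` (fst \<kappa>' \<inter> (fst \<kappa> \<inter> f -` fst \<nu> \<inter> f -` fst \<nu>'))"
  let ?V = "snd \<kappa> ` (fst \<kappa> \<inter> f -` fst \<nu>)" and ?W = "snd \<nu> ` (fst \<nu> \<inter> fst \<nu>')"
  have oU: "open ?U" by (intro open_chart_image c open_Int co)
  have oV: "open ?V" by (intro open_chart_image c open_Int co)
  have oW: "open ?W" by (intro open_chart_image c open_Int co)
  have x: "snd \<kappa>' p \<in> ?U" using \<kappa> \<nu> by auto
  have T: "smooth_on ?U ?T" by (rule smooth_on_subset[OF smooth_on_transition[OF at(1) \<kappa>(2,1)]]) auto
  have F: "smooth_on ?V ?F" using f \<kappa> \<nu> by (simp add: smooth_map_def)
  have TV: "?T ` ?U \<subseteq> ?V" using c by (auto simp: transition_snd)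
  have FT: "smooth_on ?U (\<lambda>y. ?F (?T y))" by (rule smooth_on_compose[OF F oU oV T TV])
  have FTW: "(\<lambda>y. ?F (?T y)) ` ?U \<subseteq> ?W" using c by (auto simp: transition_snd local_rep_snd)
  have S: "smooth_on ?W ?S" by (rule smooth_on_transition[OF at(2) \<nu>(1,2)])
  have SFT: "smooth_on ?U (\<lambda>y. ?S (?F (?T y)))" by (rule smooth_on_compose[OF S oU oW FT FTW])
  have eq: "?S (?F (?T y)) = local_rep \<kappa>' \<nu>' f y" if "y \<in> ?U" for y
    using that c by (auto simp: transition_snd local_rep_snd)
  have "tension (g \<kappa>') (h \<nu>') (local_rep \<kappa>' \<nu>' f) (snd \<kappa>' p) = tension (g \<kappa>') (h \<nu>') (\<lambda>y. ?S (?F (?T y))) (snd \<kappa>' p)"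
    by (rule tension_cong[OF oU x eq SFT, symmetric])
  also have "\<dots> = (\<Sum>b\<in>UNIV. tension (g \<kappa>') (h \<nu>) (\<lambda>y. ?F (?T y)) (snd \<kappa>' p) $ b *\<^sub>R partial b ?S (?F (?T (snd \<kappa>' p))))"
  proof (rule tension_isometry_target[OF oU FT x FTW S])
    show "?S ` ?W \<subseteq> chart_range \<nu>'" using c by (auto simp: transition_snd chart_snd_in)
    show "metric_on ?W (h \<nu>)"
      by (rule metric_on_subset[OF metric_on_chart[OF N \<nu>(1)] oW]) (auto simp: chart_range_def)
    show "metric_on (chart_range \<nu>') (h \<nu>')" by (rule metric_on_chart[OF N \<nu>(2)])
    show "isometric_on ?W (h \<nu>) (h \<nu>') ?S" by (rule isometric_on_transition[OF N \<nu>(1,2)])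
  qed
  also have "tension (g \<kappa>') (h \<nu>) (\<lambda>y. ?F (?T y)) (snd \<kappa>' p) = tension (g \<kappa>) (h \<nu>) ?F (?T (snd \<kappa>' p))"
  proof (rule tension_isometry_source[OF T x TV F])
    show "metric_on ?U (g \<kappa>')"
      by (rule metric_on_subset[OF metric_on_chart[OF M \<kappa>(2)] oU]) (auto simp: chart_range_def)
    show "metric_on ?V (g \<kappa>)"
      by (rule metric_on_subset[OF metric_on_chart[OF M \<kappa>(1)] oV]) (auto simp: chart_range_def)
    show "isometric_on ?U (g \<kappa>') (g \<kappa>) ?T"
      by (rule isometric_on_subset[OF isometric_on_transition[OF M \<kappa>(2,1)]]) auto
  qed
  finally show ?thesis using c \<kappa> by (simp add: transition_snd local_rep_snd)
qed

text \<open>The definition picks charts at each point, while the variation is computed in one pair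
  of charts. The target transition is an isometry, so the lengths agree.\<close>

lemma tension_norm_sq_charts:
  assumes \<kappa>: "\<kappa> \<in> A" "p \<in> fst \<kappa>" and \<nu>: "\<nu> \<in> B" "f p \<in> fst \<nu>"
  shows "tension_norm_sq A g B h f p = metric_inner (h \<nu>) (snd \<nu> (f p))
     (tension (g \<kappa>) (h \<nu>) (local_rep \<kappa> \<nu> f) (snd \<kappa> p)) (tension (g \<kappa>) (h \<nu>) (local_rep \<kappa> \<nu> f) (snd \<kappa> p))"
proof -
  let ?\<kappa> = "chart_at A p" and ?\<nu> = "chart_at B (f p)"
  have c: "?\<kappa> \<in> A" "p \<in> fst ?\<kappa>" "?\<nu> \<in> B" "f p \<in> fst ?\<nu>" using chart_at at by blast+
  have "snd ?\<nu> (f p) = transition \<nu> ?\<nu> (snd \<nu> (f p))"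
    using \<nu> at(2) by (simp add: transition_snd smooth_atlas_is_chart)
  moreover have "snd \<nu> (f p) \<in> snd \<nu> ` (fst \<nu> \<inter> fst ?\<nu>)" using \<nu> c by auto
  ultimately show ?thesis
    unfolding tension_norm_sq_def Let_def
      tension_change_charts[OF \<kappa>(1) c(1) \<kappa>(2) c(2) \<nu>(1) c(3) \<nu>(2) c(4)]
    by (simp add: metric_inner_isometry[OF isometric_on_transition[OF N \<nu>(1) c(3)]])
qed

end

locale riemannian_surface_map = riemannian_map A g B h \<phi>
  for A :: "('p::{t2_space,second_countable_topology}, 2) chart set" and g
    and B :: "('q::{t2_space,second_countable_topology}, 3) chart set" and h \<phi>
begin

lemma mean_curvature_charts:
  assumes \<xi>: "unit_normal_on A B h \<phi> V \<xi>" "p \<in> V"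
    and \<kappa>: "\<kappa> \<in> A" "p \<in> fst \<kappa>" and \<nu>: "\<nu> \<in> B" "\<phi> p \<in> fst \<nu>"
  shows "mean_curvature A g B h \<phi> \<xi> p = 1/2 * metric_inner (h \<nu>) (snd \<nu> (\<phi> p)) (\<xi> \<nu> p)
     (tension (g \<kappa>) (h \<nu>) (local_rep \<kappa> \<nu> \<phi>) (snd \<kappa> p))"
proof -
  let ?\<kappa> = "chart_at A p" and ?\<nu> = "chart_at B (\<phi> p)"
  have c: "?\<kappa> \<in> A" "p \<in> fst ?\<kappa>" "?\<nu> \<in> B" "\<phi> p \<in> fst ?\<nu>" using chart_at at by blast+
  note ch = smooth_atlas_is_chart[OF at(1) c(1)] smooth_atlas_is_chart[OF at(2) c(3)]
  let ?F = "local_rep ?\<kappa> ?\<nu> \<phi>" and ?X = "\<xi> ?\<nu> \<circ> chart_inv ?\<kappa>"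
  note n = unit_normal_charts[OF \<xi>(1) c(1,3)]
  have "snd ?\<kappa> p \<in> snd ?\<kappa> ` (fst ?\<kappa> \<inter> V \<inter> \<phi> -` fst ?\<nu>)" using c \<xi> by auto
  from trace_shape_matrix[OF n(1,2) this n(3) metric_on_chart[OF N c(3)] n(5,6)]
  have "trace (shape_operator g h \<phi> \<xi> ?\<kappa> ?\<nu> p) =
    metric_inner (h ?\<nu>) (?F (snd ?\<kappa> p)) (?X (snd ?\<kappa> p)) (tension (g ?\<kappa>) (h ?\<nu>) ?F (snd ?\<kappa> p))"
    unfolding shape_operator_def .
  then have 1: "mean_curvature A g B h \<phi> \<xi> p = 1/2 * metric_inner (h ?\<nu>) (snd ?\<nu> (\<phi> p)) (\<xi> ?\<nu> p)
     (tension (g ?\<kappa>) (h ?\<nu>) ?F (snd ?\<kappa> p))"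
    by (simp add: mean_curvature_def local_rep_snd chart_inv_snd ch c)
  have "\<xi> ?\<nu> p = jacobian (transition \<nu> ?\<nu>) (snd \<nu> (\<phi> p)) *v \<xi> \<nu> p"
    by (rule unit_normal_onD(3)[OF \<xi> \<nu> c(3,4)])
  then have \<xi>': "\<xi> ?\<nu> p = (\<Sum>b\<in>UNIV. \<xi> \<nu> p $ b *\<^sub>R partial b (transition \<nu> ?\<nu>) (snd \<nu> (\<phi> p)))"
    by (simp add: vec_eq_iff matrix_vector_mult_def jacobian_nth mult.commute)
  have "snd ?\<nu> (\<phi> p) = transition \<nu> ?\<nu> (snd \<nu> (\<phi> p))"
    using \<nu> at(2) by (simp add: transition_snd smooth_atlas_is_chart)
  moreover have "snd \<nu> (\<phi> p) \<in> snd \<nu> ` (fst \<nu> \<inter> fst ?\<nu>)" using \<nu> c by auto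
  ultimately show ?thesis
    unfolding 1 \<xi>' tension_change_charts[OF \<kappa>(1) c(1) \<kappa>(2) c(2) \<nu>(1) c(3) \<nu>(2) c(4)]
    by (simp add: metric_inner_isometry[OF isometric_on_transition[OF N \<nu>(1) c(3)]])
qed

end

locale umbilical_surface = riemannian_surface_map A g B h \<phi>
  for A :: "('p::{t2_space,second_countable_topology}, 2) chart set" and g
    and B :: "('q::{t2_space,second_countable_topology}, 3) chart set" and h \<phi> +
  assumes iso: "isometric_immersion A g B h \<phi>" and umb: "totally_umbilical A g B h \<phi>"
begin

text \<open>Only the values of the factor and of the normal at one point are kept. What is built
  from them later is unchanged when both change sign.\<close>

lemma umbilical_hessian_charts:
  assumes \<kappa>: "\<kappa> \<in> A" "p \<in> fst \<kappa>" and \<nu>: "\<nu> \<in> B" "\<phi> p \<in> fst \<nu>"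
  obtains l X where
    "\<And>i j. hessian_map (g \<kappa>) (h \<nu>) (local_rep \<kappa> \<nu> \<phi>) (snd \<kappa> p) i j = (l * g \<kappa> (snd \<kappa> p) $ i $ j) *\<^sub>R X"
    "metric_inner (h \<nu>) (snd \<nu> (\<phi> p)) X X = 1"
    "\<And>i. metric_inner (h \<nu>) (snd \<nu> (\<phi> p)) X (partial i (local_rep \<kappa> \<nu> \<phi>) (snd \<kappa> p)) = 0"
proof -
  obtain V \<xi> l where V: "p \<in> V" "unit_normal_on A B h \<phi> V \<xi>" and
    L: "\<forall>q\<in>V. \<forall>\<kappa>\<in>A. \<forall>\<nu>\<in>B. q \<in> fst \<kappa> \<longrightarrow> \<phi> q \<in> fst \<nu> \<longrightarrow> shape_operator g h \<phi> \<xi> \<kappa> \<nu> q = l q *\<^sub>R mat 1"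
    using spec[OF umb[unfolded totally_umbilical_def], of p] by (elim exE conjE) (rule that)
  have l: "shape_operator g h \<phi> \<xi> \<kappa> \<nu> p = l p *\<^sub>R mat 1"
    by (rule L[rule_format, OF V(1) \<kappa>(1) \<nu>(1) \<kappa>(2) \<nu>(2)])
  note ch = smooth_atlas_is_chart[OF at(1) \<kappa>(1)] smooth_atlas_is_chart[OF at(2) \<nu>(1)]
  let ?U = "snd \<kappa> ` (fst \<kappa> \<inter> V \<inter> \<phi> -` fst \<nu>)" and ?F = "local_rep \<kappa> \<nu> \<phi>" and ?X = "\<xi> \<nu> \<circ> chart_inv \<kappa>"
  note n = unit_normal_charts[OF V(2) \<kappa>(1) \<nu>(1)]
  have x: "snd \<kappa> p \<in> ?U" using \<kappa> \<nu> V by auto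
  have X1: "metric_inner (h \<nu>) (?F (snd \<kappa> p)) (?X (snd \<kappa> p)) (?X (snd \<kappa> p)) = 1"
    using \<kappa> \<nu> ch unit_normal_onD(1)[OF V(2,1) \<nu> \<kappa>] by (simp add: local_rep_snd chart_inv_snd)
  have im: "isometric_on ?U (g \<kappa>) (h \<nu>) ?F"
    by (rule isometric_on_subset[OF isometric_on_local_rep[OF iso \<kappa>(1) \<nu>(1)]]) auto
  have "hessian_map (g \<kappa>) (h \<nu>) ?F (snd \<kappa> p) i j = (l p * g \<kappa> (snd \<kappa> p) $ i $ j) *\<^sub>R ?X (snd \<kappa> p)" for i j
    by (rule umbilical_hessian_map[OF n(1,2) x n(3) metric_on_chart[OF N \<nu>(1)] n(5,6) X1 n(4) im
        l[unfolded shape_operator_def]])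
  then show ?thesis
    using that[of "l p" "?X (snd \<kappa> p)"] X1 n(6)[OF x] ch \<kappa> by (simp add: local_rep_snd)
qed

end

section \<open>The Riemannian volume\<close>

lemma has_integral_iff_set_nn_integral:
  fixes u :: "'a::euclidean_space \<Rightarrow> real"
  assumes m: "(\<lambda>x. indicator S x * u x) \<in> borel_measurable borel" and pos: "\<And>x. x \<in> S \<Longrightarrow> u x \<ge> 0"
  shows "(u has_integral r) S \<longleftrightarrow> (\<integral>\<^sup>+x\<in>S. ennreal (u x) \<partial>lborel) = ennreal r \<and> 0 \<le> r"
proof -
  let ?f = "\<lambda>x. indicator S x * u x"
  have "(u has_integral r) S \<longleftrightarrow> (?f has_integral r) UNIV"
    by (subst has_integral_restrict_UNIV[symmetric], rule has_integral_cong) (simp add: indicator_def)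
  also have "\<dots> \<longleftrightarrow> (?f \<in> lebesgue \<rightarrow>\<^sub>M borel \<and> integral\<^sup>N lebesgue ?f = r \<and> 0 \<le> r)"
    by (rule has_integral_iff_nn_integral_lebesgue) (simp add: indicator_def pos)
  also have "integral\<^sup>N lebesgue ?f = (\<integral>\<^sup>+x\<in>S. ennreal (u x) \<partial>lborel)"
    by (subst nn_integral_completion) (auto intro!: nn_integral_cong simp: indicator_def)
  finally show ?thesis using m by (simp add: measurable_completion)
qed

text \<open>The values are carried to \<open>real^1\<close>, the setting of the change of variables
  theorem, and back; for nonnegative functions absolute integrability is plain
  integrability.\<close>

lemma nonneg_change_of_variables:
  fixes f :: "real^'n::{finite,wellorder} \<Rightarrow> real" and T :: "real^'n::_ \<Rightarrow> real^'n::_"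
  assumes S: "S \<in> sets lebesgue" and der: "\<And>x. x \<in> S \<Longrightarrow> (T has_derivative T' x) (at x within S)"
    and inj: "inj_on T S" and pos: "\<And>y. y \<in> T ` S \<Longrightarrow> f y \<ge> 0"
  shows "((\<lambda>x. \<bar>det (matrix (T' x))\<bar> * f (T x)) has_integral b) S \<longleftrightarrow> (f has_integral b) (T ` S)"
proof -
  have "(\<lambda>x. \<bar>det (matrix (T' x))\<bar> *\<^sub>R (vec (f (T x)) :: real^1)) absolutely_integrable_on S \<and>
      integral S (\<lambda>x. \<bar>det (matrix (T' x))\<bar> *\<^sub>R (vec (f (T x)) :: real^1)) = vec b
    \<longleftrightarrow> (\<lambda>y. vec (f y) :: real^1) absolutely_integrable_on (T ` S) \<and> integral (T ` S) (\<lambda>y. vec (f y) :: real^1) = vec b"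
    by (rule has_absolute_integral_change_of_variables[OF S der inj])
  moreover have "\<bar>det (matrix (T' x))\<bar> *\<^sub>R (vec (f (T x)) :: real^1) = vec (\<bar>det (matrix (T' x))\<bar> * f (T x))" for x
    by (simp add: vec_eq_iff)
  ultimately have eq: "((\<lambda>x. \<bar>det (matrix (T' x))\<bar> * f (T x)) absolutely_integrable_on S \<and>
      integral S (\<lambda>x. \<bar>det (matrix (T' x))\<bar> * f (T x)) = b)
    \<longleftrightarrow> (f absolutely_integrable_on (T ` S) \<and> integral (T ` S) f = b)"
    by (simp add: absolutely_integrable_on_1_iff integral_on_1_eq vec_eq_iff)
  have iff: "(u has_integral b) A \<longleftrightarrow> u absolutely_integrable_on A \<and> integral A u = b"
    if "\<And>x. x \<in> A \<Longrightarrow> u x \<ge> 0" for u :: "real^'n::_ \<Rightarrow> real" and A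
    using that nonnegative_absolutely_integrable_1[of u A] set_lebesgue_integral_eq_integral(1)[of A u]
    by (auto simp: has_integral_iff)
  show ?thesis
    using eq pos by (subst (1 2) iff) auto
qed

lemma nn_integral_change_of_variables:
  fixes f :: "real^'n::{finite,wellorder} \<Rightarrow> real" and T :: "real^'n::_ \<Rightarrow> real^'n::_"
  assumes S: "S \<in> sets borel" and der: "\<And>x. x \<in> S \<Longrightarrow> (T has_derivative T' x) (at x within S)"
    and inj: "inj_on T S" and pos: "\<And>y. y \<in> T ` S \<Longrightarrow> f y \<ge> 0"
    and m: "(\<lambda>y. indicator (T ` S) y * f y) \<in> borel_measurable borel"
      "(\<lambda>x. indicator S x * (\<bar>det (matrix (T' x))\<bar> * f (T x))) \<in> borel_measurable borel"
  shows "(\<integral>\<^sup>+y\<in>T ` S. ennreal (f y) \<partial>lborel) = (\<integral>\<^sup>+x\<in>S. ennreal (\<bar>det (matrix (T' x))\<bar> * f (T x)) \<partial>lborel)"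
    (is "?a = ?b")
proof -
  \<comment> \<open>The two integrals take the same finite values; so if one of them is infinite,
    the other is too.\<close>
  have "?b = ennreal r \<longleftrightarrow> ?a = ennreal r" if "r \<ge> 0" for r
    using nonneg_change_of_variables[of S T T' f r, OF _ der inj pos] S that
      has_integral_iff_set_nn_integral[OF m(1), of r] has_integral_iff_set_nn_integral[OF m(2), of r] pos
    by simp
  then show ?thesis by (cases ?a rule: ennreal_cases; cases ?b rule: ennreal_cases) auto
qed

text \<open>The part of the volume carried by one chart, pushed forward from the coordinates. The
  default value makes the map total; the density vanishes where it is taken.\<close>

definition chart_volume ::
  "('p, 'n::finite) chart_metric \<Rightarrow> ('p, 'n) chart \<Rightarrow> 'p::topological_space measure" where
  "chart_volume g \<kappa> = distr (density lborel (\<lambda>x. ennreal (indicator (chart_range \<kappa>) x * sqrt (det (g \<kappa> x))))) borel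
     (\<lambda>x. if x \<in> chart_range \<kappa> then chart_inv \<kappa> x else undefined)"

lemma continuous_on_sqrt_det:
  assumes "metric_on V K"
  shows "continuous_on V (\<lambda>x. sqrt (det (K x)))"
proof -
  have "smooth_on V (\<lambda>x. det (K x))"
    using assms by (intro smooth_on_det smooth_on_vec_nth) (auto simp: metric_on_def)
  then show ?thesis by (intro continuous_on_real_sqrt smooth_on_imp_continuous_on)
qed

lemma sqrt_det_measurable:
  assumes "metric_on V K" "S \<in> sets borel" "S \<subseteq> V"
  shows "(\<lambda>x. indicator S x * sqrt (det (K x))) \<in> borel_measurable borel"
  using borel_measurable_continuous_on_indicator[OF assms(2) continuous_on_subset[OF continuous_on_sqrt_det[OF assms(1)] assms(3)]]
  by simp

lemma chart_inv_measurable: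
  fixes \<kappa> :: "('p::topological_space, 'n::finite) chart"
  assumes "is_chart \<kappa>"
  shows "(\<lambda>x. if x \<in> chart_range \<kappa> then chart_inv \<kappa> x else undefined) \<in> borel_measurable borel"
  using borel_measurable_continuous_on_restrict[OF continuous_on_chart_inv[OF assms]] is_chart_open(2)[OF assms]
  by (subst (asm) measurable_restrict_space_iff) auto

lemma chart_image_borel:
  fixes \<kappa> :: "('p::topological_space, 'n::finite) chart"
  assumes c: "is_chart \<kappa>" and S: "S \<in> sets borel"
  shows "snd \<kappa> ` (fst \<kappa> \<inter> S) \<in> sets borel"
proof -
  let ?I = "\<lambda>x. if x \<in> chart_range \<kappa> then chart_inv \<kappa> x else undefined"
  have "?I -` S \<inter> space borel \<in> sets borel"
    by (rule measurable_sets[OF chart_inv_measurable[OF c] S])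
  then have "chart_range \<kappa> \<inter> (?I -` S \<inter> space borel) \<in> sets borel"
    using is_chart_open(2)[OF c] by auto
  also have "chart_range \<kappa> \<inter> (?I -` S \<inter> space borel) = snd \<kappa> ` (fst \<kappa> \<inter> S)"
    unfolding chart_image[OF c] by auto
  finally show ?thesis .
qed

lemma emeasure_chart_volume:
  fixes \<kappa> :: "('p::topological_space, 'n::finite) chart"
  assumes c: "is_chart \<kappa>" and K: "metric_on (chart_range \<kappa>) (g \<kappa>)" and S: "S \<in> sets borel"
  shows "emeasure (chart_volume g \<kappa>) S = (\<integral>\<^sup>+x\<in>snd \<kappa> ` (fst \<kappa> \<inter> S). ennreal (sqrt (det (g \<kappa> x))) \<partial>lborel)"
proof -
  let ?I = "\<lambda>x. if x \<in> chart_range \<kappa> then chart_inv \<kappa> x else undefined"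
  have mI: "?I \<in> borel_measurable borel" by (rule chart_inv_measurable[OF c])
  have mw: "(\<lambda>x. indicator (chart_range \<kappa>) x * sqrt (det (g \<kappa> x))) \<in> borel_measurable borel"
    using is_chart_open(2)[OF c] by (intro sqrt_det_measurable[OF K]) auto
  have mS: "?I -` S \<in> sets borel" using measurable_sets[OF mI S] by simp
  have "emeasure (chart_volume g \<kappa>) S =
     (\<integral>\<^sup>+x. ennreal (indicator (chart_range \<kappa>) x * sqrt (det (g \<kappa> x))) * indicator (?I -` S) x \<partial>lborel)"
    unfolding chart_volume_def using mI mw mS S
    by (subst emeasure_distr) (auto intro!: emeasure_density)
  also have "\<dots> = (\<integral>\<^sup>+x\<in>snd \<kappa> ` (fst \<kappa> \<inter> S). ennreal (sqrt (det (g \<kappa> x))) \<partial>lborel)"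
    unfolding chart_image[OF c] by (rule nn_integral_cong) (auto simp: indicator_def)
  finally show ?thesis .
qed

text \<open>The square root of det g = (det J)^2 det g' supplies exactly the Jacobian factor of the
  change of variables.\<close>

lemma nn_integral_charts:
  fixes A :: "('p::{t2_space,second_countable_topology}, 'n::{finite,wellorder}) chart set"
  assumes M: "riemannian_manifold A g" and \<kappa>: "\<kappa> \<in> A" "\<kappa>' \<in> A" and S: "S \<in> sets borel" "S \<subseteq> fst \<kappa>" "S \<subseteq> fst \<kappa>'"
    and pos: "\<And>x. x \<in> chart_range \<kappa>' \<Longrightarrow> det (g \<kappa>' x) \<ge> 0"
  shows "(\<integral>\<^sup>+x\<in>snd \<kappa>' ` S. ennreal (sqrt (det (g \<kappa>' x))) \<partial>lborel) = (\<integral>\<^sup>+x\<in>snd \<kappa> ` S. ennreal (sqrt (det (g \<kappa> x))) \<partial>lborel)"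
proof -
  have at: "smooth_atlas A" using M by (simp add: riemannian_manifold_def)
  note c = smooth_atlas_is_chart[OF at \<kappa>(1)] smooth_atlas_is_chart[OF at \<kappa>(2)]
  let ?T = "transition \<kappa> \<kappa>'" and ?S = "snd \<kappa> ` S" and ?W = "snd \<kappa> ` (fst \<kappa> \<inter> fst \<kappa>')"
  let ?T' = "\<lambda>x. frechet_derivative ?T (at x)"
  have T: "smooth_on ?W ?T" by (rule smooth_on_transition[OF at \<kappa>])
  have SW: "?S \<subseteq> ?W" using S by auto
  have im: "?T ` ?S = snd \<kappa>' ` S" using S(2) c(1) by (force simp: transition_snd image_iff)
  have bS: "?S \<in> sets borel" using chart_image_borel[OF c(1) S(1)] S(2) by (simp add: Int_absorb1)
  have bS': "snd \<kappa>' ` S \<in> sets borel" using chart_image_borel[OF c(2) S(1)] S(3) by (simp add: Int_absorb1)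
  have d: "sqrt (det (g \<kappa> x)) = \<bar>det (matrix (?T' x))\<bar> * sqrt (det (g \<kappa>' (?T x)))" if "x \<in> ?S" for x
  proof -
    have "g \<kappa> x = transpose (jacobian ?T x) ** g \<kappa>' (?T x) ** jacobian ?T x"
      using conjunct2[OF conjunct2[OF M[unfolded riemannian_manifold_def], unfolded riemannian_metric_def],
          rule_format, OF \<kappa>] that SW by blast
    then have "det (g \<kappa> x) = (det (jacobian ?T x))\<^sup>2 * det (g \<kappa>' (?T x))"
      by (simp add: det_mul power2_eq_square)
    then show ?thesis by (simp add: real_sqrt_mult jacobian_def)
  qed
  have "(\<integral>\<^sup>+x\<in>?T ` ?S. ennreal (sqrt (det (g \<kappa>' x))) \<partial>lborel) =
     (\<integral>\<^sup>+x\<in>?S. ennreal (\<bar>det (matrix (?T' x))\<bar> * sqrt (det (g \<kappa>' (?T x)))) \<partial>lborel)"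
  proof (rule nn_integral_change_of_variables[OF bS])
    show "(?T has_derivative ?T' x) (at x within ?S)" if "x \<in> ?S" for x
      using smooth_on_has_derivative[OF T, of x] that SW by (auto intro: has_derivative_at_withinI)
    show "inj_on ?T ?S"
    proof (rule inj_onI)
      fix x y assume "x \<in> ?S" "y \<in> ?S" "?T x = ?T y"
      then obtain p q where pq: "x = snd \<kappa> p" "y = snd \<kappa> q" "p \<in> S" "q \<in> S" "snd \<kappa>' p = snd \<kappa>' q"
        using S(2) c(1) by (auto simp: transition_snd subset_iff)
      then have "p = q" using chart_inv_snd[OF c(2)] S(3) by (metis subsetD)
      then show "x = y" by (simp add: pq)
    qed
    show "sqrt (det (g \<kappa>' y)) \<ge> 0" if "y \<in> ?T ` ?S" for y
      using that pos[of y] S(3) unfolding im by (auto simp: chart_range_def)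
    show "(\<lambda>y. indicator (?T ` ?S) y * sqrt (det (g \<kappa>' y))) \<in> borel_measurable borel"
      unfolding im by (rule sqrt_det_measurable[OF metric_on_chart[OF M \<kappa>(2)] bS']) (use S in \<open>auto simp: chart_range_def\<close>)
    have "(\<lambda>x. indicator ?S x * sqrt (det (g \<kappa> x))) \<in> borel_measurable borel"
      by (rule sqrt_det_measurable[OF metric_on_chart[OF M \<kappa>(1)] bS]) (use S in \<open>auto simp: chart_range_def\<close>)
    also have "(\<lambda>x. indicator ?S x * sqrt (det (g \<kappa> x))) =
       (\<lambda>x. indicator ?S x * (\<bar>det (matrix (?T' x))\<bar> * sqrt (det (g \<kappa>' (?T x)))))"
      using d by (auto simp: indicator_def fun_eq_iff)
    finally show "(\<lambda>x. indicator ?S x * (\<bar>det (matrix (?T' x))\<bar> * sqrt (det (g \<kappa>' (?T x))))) \<in> borel_measurable borel" .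
  qed
  also have "\<dots> = (\<integral>\<^sup>+x\<in>?S. ennreal (sqrt (det (g \<kappa> x))) \<partial>lborel)"
    using d by (intro nn_integral_cong) (auto simp: indicator_def)
  finally show ?thesis unfolding im .
qed

definition is_riemannian_volume ::
  "('p::topological_space, 'n::finite) chart set \<Rightarrow> ('p, 'n) chart_metric \<Rightarrow> 'p measure \<Rightarrow> bool" where
  "is_riemannian_volume A g \<mu> \<longleftrightarrow> sets \<mu> = sets borel \<and>
     (\<forall>\<kappa>\<in>A. \<forall>S\<in>sets borel. S \<subseteq> fst \<kappa> \<longrightarrow>
        emeasure \<mu> S = (\<integral>\<^sup>+x\<in>snd \<kappa> ` S. ennreal (sqrt (det (g \<kappa> x))) \<partial>lborel))"

text \<open>Without unique existence the definite description \<open>riemannian_volume\<close> would be unspecified.\<close>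

lemma ex1_riemannian_volume:
  fixes A :: "('p::{t2_space,second_countable_topology}, 'n::{finite,wellorder}) chart set"
  assumes M: "riemannian_manifold A g"
    and pos: "\<And>\<kappa> x. \<kappa> \<in> A \<Longrightarrow> x \<in> chart_range \<kappa> \<Longrightarrow> det (g \<kappa> x) \<ge> 0"
  shows "\<exists>!\<mu>. is_riemannian_volume A g \<mu>"
proof -
  have at: "smooth_atlas A" using M by (simp add: riemannian_manifold_def)
  have cover: "(\<Union>\<kappa>\<in>A. fst \<kappa>) = UNIV" using at by (simp add: smooth_atlas_def)
  \<comment> \<open>Second countability reduces the atlas to countably many charts; their domains
    are then made disjoint.\<close>
  obtain F where F: "F \<subseteq> fst ` A" "countable F" "\<Union>F = (\<Union>\<kappa>\<in>A. fst \<kappa>)"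
  proof (rule Lindelof_openin[of "fst ` A" UNIV])
    show "openin (top_of_set UNIV) S" if "S \<in> fst ` A" for S
      using that smooth_atlas_is_chart[OF at] is_chart_open(1) by auto
  qed (use that in auto)
  have "F \<noteq> {}" using F(3) cover by auto
  then have "\<exists>\<kappa>. \<kappa> \<in> A \<and> fst \<kappa> = from_nat_into F n" for n
    using from_nat_into[of F n] F(1) by auto
  then obtain k where k: "\<And>n. k n \<in> A" "\<And>n. fst (k n) = from_nat_into F n" by metis
  have Uk: "(\<Union>n. fst (k n)) = UNIV"
    using range_from_nat_into[OF \<open>F \<noteq> {}\<close> F(2)] F(3) cover by (simp add: k(2))
  define D where "D = disjointed (\<lambda>n. fst (k n))"
  have ck: "is_chart (k n)" for n by (rule smooth_atlas_is_chart[OF at k(1)])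
  have D: "disjoint_family D" "(\<Union>n. D n) = UNIV" "D n \<subseteq> fst (k n)" "D n \<in> sets borel" for n
  proof -
    show "disjoint_family D" unfolding D_def by (rule disjoint_family_disjointed)
    show "(\<Union>n. D n) = UNIV" unfolding D_def by (simp add: UN_disjointed_eq Uk)
    show "D n \<subseteq> fst (k n)" unfolding D_def by (rule disjointed_subset)
    have "range D \<subseteq> sets borel" unfolding D_def
      by (rule sets.range_disjointed_sets) (use is_chart_open(1)[OF ck] in auto)
    then show "D n \<in> sets borel" by auto
  qed
  have split: "emeasure \<mu> S = (\<Sum>n. emeasure \<mu> (S \<inter> D n))" if "sets \<mu> = sets borel" "S \<in> sets borel" for \<mu> S
  proof -
    have "(\<Sum>n. emeasure \<mu> (S \<inter> D n)) = emeasure \<mu> (\<Union>n. S \<inter> D n)"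
      using that D(1,4) by (intro suminf_emeasure) (auto simp: disjoint_family_on_def)
    also have "(\<Union>n. S \<inter> D n) = S" using D(2) by auto
    finally show ?thesis ..
  qed
  \<comment> \<open>The sum over the pieces is an integral for the counting measure, so countable
    additivity becomes an interchange of sum and integral.\<close>
  define m where "m S = (\<integral>\<^sup>+n. emeasure (chart_volume g (k n)) (S \<inter> D n) \<partial>count_space UNIV)" for S
  define \<mu> where "\<mu> = measure_of UNIV (sets borel) m"
  have sets: "sets \<mu> = sets borel" unfolding \<mu>_def
    by (subst sets_measure_of) (auto simp: sets.sigma_sets_eq[of borel, simplified])
  have ca: "countably_additive (sets borel) m"
  proof (rule countably_additiveI)
    fix B :: "nat \<Rightarrow> 'p set" assume B: "range B \<subseteq> sets borel" "disjoint_family B"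
    have "(\<Sum>i. m (B i)) = (\<integral>\<^sup>+n. (\<Sum>i. emeasure (chart_volume g (k n)) (B i \<inter> D n)) \<partial>count_space UNIV)"
      unfolding m_def by (rule nn_integral_suminf[symmetric]) simp
    also have "\<dots> = m (\<Union>i. B i)" unfolding m_def
    proof (rule nn_integral_cong)
      fix n
      have "(\<Sum>i. emeasure (chart_volume g (k n)) (B i \<inter> D n)) = emeasure (chart_volume g (k n)) (\<Union>i. B i \<inter> D n)"
        using B D(4) by (intro suminf_emeasure) (auto simp: disjoint_family_on_def chart_volume_def)
      then show "(\<Sum>i. emeasure (chart_volume g (k n)) (B i \<inter> D n)) = emeasure (chart_volume g (k n)) (\<Union> (range B) \<inter> D n)"
        by (simp only: Int_commute[of "\<Union> (range B)"] Int_UN_distrib Int_commute[of "D n"])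
    qed
    finally show "(\<Sum>i. m (B i)) = m (\<Union>i. B i)" .
  qed
  have em: "emeasure \<mu> S = m S" if "S \<in> sets borel" for S
  proof (rule emeasure_measure_of[OF \<mu>_def])
    show "positive (sets \<mu>) m" by (simp add: positive_def m_def)
    show "countably_additive (sets \<mu>) m" using ca by (simp add: sets)
  qed (use that in \<open>auto simp: sets\<close>)
  have cv: "emeasure (chart_volume g \<kappa>) S = (\<integral>\<^sup>+x\<in>snd \<kappa> ` S. ennreal (sqrt (det (g \<kappa> x))) \<partial>lborel)"
    if "\<kappa> \<in> A" "S \<in> sets borel" "S \<subseteq> fst \<kappa>" for \<kappa> S
    using emeasure_chart_volume[of \<kappa> g, OF smooth_atlas_is_chart[OF at that(1)] metric_on_chart[OF M that(1)] that(2)] that(3)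
    by (simp add: Int_absorb1)
  \<comment> \<open>Charts agree on common domains, so the chart assigned to a piece may be replaced
    by any chart containing the set.\<close>
  have piece: "emeasure (chart_volume g (k n)) (S \<inter> D n) = emeasure (chart_volume g \<kappa>) (S \<inter> D n)"
    if "\<kappa> \<in> A" "S \<in> sets borel" "S \<subseteq> fst \<kappa>" for \<kappa> S n
  proof -
    have S: "S \<inter> D n \<in> sets borel" "S \<inter> D n \<subseteq> fst \<kappa>" "S \<inter> D n \<subseteq> fst (k n)" using that D(3,4) by auto
    show ?thesis
      unfolding cv[OF that(1) S(1,2)] cv[OF k(1) S(1,3)]
      by (rule nn_integral_charts[OF M that(1) k(1) S pos[OF k(1)]])
  qed
  show ?thesis
  proof (rule ex1I)
    show "is_riemannian_volume A g \<mu>"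
      unfolding is_riemannian_volume_def
    proof (intro conjI ballI impI sets)
      fix \<kappa> S assume S: "\<kappa> \<in> A" "S \<in> sets borel" "S \<subseteq> fst \<kappa>"
      have "emeasure \<mu> S = (\<Sum>n. emeasure (chart_volume g (k n)) (S \<inter> D n))"
        by (simp add: em S m_def nn_integral_count_space_nat)
      also have "\<dots> = (\<Sum>n. emeasure (chart_volume g \<kappa>) (S \<inter> D n))" by (simp add: piece[OF S])
      also have "\<dots> = emeasure (chart_volume g \<kappa>) S"
        by (rule split[symmetric]) (use S in \<open>auto simp: chart_volume_def\<close>)
      finally show "emeasure \<mu> S = (\<integral>\<^sup>+x\<in>snd \<kappa> ` S. ennreal (sqrt (det (g \<kappa> x))) \<partial>lborel)"
        by (simp add: cv[OF S])
    qed
    fix \<mu>' assume \<mu>': "is_riemannian_volume A g \<mu>'"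
    then have sets': "sets \<mu>' = sets borel" by (simp add: is_riemannian_volume_def)
    \<comment> \<open>Uniqueness: every set splits along the countably many pieces, and on each of
      them the charts prescribe the measure.\<close>
    show "\<mu>' = \<mu>"
    proof (rule measure_eqI)
      show "sets \<mu>' = sets \<mu>" by (simp add: sets sets')
      fix S assume "S \<in> sets \<mu>'"
      then have S: "S \<in> sets borel" by (simp add: sets')
      have "emeasure \<mu>' (S \<inter> D n) = emeasure (chart_volume g (k n)) (S \<inter> D n)" for n
      proof -
        have *: "S \<inter> D n \<in> sets borel" "S \<inter> D n \<subseteq> fst (k n)" using S D(3,4) by auto
        then show ?thesis using \<mu>' k(1) unfolding is_riemannian_volume_def cv[OF k(1) *] by blast
      qed
      then show "emeasure \<mu>' S = emeasure \<mu> S"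
        by (simp add: split[OF sets' S] em[OF S] m_def nn_integral_count_space_nat)
    qed
  qed
qed

lemma riemannian_volume:
  fixes A :: "('p::{t2_space,second_countable_topology}, 'n::{finite,wellorder}) chart set"
  assumes M: "riemannian_manifold A g"
    and pos: "\<And>\<kappa> x. \<kappa> \<in> A \<Longrightarrow> x \<in> chart_range \<kappa> \<Longrightarrow> det (g \<kappa> x) \<ge> 0"
  shows "is_riemannian_volume A g (riemannian_volume A g)"
  using theI'[OF ex1_riemannian_volume[OF assms]]
  unfolding is_riemannian_volume_def riemannian_volume_def .

lemma set_lebesgue_integral_chart:
  fixes A :: "('p::{t2_space,second_countable_topology}, 'n::{finite,wellorder}) chart set" and f :: "'p \<Rightarrow> real"
  assumes M: "riemannian_manifold A g"
    and pos: "\<And>\<kappa> x. \<kappa> \<in> A \<Longrightarrow> x \<in> chart_range \<kappa> \<Longrightarrow> det (g \<kappa> x) \<ge> 0"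
    and \<kappa>: "\<kappa> \<in> A" and K: "compact K" "K \<subseteq> chart_range \<kappa>"
    and f: "continuous_on K (\<lambda>x. f (chart_inv \<kappa> x))"
  shows "set_lebesgue_integral (riemannian_volume A g) (chart_inv \<kappa> ` K) f =
    integral K (\<lambda>x. f (chart_inv \<kappa> x) * sqrt (det (g \<kappa> x)))"
proof -
  let ?\<mu> = "riemannian_volume A g" and ?\<Omega> = "chart_inv \<kappa> ` K"
  let ?I = "\<lambda>x. if x \<in> chart_range \<kappa> then chart_inv \<kappa> x else undefined"
  let ?w = "\<lambda>x. indicator (chart_range \<kappa>) x * sqrt (det (g \<kappa> x))"
  have c: "is_chart \<kappa>" using M \<kappa> smooth_atlas_is_chart unfolding riemannian_manifold_def by blast
  have vol: "is_riemannian_volume A g ?\<mu>" by (rule riemannian_volume[OF M pos])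
  then have sets: "sets ?\<mu> = sets borel" by (simp add: is_riemannian_volume_def)
  have \<Omega>: "?\<Omega> \<subseteq> fst \<kappa>" using K chart_inv_in[OF c] by auto
  have "compact ?\<Omega>" using K by (intro compact_continuous_image continuous_on_subset[OF continuous_on_chart_inv[OF c]])
  then have b\<Omega>: "?\<Omega> \<in> sets borel" by (intro borel_closed compact_imp_closed)
  have b: "fst \<kappa> \<in> sets borel" using is_chart_open(1)[OF c] by simp
  have "continuous_on ?\<Omega> (\<lambda>p. f (chart_inv \<kappa> (snd \<kappa> p)))"
    by (rule continuous_on_compose2[OF f continuous_on_subset[OF continuous_on_chart[OF c] \<Omega>]])
       (use K snd_chart_inv[OF c] in \<open>auto simp: subset_iff\<close>)
  then have "continuous_on ?\<Omega> f"
    by (rule continuous_on_eq) (use \<Omega> chart_inv_snd[OF c] in auto)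
  then have F: "(\<lambda>p. indicator ?\<Omega> p *\<^sub>R f p) \<in> borel_measurable borel"
    by (rule borel_measurable_continuous_on_indicator[OF b\<Omega>])
  have mI: "?I \<in> borel_measurable borel" by (rule chart_inv_measurable[OF c])
  have mw: "?w \<in> borel_measurable borel"
    using is_chart_open(2)[OF c] by (intro sqrt_det_measurable[OF metric_on_chart[OF M \<kappa>]]) auto
  \<comment> \<open>Restricted to the chart domain, the volume is the pushforward measure, so the
    integral can be moved to coordinates.\<close>
  have eq: "density ?\<mu> (indicator (fst \<kappa>) :: 'p \<Rightarrow> real) = chart_volume g \<kappa>"
  proof (rule measure_eqI)
    show "sets (density ?\<mu> (indicator (fst \<kappa>) :: 'p \<Rightarrow> real)) = sets (chart_volume g \<kappa>)"
      by (simp add: sets chart_volume_def)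
    fix S assume "S \<in> sets (density ?\<mu> (indicator (fst \<kappa>) :: 'p \<Rightarrow> real))"
    then have S: "S \<in> sets borel" by (simp add: sets)
    have "emeasure (density ?\<mu> (indicator (fst \<kappa>) :: 'p \<Rightarrow> real)) S = emeasure ?\<mu> (fst \<kappa> \<inter> S)"
      using S b sets by (subst emeasure_density) (auto simp: nn_integral_indicator[symmetric] indicator_def
          measurable_def intro!: nn_integral_cong borel_measurable_indicator)
    also have "\<dots> = emeasure (chart_volume g \<kappa>) S"
      unfolding emeasure_chart_volume[of \<kappa> g, OF c metric_on_chart[OF M \<kappa>] S]
      by (rule conjunct2[OF vol[unfolded is_riemannian_volume_def], rule_format, OF \<kappa> sets.Int[OF b S] Int_lower1])
    finally show "emeasure (density ?\<mu> (indicator (fst \<kappa>) :: 'p \<Rightarrow> real)) S = emeasure (chart_volume g \<kappa>) S" .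
  qed
  have "set_lebesgue_integral ?\<mu> ?\<Omega> f = (\<integral>p. indicator (fst \<kappa>) p *\<^sub>R (indicator ?\<Omega> p *\<^sub>R f p) \<partial>?\<mu>)"
    unfolding set_lebesgue_integral_def by (rule Bochner_Integration.integral_cong) (use \<Omega> in \<open>auto simp: indicator_def\<close>)
  also have "\<dots> = (\<integral>p. indicator ?\<Omega> p *\<^sub>R f p \<partial>density ?\<mu> (indicator (fst \<kappa>) :: 'p \<Rightarrow> real))"
  proof (rule integral_density[symmetric])
    show "(\<lambda>p. indicator ?\<Omega> p *\<^sub>R f p) \<in> borel_measurable ?\<mu>"
      using F measurable_cong_sets[OF sets refl] by blast
    show "(indicator (fst \<kappa>) :: 'p \<Rightarrow> real) \<in> borel_measurable ?\<mu>"
      using b by (intro borel_measurable_indicator) (simp add: sets)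
  qed simp
  also have "\<dots> = (\<integral>p. indicator ?\<Omega> p *\<^sub>R f p \<partial>chart_volume g \<kappa>)" by (simp only: eq)
  also have "\<dots> = (\<integral>x. indicator ?\<Omega> (?I x) *\<^sub>R f (?I x) \<partial>density lborel ?w)"
    unfolding chart_volume_def using mI F by (intro integral_distr) auto
  also have "\<dots> = (\<integral>x. ?w x *\<^sub>R (indicator ?\<Omega> (?I x) *\<^sub>R f (?I x)) \<partial>lborel)"
  proof (rule integral_density)
    show "(\<lambda>x. indicator ?\<Omega> (?I x) *\<^sub>R f (?I x)) \<in> borel_measurable lborel"
      using measurable_compose[OF mI F] by simp
    show "?w \<in> borel_measurable lborel" using mw by simp
    show "AE x in lborel. 0 \<le> ?w x" using pos[OF \<kappa>] by (auto simp: indicator_def)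
  qed
  also have "\<dots> = (LINT x:K|lborel. f (chart_inv \<kappa> x) * sqrt (det (g \<kappa> x)))"
    unfolding set_lebesgue_integral_def
  proof (rule Bochner_Integration.integral_cong[OF refl])
    fix x
    have "chart_inv \<kappa> x \<in> ?\<Omega> \<longleftrightarrow> x \<in> K" if "x \<in> chart_range \<kappa>"
      using that K snd_chart_inv[OF c] by (metis (no_types, lifting) image_iff subsetD)
    then show "?w x *\<^sub>R (indicator ?\<Omega> (?I x) *\<^sub>R f (?I x)) = indicator K x *\<^sub>R (f (chart_inv \<kappa> x) * sqrt (det (g \<kappa> x)))"
      using K by (auto simp: indicator_def)
  qed
  also have "\<dots> = integral K (\<lambda>x. f (chart_inv \<kappa> x) * sqrt (det (g \<kappa> x)))"
  proof (rule set_borel_integral_eq_integral(2))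
    have "continuous_on K (\<lambda>x. f (chart_inv \<kappa> x) * sqrt (det (g \<kappa> x)))"
      using continuous_on_subset[OF continuous_on_sqrt_det[OF metric_on_chart[OF M \<kappa>]] K(2)]
      by (intro continuous_on_mult f)
    then show "set_integrable lborel K (\<lambda>x. f (chart_inv \<kappa> x) * sqrt (det (g \<kappa> x)))"
      unfolding set_integrable_def by (rule borel_integrable_compact[OF K(1)])
  qed
  finally show ?thesis .
qed

section \<open>Tangential variations\<close>

lemma smooth_on_Pair:
  assumes "open S" "smooth_on S f" "smooth_on S g"
  shows "smooth_on S (\<lambda>x. (f x, g x))"
proof -
  have "bounded_linear (\<lambda>y. (y, 0))" "bounded_linear (\<lambda>y. (0, y))"
    by (intro bounded_linear_Pair bounded_linear_ident bounded_linear_zero)+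
  then have "smooth_on S (\<lambda>x. (f x, 0) + (0, g x))"
    using assms by (intro smooth_on_add smooth_on_bounded_linear_compose[of "\<lambda>y. (y, 0)"]
        smooth_on_bounded_linear_compose[of "\<lambda>y. (0, y)"])
  then show ?thesis by simp
qed

lemma integral_supported:
  fixes u :: "'a::euclidean_space \<Rightarrow> real"
  assumes "\<And>x. x \<notin> S \<Longrightarrow> u x = 0"
  shows "integral S u = integral UNIV u"
proof -
  have "(\<lambda>x. if x \<in> S then u x else 0) = u" using assms by auto
  then show ?thesis using integral_restrict_UNIV[of S u] by simp
qed

text \<open>Joint smoothness makes the \<open>t\<close>-derivative continuous on the product with
  the cube, as Leibniz's rule requires.\<close>

lemma leibniz_smooth:
  fixes f :: "real \<times> 'a::euclidean_space \<Rightarrow> real"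
  assumes f: "smooth_on ({-r<..<r} \<times> U) f" and r: "r > 0" and sub: "cbox a b \<subseteq> U"
  shows "((\<lambda>t. integral (cbox a b) (\<lambda>x. f (t, x))) has_real_derivative
     integral (cbox a b) (\<lambda>x. frechet_derivative f (at (0, x)) (1, 0))) (at 0)"
proof -
  let ?I = "{-r<..<r}"
  have "((\<lambda>t. integral (cbox a b) (\<lambda>x. f (t, x))) has_real_derivative
     integral (cbox a b) (\<lambda>x. frechet_derivative f (at (0, x)) (1, 0))) (at 0 within ?I)"
  proof (rule leibniz_rule_field_derivative[where fx = "\<lambda>t x. frechet_derivative f (at (t, x)) (1, 0)"])
    fix t x assume tx: "t \<in> ?I" "x \<in> cbox a b"
    have "((\<lambda>s. f ((0, x) + s *\<^sub>R (1, 0))) has_real_derivative frechet_derivative f (at ((0, x) + t *\<^sub>R (1, 0))) (1, 0)) (at t)"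
      using tx sub by (intro smooth_on_has_real_derivative_line[OF f]) auto
    then show "((\<lambda>t. f (t, x)) has_real_derivative frechet_derivative f (at (t, x)) (1, 0)) (at t within ?I)"
      by (simp add: has_field_derivative_at_within)
  next
    fix t assume t: "t \<in> ?I"
    have "continuous_on (cbox a b) (\<lambda>x. f (t, x))"
      using t sub by (intro continuous_on_compose2[OF smooth_on_imp_continuous_on[OF f]] continuous_intros) auto
    then show "(\<lambda>x. f (t, x)) integrable_on cbox a b" by (rule integrable_continuous)
  next
    have "continuous_on (?I \<times> U) (\<lambda>p. frechet_derivative f (at p) (1, 0))"
      by (intro smooth_on_imp_continuous_on smooth_on_frechet_derivative f)
    then have "continuous_on (?I \<times> cbox a b) (\<lambda>p. frechet_derivative f (at p) (1, 0))"
      by (rule continuous_on_subset) (use sub in auto)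
    then show "continuous_on (?I \<times> cbox a b) (\<lambda>(t, x). frechet_derivative f (at (t, x)) (1, 0))"
      by (simp add: case_prod_unfold)
  qed (use r in auto)
  moreover have "at 0 within ?I = at 0" by (rule at_within_open) (use r in auto)
  ultimately show ?thesis by (simp only:)
qed

text \<open>Partial integration on a cube without Fubini: the integral of a translate \<open>u (x + t e\<^sub>k)\<close> does not
  depend on \<open>t\<close>.\<close>

lemma integral_partial_eq_0:
  fixes u :: "real^'n \<Rightarrow> real"
  assumes u: "smooth_on UNIV u" and r: "r > 0" and supp: "\<And>x. dist x x0 \<ge> r \<Longrightarrow> u x = 0"
    and sub: "ball x0 (2 * r) \<subseteq> cbox a b"
  shows "integral (cbox a b) (partial k u) = 0"
proof -
  let ?v = "axis k 1 :: real^'n"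
  let ?f = "\<lambda>p. u (snd p + fst p *\<^sub>R ?v)"
  have sf: "smooth_on ({-r<..<r} \<times> UNIV) ?f"
    by (rule smooth_on_compose[OF u])
      (auto intro!: open_Times smooth_on_add smooth_on_scaleR smooth_on_fst smooth_on_snd smooth_on_id smooth_on_const)
  \<comment> \<open>The cube shifted by less than \<open>r\<close> still contains the support of
    \<open>u\<close>, because it holds the ball of radius \<open>2 * r\<close> around
    \<open>x0\<close>.\<close>
  have const: "integral (cbox a b) (\<lambda>x. u (x + t *\<^sub>R ?v)) = integral UNIV u" if "\<bar>t\<bar> < r" for t
  proof -
    have "integral (cbox a b) (\<lambda>x. u (x + t *\<^sub>R ?v)) = integral (cbox (a + t *\<^sub>R ?v) (b + t *\<^sub>R ?v)) u"
      using integral_shift_cbox_plus[of a b u "t *\<^sub>R ?v"] by (simp add: o_def add.commute)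
    also have "\<dots> = integral UNIV u"
    proof (rule integral_supported, rule supp, rule ccontr)
      fix x assume x: "x \<notin> cbox (a + t *\<^sub>R ?v) (b + t *\<^sub>R ?v)" "\<not> r \<le> dist x x0"
      have "dist (x - t *\<^sub>R ?v) x0 \<le> dist (x - t *\<^sub>R ?v) x + dist x x0" by (rule dist_triangle)
      also have "\<dots> < 2 * r" using x that by (simp add: dist_norm)
      finally have "x - t *\<^sub>R ?v \<in> cbox a b" using sub by (auto simp: dist_commute)
      then have "t *\<^sub>R ?v + (x - t *\<^sub>R ?v) \<in> cbox (t *\<^sub>R ?v + a) (t *\<^sub>R ?v + b)"
        unfolding cbox_translation by (rule imageI)
      then have "x \<in> cbox (a + t *\<^sub>R ?v) (b + t *\<^sub>R ?v)"
        by (simp add: add.commute)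
      then show False using x by simp
    qed
    finally show ?thesis .
  qed
  have "((\<lambda>t. integral (cbox a b) (\<lambda>x. ?f (t, x))) has_real_derivative
     integral (cbox a b) (\<lambda>x. frechet_derivative ?f (at (0, x)) (1, 0))) (at 0)"
    by (rule leibniz_smooth[OF sf r]) auto
  moreover have "((\<lambda>t. integral (cbox a b) (\<lambda>x. ?f (t, x))) has_real_derivative 0) (at 0)"
    by (rule has_field_derivative_transform_within_open[of "\<lambda>t. integral UNIV u" _ _ "{-r<..<r}"])
       (use r const in \<open>auto simp: abs_less_iff\<close>)
  ultimately have "integral (cbox a b) (\<lambda>x. frechet_derivative ?f (at (0, x)) (1, 0)) = 0"
    by (rule DERIV_unique)
  moreover have "frechet_derivative ?f (at (0, x)) (1, 0) = partial k u x" for x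
  proof -
    have "((\<lambda>s. ?f ((0, x) + s *\<^sub>R (1, 0))) has_real_derivative frechet_derivative ?f (at ((0, x) + 0 *\<^sub>R (1, 0))) (1, 0)) (at 0)"
      using r by (intro smooth_on_has_real_derivative_line[OF sf]) auto
    moreover have "((\<lambda>s. u (x + s *\<^sub>R ?v)) has_real_derivative partial k u (x + 0 *\<^sub>R ?v)) (at 0)"
      unfolding partial_def by (intro smooth_on_has_real_derivative_line[OF u]) auto
    ultimately show ?thesis by (auto dest: DERIV_unique)
  qed
  ultimately show ?thesis by simp
qed

text \<open>The open sets \<open>U\<close> and \<open>- S\<close> cover the space; on the first the
  function is \<open>f\<close>, on the second it is zero.\<close>

lemma smooth_on_UNIV_cutoff:
  fixes f :: "'a::euclidean_space \<Rightarrow> real"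
  assumes "open U" "smooth_on U f" "closed S" "S \<subseteq> U" "\<And>x. x \<in> U - S \<Longrightarrow> f x = 0"
  shows "smooth_on UNIV (\<lambda>x. if x \<in> U then f x else 0)"
proof (rule smooth_on_local)
  fix x :: 'a
  show "\<exists>W. open W \<and> x \<in> W \<and> smooth_on W (\<lambda>x. if x \<in> U then f x else 0)"
  proof (cases "x \<in> U")
    case True
    have "smooth_on U (\<lambda>x. if x \<in> U then f x else 0)"
      by (rule smooth_on_cong[OF assms(1) _ assms(2)]) simp
    then show ?thesis using True assms by blast
  next
    case False
    have "smooth_on (- S) (\<lambda>x. if x \<in> U then f x else 0)"
      by (rule smooth_on_cong[OF _ _ smooth_on_const[of _ 0]]) (use assms in auto)
    then show ?thesis using False assms by (intro exI[of _ "- S"]) auto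
  qed
qed

text \<open>The radii are such that \<open>\<psi> t\<close> maps \<open>C\<close> to itself for \<open>|t| < r\<close>; it need not be a diffeomorphism.\<close>

locale chart_variation =
  fixes A :: "('p::{t2_space,second_countable_topology}, 'm::finite) chart set"
    and B :: "('q::{t2_space,second_countable_topology}, 'n::finite) chart set"
    and \<phi> :: "'p \<Rightarrow> 'q" and \<kappa> \<nu> and C :: "(real^'m) set" and x0 :: "real^'m" and r :: real and \<eta> :: "real^'m \<Rightarrow> real" and v :: "real^'m"
  assumes atA: "smooth_atlas A" and atB: "smooth_atlas B" and sm: "smooth_map A B \<phi>"
    and \<kappa>: "\<kappa> \<in> A" and \<nu>: "\<nu> \<in> B"
    and C: "compact C" "C \<subseteq> snd \<kappa> ` (fst \<kappa> \<inter> \<phi> -` fst \<nu>)"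
    and r: "r > 0" "ball x0 (2 * r) \<subseteq> C"
    and \<eta>: "smooth_on UNIV \<eta>" "\<And>x. \<eta> x \<ge> 0" "\<And>x. \<eta> x \<le> 1" "\<And>x. dist x x0 \<ge> r \<Longrightarrow> \<eta> x = 0"
    and v: "norm v = 1"
begin

definition U where "U = snd \<kappa> ` (fst \<kappa> \<inter> \<phi> -` fst \<nu>)"

definition \<psi> where "\<psi> t x = x + (t * \<eta> x) *\<^sub>R v"

text \<open>Precomposition of \<open>\<phi>\<close> with \<open>\<psi> t\<close>, transported to the
  surface. As \<open>\<psi> t\<close> is the identity off \<open>C\<close>, the two cases fit
  together smoothly.\<close>

definition \<Phi> where "\<Phi> t p = (if p \<in> fst \<kappa> then \<phi> (chart_inv \<kappa> (\<psi> t (snd \<kappa> p))) else \<phi> p)"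

definition \<Omega> where "\<Omega> = chart_inv \<kappa> ` C"

lemma c: "is_chart \<kappa>" "is_chart \<nu>" using smooth_atlas_is_chart atA atB \<kappa> \<nu> by blast+

lemma cont_\<phi>: "continuous_on S \<phi>"
  using sm continuous_on_subset unfolding smooth_map_def by blast

lemma open_U: "open U" unfolding U_def
  using c cont_\<phi> by (intro open_chart_image open_vimage is_chart_open)

lemma U_range: "U \<subseteq> chart_range \<kappa>" by (auto simp: U_def chart_range_def)

lemma C_U: "C \<subseteq> U" using C by (simp add: U_def)

lemma \<psi>_id: "x \<notin> C \<Longrightarrow> \<psi> t x = x"
  using r \<eta>(4)[of x] by (force simp: \<psi>_def dist_commute)

lemma \<psi>_0: "\<psi> 0 x = x" by (simp add: \<psi>_def)

text \<open>Points outside the support of \<open>\<eta>\<close> stay fixed; the others start within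
  \<open>r\<close> of \<open>x0\<close> and move by less than \<open>r\<close>, hence stay in the
  ball of radius \<open>2 * r\<close>.\<close>

lemma \<psi>_C: "\<bar>t\<bar> < r \<Longrightarrow> x \<in> C \<Longrightarrow> \<psi> t x \<in> C"
proof (cases "dist x x0 \<ge> r")
  case True
  then show "x \<in> C \<Longrightarrow> \<psi> t x \<in> C" using \<eta>(4) by (simp add: \<psi>_def)
next
  case False
  assume t: "\<bar>t\<bar> < r"
  have "\<bar>t\<bar> * \<eta> x \<le> \<bar>t\<bar> * 1" using \<eta>(2,3) by (intro mult_left_mono) auto
  then have "dist (\<psi> t x) x \<le> \<bar>t\<bar>" using \<eta>(2) v by (simp add: \<psi>_def dist_norm abs_mult)
  then have "dist (\<psi> t x) x0 < 2 * r" using dist_triangle[of "\<psi> t x" x0 x] t False by simp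
  then show "\<psi> t x \<in> C" using r by (auto simp: dist_commute)
qed

lemma \<psi>_in: "\<bar>t\<bar> < r \<Longrightarrow> C \<subseteq> W \<Longrightarrow> x \<in> W \<Longrightarrow> \<psi> t x \<in> W"
  using \<psi>_C \<psi>_id by (metis subsetD)

lemma smooth_\<psi>:
  assumes "open W"
  shows "smooth_on W (\<lambda>p. \<psi> (fst p) (snd p))"
proof -
  have "smooth_on W (\<lambda>p. \<eta> (snd p))"
    by (rule smooth_on_compose[OF \<eta>(1) assms]) (auto intro: smooth_on_snd smooth_on_id assms)
  then show ?thesis unfolding \<psi>_def
    by (intro smooth_on_add smooth_on_scaleR smooth_on_mult smooth_on_fst smooth_on_snd smooth_on_id smooth_on_const assms)
qed

lemma \<Phi>_0: "\<Phi> 0 = \<phi>"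
  by (auto simp: \<Phi>_def \<psi>_0 chart_inv_snd c fun_eq_iff)

lemma \<Phi>_outside: "p \<notin> \<Omega> \<Longrightarrow> \<Phi> t p = \<phi> p"
proof (cases "p \<in> fst \<kappa>")
  case True
  assume "p \<notin> \<Omega>"
  then have "snd \<kappa> p \<notin> C" using chart_inv_snd[OF c(1) True] unfolding \<Omega>_def by (metis imageI)
  then show ?thesis using True by (simp add: \<Phi>_def \<psi>_id chart_inv_snd c)
qed (simp add: \<Phi>_def)

lemma compact_\<Omega>: "compact \<Omega>"
  unfolding \<Omega>_def using C C_U U_range
  by (intro compact_continuous_image continuous_on_subset[OF continuous_on_chart_inv[OF c(1)]]) auto

lemma \<Omega>_sub: "\<Omega> \<subseteq> fst \<kappa>"
  unfolding \<Omega>_def using C_U U_range chart_inv_in[OF c(1)] by auto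

lemma \<Phi>_chart_inv: "x \<in> chart_range \<kappa> \<Longrightarrow> \<Phi> t (chart_inv \<kappa> x) = \<phi> (chart_inv \<kappa> (\<psi> t x))"
  by (simp add: \<Phi>_def chart_inv_in snd_chart_inv c)

lemma local_rep_\<Phi>: "x \<in> U \<Longrightarrow> local_rep \<kappa> \<nu> (\<Phi> t) x = local_rep \<kappa> \<nu> \<phi> (\<psi> t x)"
  using U_range by (auto simp: local_rep_def \<Phi>_chart_inv)

lemma continuous_on_\<Phi>: "continuous_on ({-r<..<r} \<times> UNIV) (\<lambda>(t, p). \<Phi> t p)"
proof -
  let ?I = "{-r<..<r}"
  have 1: "continuous_on (?I \<times> fst \<kappa>) (\<lambda>(t, p). \<Phi> t p)"
  proof -
    have "continuous_on (?I \<times> fst \<kappa>) (\<lambda>q. (fst q, snd \<kappa> (snd q)))"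
      by (intro continuous_intros continuous_on_compose2[OF continuous_on_chart[OF c(1)] continuous_on_snd[OF continuous_on_id]]) auto
    then have "continuous_on (?I \<times> fst \<kappa>) (\<lambda>q. \<psi> (fst q) (snd \<kappa> (snd q)))"
      using continuous_on_compose2[OF smooth_on_imp_continuous_on[OF smooth_\<psi>[OF open_UNIV]], of "?I \<times> fst \<kappa>" "\<lambda>q. (fst q, snd \<kappa> (snd q))"]
      by simp
    then have "continuous_on (?I \<times> fst \<kappa>) (\<lambda>q. chart_inv \<kappa> (\<psi> (fst q) (snd \<kappa> (snd q))))"
      by (rule continuous_on_compose2[OF continuous_on_chart_inv[OF c(1)]])
         (use C_U U_range in \<open>auto intro!: \<psi>_in chart_snd_in\<close>)
    then have "continuous_on (?I \<times> fst \<kappa>) (\<lambda>q. \<phi> (chart_inv \<kappa> (\<psi> (fst q) (snd \<kappa> (snd q)))))"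
      by (rule continuous_on_compose2[OF cont_\<phi>[of UNIV]]) auto
    then show ?thesis by (rule continuous_on_eq) (auto simp: \<Phi>_def)
  qed
  have 2: "continuous_on (?I \<times> (- \<Omega>)) (\<lambda>(t, p). \<Phi> t p)"
  proof (rule continuous_on_eq)
    show "continuous_on (?I \<times> (- \<Omega>)) (\<lambda>q. \<phi> (snd q))"
      by (intro continuous_on_compose2[OF cont_\<phi>[of UNIV] continuous_on_snd[OF continuous_on_id]]) auto
  qed (auto simp: \<Phi>_outside)
  have "?I \<times> UNIV = ?I \<times> fst \<kappa> \<union> ?I \<times> (- \<Omega>)" using \<Omega>_sub by auto
  moreover have "open (?I \<times> fst \<kappa>)" "open (?I \<times> (- \<Omega>))"
    using is_chart_open(1)[OF c(1)] compact_imp_closed[OF compact_\<Omega>]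
    by (auto intro!: open_Times)
  ultimately show ?thesis
    using continuous_on_open_Un[OF _ _ 1 2] by (simp only:)
qed

lemma smooth_on_local_rep_\<phi>:
  "\<kappa>' \<in> A \<Longrightarrow> \<nu>' \<in> B \<Longrightarrow> smooth_on (snd \<kappa>' ` (fst \<kappa>' \<inter> \<phi> -` fst \<nu>')) (local_rep \<kappa>' \<nu>' \<phi>)"
  using sm by (simp add: smooth_map_def)

lemma open_variation_domain:
  assumes c': "is_chart \<kappa>'" "is_chart \<nu>'"
  shows "open {(t, x). t \<in> {-r<..<r} \<and> x \<in> chart_range \<kappa>' \<and> \<Phi> t (chart_inv \<kappa>' x) \<in> fst \<nu>'}" (is "open ?W")
proof -
  let ?I = "{-r<..<r}"
  have 1: "continuous_on (?I \<times> chart_range \<kappa>') (\<lambda>q. (fst q, chart_inv \<kappa>' (snd q)))"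
    by (intro continuous_intros continuous_on_compose2[OF continuous_on_chart_inv[OF c'(1)] continuous_on_snd[OF continuous_on_id]]) auto
  have "(\<lambda>q. (fst q, chart_inv \<kappa>' (snd q))) ` (?I \<times> chart_range \<kappa>') \<subseteq> ?I \<times> UNIV" by auto
  from continuous_on_compose2[OF continuous_on_\<Phi> 1 this]
  have "continuous_on (?I \<times> chart_range \<kappa>') (\<lambda>q. \<Phi> (fst q) (chart_inv \<kappa>' (snd q)))"
    by (simp add: case_prod_unfold)
  from continuous_open_preimage[OF this _ is_chart_open(1)[OF c'(2)]]
  have "open (?I \<times> chart_range \<kappa>' \<inter> (\<lambda>q. \<Phi> (fst q) (chart_inv \<kappa>' (snd q))) -` fst \<nu>')"
    using is_chart_open(2)[OF c'(1)] by (simp add: open_Times)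
  also have "?I \<times> chart_range \<kappa>' \<inter> (\<lambda>q. \<Phi> (fst q) (chart_inv \<kappa>' (snd q))) -` fst \<nu>' = ?W" by auto
  finally show ?thesis .
qed

text \<open>A chart \<open>\<kappa>'\<close> may reach beyond the domain of \<open>\<kappa>\<close>.
  There smoothness is checked on the complement of \<open>\<Omega>\<close>, where the variation is
  constant in time; elsewhere the transition to \<open>\<kappa>\<close> is used.\<close>

lemma smooth_on_\<Phi>:
  assumes \<kappa>': "\<kappa>' \<in> A" and \<nu>': "\<nu>' \<in> B"
  shows "smooth_on {(t, x). t \<in> {-r<..<r} \<and> x \<in> chart_range \<kappa>' \<and> \<Phi> t (chart_inv \<kappa>' x) \<in> fst \<nu>'}
          (\<lambda>(t, x). local_rep \<kappa>' \<nu>' (\<Phi> t) x)" (is "smooth_on ?W ?f")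
proof (rule smooth_on_local)
  have c': "is_chart \<kappa>'" "is_chart \<nu>'" using smooth_atlas_is_chart atA atB \<kappa>' \<nu>' by blast+
  let ?I = "{-r<..<r}"
  have oW: "open ?W" by (rule open_variation_domain[OF c'])
  fix q assume "q \<in> ?W"
  then obtain t x where q: "q = (t, x)" "t \<in> ?I" "x \<in> chart_range \<kappa>'" "\<Phi> t (chart_inv \<kappa>' x) \<in> fst \<nu>'" by auto
  show "\<exists>V. open V \<and> q \<in> V \<and> smooth_on V ?f"
  proof (cases "chart_inv \<kappa>' x \<in> fst \<kappa>")
    case True
    let ?D = "snd \<kappa>' ` (fst \<kappa>' \<inter> fst \<kappa>)"
    let ?V = "?W \<inter> (UNIV \<times> ?D)"
    have oD: "open ?D" by (rule open_chart_image[OF c'(1) is_chart_open(1)[OF c(1)]])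
    have oV: "open ?V" by (intro open_Int oW open_Times oD open_UNIV)
    have "x \<in> ?D" unfolding chart_image[OF c'(1)] using q True by auto
    then have "q \<in> ?V" using \<open>q \<in> ?W\<close> q by auto
    have T: "smooth_on ?V (\<lambda>q. transition \<kappa>' \<kappa> (snd q))"
      by (rule smooth_on_compose[OF smooth_on_transition[OF atA \<kappa>' \<kappa>] oV oD smooth_on_snd[OF oV smooth_on_id]]) auto
    have psi: "smooth_on ?V (\<lambda>q. \<psi> (fst q) (transition \<kappa>' \<kappa> (snd q)))"
    proof -
      have "smooth_on ?V (\<lambda>q. \<eta> (transition \<kappa>' \<kappa> (snd q)))"
        by (rule smooth_on_compose[OF \<eta>(1) oV open_UNIV T]) auto
      then show ?thesis unfolding \<psi>_def
        by (intro smooth_on_add smooth_on_scaleR smooth_on_mult smooth_on_fst smooth_on_id smooth_on_const oV T)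
    qed
    let ?U' = "snd \<kappa> ` (fst \<kappa> \<inter> \<phi> -` fst \<nu>')"
    have oU': "open ?U'" by (intro open_chart_image c open_vimage is_chart_open c' cont_\<phi>)
    have eqs: "\<psi> s (transition \<kappa>' \<kappa> y) \<in> ?U' \<and> local_rep \<kappa> \<nu>' \<phi> (\<psi> s (transition \<kappa>' \<kappa> y)) = local_rep \<kappa>' \<nu>' (\<Phi> s) y"
      if sy: "(s, y) \<in> ?V" for s y
    proof -
      obtain p where p: "p \<in> fst \<kappa>'" "p \<in> fst \<kappa>" "y = snd \<kappa>' p" using sy by auto
      have s: "\<bar>s\<bar> < r" using sy by auto
      have in_range: "\<psi> s (snd \<kappa> p) \<in> chart_range \<kappa>"
        by (rule \<psi>_in[OF s]) (use C_U U_range p in \<open>auto intro: chart_snd_in\<close>)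
      have \<Phi>p: "\<Phi> s p = \<phi> (chart_inv \<kappa> (\<psi> s (snd \<kappa> p)))" by (simp add: \<Phi>_def p)
      have "\<Phi> s p \<in> fst \<nu>'" using sy by (simp add: p chart_inv_snd c')
      then have "\<psi> s (snd \<kappa> p) \<in> ?U'"
        unfolding chart_image[OF c(1)] using in_range \<Phi>p by auto
      then show ?thesis
        by (simp add: transition_snd local_rep_def p chart_inv_snd c' \<Phi>p)
    qed
    have "smooth_on ?V (\<lambda>q. local_rep \<kappa> \<nu>' \<phi> (\<psi> (fst q) (transition \<kappa>' \<kappa> (snd q))))"
      by (rule smooth_on_compose[OF smooth_on_local_rep_\<phi>[OF \<kappa> \<nu>'] oV oU' psi]) (use eqs in force)
    then have "smooth_on ?V ?f"
      by (rule smooth_on_cong[OF oV, rotated]) (use eqs in force)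
    then show ?thesis using oV \<open>q \<in> ?V\<close> by blast
  next
    case False
    let ?D = "snd \<kappa>' ` (fst \<kappa>' \<inter> (- \<Omega>))"
    let ?V = "?W \<inter> (UNIV \<times> ?D)"
    have oD: "open ?D"
      using compact_imp_closed[OF compact_\<Omega>] by (intro open_chart_image c') auto
    have oV: "open ?V" by (intro open_Int oW open_Times oD open_UNIV)
    have "x \<in> ?D" unfolding chart_image[OF c'(1)] using q False \<Omega>_sub by auto
    then have "q \<in> ?V" using \<open>q \<in> ?W\<close> q by auto
    let ?U' = "snd \<kappa>' ` (fst \<kappa>' \<inter> \<phi> -` fst \<nu>')"
    have oU': "open ?U'" by (intro open_chart_image c' open_vimage is_chart_open cont_\<phi>)
    have eqs: "y \<in> ?U' \<and> local_rep \<kappa>' \<nu>' \<phi> y = local_rep \<kappa>' \<nu>' (\<Phi> s) y" if sy: "(s, y) \<in> ?V" for s y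
    proof -
      obtain p where p: "p \<in> fst \<kappa>'" "p \<notin> \<Omega>" "y = snd \<kappa>' p" using sy by auto
      then show ?thesis using sy by (auto simp: local_rep_def chart_inv_snd c' \<Phi>_outside)
    qed
    have "smooth_on ?V (\<lambda>q. local_rep \<kappa>' \<nu>' \<phi> (snd q))"
      by (rule smooth_on_compose[OF smooth_on_local_rep_\<phi>[OF \<kappa>' \<nu>'] oV oU' smooth_on_snd[OF oV smooth_on_id]])
         (use eqs in force)
    then have "smooth_on ?V ?f"
      by (rule smooth_on_cong[OF oV, rotated]) (use eqs in force)
    then show ?thesis using oV \<open>q \<in> ?V\<close> by blast
  qed
qed

lemma variation_in_\<Phi>: "variation_in A B \<Omega> \<phi> r \<Phi>"
  unfolding variation_in_def
  using r(1) \<Phi>_0 \<Phi>_outside continuous_on_\<Phi> smooth_on_\<Phi> by auto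

text \<open>Makes the independence of charts available for each map \<open>\<Phi> t\<close>, by
  restricting the variation to one time.\<close>

lemma smooth_map_\<Phi>:
  assumes t: "\<bar>t\<bar> < r"
  shows "smooth_map A B (\<Phi> t)"
  unfolding smooth_map_def
proof (intro conjI ballI)
  have 1: "continuous_on UNIV (\<lambda>p. (t, p))" by (intro continuous_intros)
  have "(\<lambda>p. (t, p)) ` UNIV \<subseteq> {-r<..<r} \<times> UNIV" using t by auto
  from continuous_on_compose2[OF continuous_on_\<Phi> 1 this]
  show cont: "continuous_on UNIV (\<Phi> t)" by simp
  fix \<kappa>' \<nu>' assume \<kappa>': "\<kappa>' \<in> A" and \<nu>': "\<nu>' \<in> B"
  have c': "is_chart \<kappa>'" "is_chart \<nu>'" using smooth_atlas_is_chart atA atB \<kappa>' \<nu>' by blast+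
  let ?U = "snd \<kappa>' ` (fst \<kappa>' \<inter> \<Phi> t -` fst \<nu>')"
  have oU: "open ?U" by (intro open_chart_image c' open_vimage is_chart_open cont)
  have "smooth_on ?U (\<lambda>x. case (t, x) of (t, x) \<Rightarrow> local_rep \<kappa>' \<nu>' (\<Phi> t) x)"
    by (rule smooth_on_compose[OF smooth_on_\<Phi>[OF \<kappa>' \<nu>'] oU open_variation_domain[OF c']
          smooth_on_Pair[OF oU smooth_on_const smooth_on_id]])
       (use t in \<open>auto simp: chart_snd_in chart_inv_snd c'\<close>)
  then show "smooth_on ?U (local_rep \<kappa>' \<nu>' (\<Phi> t))" by simp
qed

end

section \<open>The first variation of the bienergy\<close>

lemma posdef_det_pos_2:
  fixes M :: "real^2^2"
  assumes "posdef M"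
  shows "det M > 0"
proof -
  have sym: "M $ 2 $ 1 = M $ 1 $ 2" by (rule posdef_nth_commute[OF assms])
  have pos: "v \<noteq> 0 \<Longrightarrow> v \<bullet> (M *v v) > 0" for v using assms by (simp add: posdef_def)
  have "axis 1 1 \<bullet> (M *v axis 1 1) > 0" by (rule pos) (simp add: axis_eq_0_iff)
  then have a: "M $ 1 $ 1 > 0"
    by (simp add: inner_vec_def matrix_vector_mult_def sum_2 axis_def)
  \<comment> \<open>Orthogonal to the first row of \<open>M\<close>, so its quadratic form is
    \<open>M $ 1 $ 1 * det M\<close>.\<close>
  let ?v = "vector [- (M $ 1 $ 2), M $ 1 $ 1] :: real^2"
  have "?v $ 2 \<noteq> 0" using a by simp
  then have "?v \<noteq> 0" by (metis zero_index)
  from pos[OF this] have "M $ 1 $ 1 * det M > 0"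
    by (simp add: inner_vec_def matrix_vector_mult_def sum_2 det_2 sym algebra_simps)
  then show ?thesis using a by (simp add: zero_less_mult_iff)
qed

lemma smooth_on_metric_nth: "metric_on U G \<Longrightarrow> smooth_on U (\<lambda>x. G x $ i $ j)"
  unfolding metric_on_def by (intro smooth_on_vec_nth) auto

lemma smooth_on_metric_inv: "metric_on U G \<Longrightarrow> smooth_on U (\<lambda>x. matrix_inv (G x) $ i $ j)"
proof -
  assume G: "metric_on U G"
  then have "open U" by (simp add: metric_on_def)
  then show ?thesis
    by (rule smooth_on_matrix_inv) (simp_all add: smooth_on_metric_nth[OF G] posdef_det[OF metric_on_posdef[OF G]])
qed

lemma smooth_on_christoffel:
  assumes "metric_on U G"
  shows "smooth_on U (\<lambda>x. christoffel G x k i j)"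
proof -
  have o: "open U" using assms by (simp add: metric_on_def)
  show ?thesis unfolding christoffel_def
    by (intro smooth_on_mult[OF o] smooth_on_sum[OF o] smooth_on_const smooth_on_diff[OF o] smooth_on_add[OF o]
        smooth_on_metric_inv[OF assms] smooth_on_partial smooth_on_metric_nth[OF assms])
qed

lemma smooth_on_tension:
  assumes G: "metric_on U G" and K: "metric_on V K" and F: "smooth_on U F" "F ` U \<subseteq> V"
  shows "smooth_on U (\<lambda>x. tension G K F x $ c)"
proof -
  have o: "open U" "open V" using G K by (simp_all add: metric_on_def)
  have Fc: "smooth_on U (\<lambda>x. F x $ c)" for c by (rule smooth_on_vec_nth[OF o(1) F(1)])
  have Ch: "smooth_on U (\<lambda>x. christoffel K (F x) c d e)" for c d e
    by (rule smooth_on_compose[OF smooth_on_christoffel[OF K] o F])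
  show ?thesis
    unfolding tension_def hessian_map_def sum_component vector_scaleR_component vec_lambda_beta real_scaleR_def
    by (intro smooth_on_sum[OF o(1)] smooth_on_mult[OF o(1)] smooth_on_add[OF o(1)] smooth_on_diff[OF o(1)]
        smooth_on_metric_inv[OF G] smooth_on_partial Fc Ch smooth_on_christoffel[OF G])
qed

text \<open>Jacobi's formula for the derivative of a determinant, checked on the entries in
  dimension two. It will account for the volume density in the divergence.\<close>

lemma partial_sqrt_det_2:
  fixes G :: "real^2 \<Rightarrow> real^2^2"
  assumes G: "metric_on U G" "x \<in> U"
  shows "2 * partial k (\<lambda>y. sqrt (det (G y))) x =
    sqrt (det (G x)) * (\<Sum>i\<in>UNIV. \<Sum>j\<in>UNIV. matrix_inv (G x) $ i $ j * partial k (\<lambda>y. G y $ i $ j) x)"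
proof -
  have pd: "posdef (G x)" by (rule metric_on_posdef[OF G])
  have pos: "det (G x) > 0" by (rule posdef_det_pos_2[OF pd])
  have sym: "G x $ 2 $ 1 = G x $ 1 $ 2" by (rule posdef_nth_commute[OF pd])
  note d = metric_on_differentiable(2)[OF G]
  let ?d = "\<lambda>i j. partial k (\<lambda>y. G y $ i $ j) x"
  have dd: "(\<lambda>y. det (G y)) differentiable at x"
    unfolding det_2 by (intro differentiable_diff differentiable_mult d)
  have pdet: "partial k (\<lambda>y. det (G y)) x = ?d 1 1 * G x $ 2 $ 2 + G x $ 1 $ 1 * ?d 2 2
      - (?d 1 2 * G x $ 2 $ 1 + G x $ 1 $ 2 * ?d 2 1)"
    unfolding det_2 by (simp add: partial_diff partial_mult differentiable_mult d)
  have "((\<lambda>y. sqrt (det (G y))) has_derivative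
      (\<lambda>v. frechet_derivative (\<lambda>y. det (G y)) (at x) v * (inverse (sqrt (det (G x))) / 2))) (at x)"
    using has_derivative_real_sqrt[OF pos dd[unfolded frechet_derivative_works]] by (simp add: mult_ac)
  from partial_eqI[OF this, of k]
  have s: "partial k (\<lambda>y. sqrt (det (G y))) x = partial k (\<lambda>y. det (G y)) x * (inverse (sqrt (det (G x))) / 2)"
    by (simp add: partial_def)
  have inv: "matrix_inv (G x) $ 1 $ 1 = G x $ 2 $ 2 / det (G x)" "matrix_inv (G x) $ 1 $ 2 = - (G x $ 1 $ 2) / det (G x)"
    "matrix_inv (G x) $ 2 $ 1 = - (G x $ 2 $ 1) / det (G x)" "matrix_inv (G x) $ 2 $ 2 = G x $ 1 $ 1 / det (G x)"
    using pos by (subst matrix_inv_nth; simp add: det_2[of "vec_lambda _"] axis_def)+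
  have sq: "sqrt (det (G x)) * sqrt (det (G x)) = det (G x)" "sqrt (det (G x)) > 0" using pos by simp_all
  have "sqrt (det (G x)) * (\<Sum>i\<in>UNIV. \<Sum>j\<in>UNIV. matrix_inv (G x) $ i $ j * ?d i j) =
    sqrt (det (G x)) * (partial k (\<lambda>y. det (G y)) x / det (G x))"
    using pos by (simp add: sum_2 inv pdet sym add_divide_distrib diff_divide_distrib mult_ac)
  also have "\<dots> = partial k (\<lambda>y. det (G y)) x * inverse (sqrt (det (G x)))"
    using sq pos by (simp add: field_simps)
  finally show ?thesis by (simp add: s)
qed

text \<open>The trace of a metric with respect to itself is the dimension.\<close>

lemma tension_umbilical:
  fixes F :: "real^'m \<Rightarrow> real^'n"
  assumes G: "posdef (G y)" and hess: "\<And>i j. hessian_map G K F y i j = (l * G y $ i $ j) *\<^sub>R X"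
  shows "tension G K F y = (l * CARD('m)) *\<^sub>R X"
proof -
  have "(\<Sum>i\<in>UNIV. \<Sum>j\<in>UNIV. matrix_inv (G y) $ i $ j * G y $ i $ j) = (\<Sum>i\<in>(UNIV::'m set). 1)"
    using matrix_inv_sums(2)[OF posdef_invertible[OF G]]
    by (intro sum.cong refl) (subst posdef_nth_commute[OF G], simp)
  then have "(\<Sum>i\<in>UNIV. \<Sum>j\<in>UNIV. matrix_inv (G y) $ i $ j * (l * G y $ i $ j)) = l * CARD('m)"
    by (simp add: sum_distrib_left[symmetric] mult.left_commute[of _ l])
  then show ?thesis
    by (simp add: tension_def hess scaleR_sum_left[symmetric])
qed

text \<open>The tangential part of \<open>\<tau>(F \<circ> \<psi>)\<close> is \<open>dF(\<tau>(\<psi>))\<close>, and by umbilicity its normal part involves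
  \<open>\<psi>\<close> only through the energy density.\<close>

lemma tension_norm_umbilical_compose:
  fixes F :: "real^'m \<Rightarrow> real^'n" and \<psi> :: "real^'m \<Rightarrow> real^'m"
  assumes \<psi>: "open U" "smooth_on U \<psi>" "x \<in> U" "\<psi> ` U \<subseteq> U" and F: "smooth_on U F"
    and iso: "isometric_on U G K F" and K: "posdef (K (F (\<psi> x)))"
    and hess: "\<And>i j. hessian_map G K F (\<psi> x) i j = (l * G (\<psi> x) $ i $ j) *\<^sub>R X"
    and X: "metric_inner K (F (\<psi> x)) X X = 1" "\<And>i. metric_inner K (F (\<psi> x)) X (partial i F (\<psi> x)) = 0"
  shows "metric_inner K (F (\<psi> x)) (tension G K (\<lambda>y. F (\<psi> y)) x) (tension G K (\<lambda>y. F (\<psi> y)) x) =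
    metric_inner G (\<psi> x) (tension G G \<psi> x) (tension G G \<psi> x) +
    l\<^sup>2 * (\<Sum>b\<in>UNIV. \<Sum>c\<in>UNIV. (\<Sum>i\<in>UNIV. \<Sum>j\<in>UNIV. matrix_inv (G x) $ i $ j * partial i \<psi> x $ b * partial j \<psi> x $ c)
       * G (\<psi> x) $ b $ c)\<^sup>2"
proof -
  let ?e = "\<Sum>b\<in>UNIV. \<Sum>c\<in>UNIV. (\<Sum>i\<in>UNIV. \<Sum>j\<in>UNIV. matrix_inv (G x) $ i $ j * partial i \<psi> x $ b * partial j \<psi> x $ c)
       * G (\<psi> x) $ b $ c"
  let ?\<tau> = "tension G G \<psi> x" and ?m = "metric_inner K (F (\<psi> x))"
  let ?T = "\<Sum>b\<in>UNIV. ?\<tau> $ b *\<^sub>R partial b F (\<psi> x)"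
  have \<psi>x: "\<psi> x \<in> U" using \<psi> by auto
  have comm: "?m u v = ?m v u" for u v by (rule metric_inner_commute) (rule K)
  have T: "tension G K (\<lambda>y. F (\<psi> y)) x = ?T + (l * ?e) *\<^sub>R X"
    unfolding tension_compose[OF \<psi>(1-4,1) F, of G K G]
    by (simp add: hess scaleR_sum_left sum_distrib_left mult_ac)
  have TX: "?m ?T X = 0" by (simp add: metric_inner_sum_left metric_inner_linear comm[of _ X] X(2))
  have TT: "?m ?T ?T = metric_inner G (\<psi> x) ?\<tau> ?\<tau>"
    by (rule metric_inner_isometry[OF iso \<psi>x])
  show ?thesis
    unfolding T by (simp add: metric_inner_linear TT TX comm[of X ?T] X(1) power_mult_distrib power2_eq_square)
qed

section \<open>The bienergy along the tangential variation\<close>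

locale umbilical_variation =
  umbilical_surface A g B h \<phi> + chart_variation A B \<phi> \<kappa> \<nu> "cbox a b" x0 r \<eta> "axis k 1"
  for A :: "('p::{t2_space,second_countable_topology}, 2) chart set" and g
    and B :: "('q::{t2_space,second_countable_topology}, 3) chart set" and h
    and \<phi> \<kappa> \<nu> and a b :: "real^2" and x0 r \<eta> and k :: 2 +
  assumes bih: "biharmonic A g B h \<phi>"
begin

abbreviation "G \<equiv> g \<kappa>"
abbreviation "K \<equiv> h \<nu>"
abbreviation "F \<equiv> local_rep \<kappa> \<nu> \<phi>"
abbreviation "W \<equiv> {-r<..<r} \<times> U"

text \<open>At \<open>p = (t, x)\<close>, \<open>D p i c\<close> is \<open>\<partial>\<^sub>i\<psi>\<^sub>t\<^sup>c\<close>, \<open>tau p\<close> is the tension field of \<open>\<psi>\<^sub>t\<close> as a map of the surface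
  to itself, \<open>e p\<close> is \<open>|d\<psi>\<^sub>t|\<^sup>2\<close>, and \<open>w0 p\<close> turns out to be \<open>|\<tau>(\<phi> \<circ> \<psi>\<^sub>t)|\<^sup>2\<close>; \<open>lam\<close> is the square of the mean
  curvature.\<close>

definition lam where "lam x = metric_inner K (F x) (tension G K F x) (tension G K F x) / 4"

definition s where "s x = sqrt (det (G x))"

definition D where "D p i c = (if i = c then 1 else 0) + fst p * partial i \<eta> (snd p) * (axis k 1 :: real^2) $ c"

definition tau where "tau p c = (\<Sum>i\<in>UNIV. \<Sum>j\<in>UNIV. matrix_inv (G (snd p)) $ i $ j *
   (fst p * partial i (partial j \<eta>) (snd p) * (axis k 1 :: real^2) $ c
     - (\<Sum>m\<in>UNIV. christoffel G (snd p) m i j * D p m c)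
     + (\<Sum>d\<in>UNIV. \<Sum>e\<in>UNIV. christoffel G (\<psi> (fst p) (snd p)) c d e * D p i d * D p j e)))"

definition e where "e p = (\<Sum>c\<in>UNIV. \<Sum>d\<in>UNIV. (\<Sum>i\<in>UNIV. \<Sum>j\<in>UNIV. matrix_inv (G (snd p)) $ i $ j * D p i c * D p j d)
       * G (\<psi> (fst p) (snd p)) $ c $ d)"

definition w0 where "w0 p = (\<Sum>c\<in>UNIV. \<Sum>d\<in>UNIV. G (\<psi> (fst p) (snd p)) $ c $ d * tau p c * tau p d)
   + lam (\<psi> (fst p) (snd p)) * (e p)\<^sup>2"

definition w where "w p = w0 p * s (snd p)"

lemma metric_G: "metric_on U G"
  by (rule metric_on_subset[OF metric_on_chart[OF M \<kappa>] open_U U_range])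

lemma smooth_on_F: "smooth_on U F"
  using smooth_on_local_rep_\<phi>[OF \<kappa> \<nu>] by (simp add: U_def)

lemma F_range: "F ` U \<subseteq> chart_range \<nu>"
  using c by (auto simp: U_def local_rep_snd chart_snd_in)

lemma isoF: "isometric_on U G K F"
  unfolding U_def by (rule isometric_on_local_rep[OF iso \<kappa> \<nu>])

lemma metric_K: "metric_on (chart_range \<nu>) K"
  by (rule metric_on_chart[OF N \<nu>])

lemma open_W: "open W"
  by (intro open_Times open_U) auto

lemma hess:
  assumes "y \<in> U"
  obtains l X where
    "\<And>i j. hessian_map G K F y i j = (l * G y $ i $ j) *\<^sub>R X"
    "metric_inner K (F y) X X = 1" "\<And>i. metric_inner K (F y) X (partial i F y) = 0"
proof -
  obtain p where p: "p \<in> fst \<kappa>" "\<phi> p \<in> fst \<nu>" "y = snd \<kappa> p" using assms by (auto simp: U_def)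
  have "F y = snd \<nu> (\<phi> p)" by (simp add: p local_rep_snd c)
  then show ?thesis
    using umbilical_hessian_charts[OF \<kappa> p(1) \<nu> p(2)] that by (metis p(3))
qed

text \<open>\<open>lam\<close> is defined through the tension field, which is smooth, while the
  factor \<open>l\<close> is obtained only point by point; here the two are tied together.\<close>

lemma lam_eq:
  assumes "y \<in> U" "\<And>i j. hessian_map G K F y i j = (l * G y $ i $ j) *\<^sub>R X" "metric_inner K (F y) X X = 1"
  shows "lam y = l\<^sup>2"
  unfolding lam_def tension_umbilical[OF metric_on_posdef[OF metric_G assms(1)] assms(2)]
  by (simp add: metric_inner_linear assms(3) power2_eq_square)

lemma smooth_on_tension_F: "smooth_on U (\<lambda>x. tension G K F x $ c)"
  by (rule smooth_on_tension[OF metric_G metric_K smooth_on_F F_range])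

lemma smooth_on_lam: "smooth_on U lam"
proof -
  note o = open_U
  have Kc: "smooth_on U (\<lambda>x. K (F x) $ c $ d)" for c d
    by (rule smooth_on_compose[OF smooth_on_metric_nth[OF metric_K] o is_chart_open(2)[OF c(2)] smooth_on_F F_range])
  have "smooth_on U (\<lambda>x. metric_inner K (F x) (tension G K F x) (tension G K F x) * (1/4))"
    unfolding metric_inner_sum
    by (intro smooth_on_mult[OF o] smooth_on_sum[OF o] Kc smooth_on_tension_F smooth_on_const)
  then show ?thesis by (simp add: lam_def[abs_def])
qed

lemma s_pos: "x \<in> U \<Longrightarrow> s x > 0"
  by (simp add: s_def posdef_det_pos_2 metric_on_posdef[OF metric_G])

lemma smooth_on_s: "smooth_on U s"
  unfolding s_def[abs_def]
  by (intro smooth_on_sqrt[OF open_U] smooth_on_det[OF open_U] smooth_on_metric_nth[OF metric_G] posdef_det_pos_2 metric_on_posdef[OF metric_G])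

lemma \<psi>_U: "\<bar>t\<bar> < r \<Longrightarrow> x \<in> U \<Longrightarrow> \<psi> t x \<in> U"
  by (rule \<psi>_in[OF _ C_U])

lemma smooth_on_snd_W: "smooth_on U f \<Longrightarrow> smooth_on W (\<lambda>p. f (snd p))"
  by (rule smooth_on_compose[OF _ open_W open_U smooth_on_snd[OF open_W smooth_on_id]]) auto

lemma smooth_on_\<psi>_W: "smooth_on U f \<Longrightarrow> smooth_on W (\<lambda>p. f (\<psi> (fst p) (snd p)))"
  by (rule smooth_on_compose[OF _ open_W open_U smooth_\<psi>[OF open_W]]) (auto intro!: \<psi>_U)

lemma \<eta>_U: "smooth_on U \<eta>"
  using smooth_on_subset[OF \<eta>(1)] by blast

lemma smooth_on_D: "smooth_on W (\<lambda>p. D p i c)"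
  unfolding D_def
  by (intro smooth_on_add smooth_on_mult smooth_on_const smooth_on_fst smooth_on_id open_W
      smooth_on_snd_W[of "partial _ \<eta>"] smooth_on_partial \<eta>_U)

lemma smooth_on_tau: "smooth_on W (\<lambda>p. tau p c)"
  unfolding tau_def
  by (intro smooth_on_sum[OF open_W] smooth_on_mult[OF open_W] smooth_on_add[OF open_W] smooth_on_diff[OF open_W]
      smooth_on_const smooth_on_fst[OF open_W] smooth_on_id smooth_on_D
      smooth_on_snd_W[of "partial _ (partial _ \<eta>)"] smooth_on_partial \<eta>_U
      smooth_on_snd_W[OF smooth_on_metric_inv[OF metric_G]] smooth_on_snd_W[OF smooth_on_christoffel[OF metric_G]]
      smooth_on_\<psi>_W[OF smooth_on_christoffel[OF metric_G]])

lemma smooth_on_e: "smooth_on W e"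
  unfolding e_def[abs_def]
  by (intro smooth_on_sum[OF open_W] smooth_on_mult[OF open_W] smooth_on_D
      smooth_on_snd_W[OF smooth_on_metric_inv[OF metric_G]] smooth_on_\<psi>_W[OF smooth_on_metric_nth[OF metric_G]])

lemma smooth_on_w0: "smooth_on W w0"
  unfolding w0_def[abs_def]
  by (intro smooth_on_sum[OF open_W] smooth_on_mult[OF open_W] smooth_on_add[OF open_W] smooth_on_power[OF open_W] smooth_on_tau smooth_on_e
      smooth_on_\<psi>_W[OF smooth_on_lam] smooth_on_\<psi>_W[OF smooth_on_metric_nth[OF metric_G]])

lemma smooth_on_w: "smooth_on W w"
  unfolding w_def[abs_def] by (intro smooth_on_mult[OF open_W] smooth_on_w0 smooth_on_snd_W smooth_on_s)

lemma smooth_on_\<psi>_slice: "smooth_on S (\<psi> t)" if "open S"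
  unfolding \<psi>_def using smooth_on_subset[OF \<eta>(1), of S]
  by (intro smooth_on_add smooth_on_scaleR smooth_on_mult smooth_on_const smooth_on_id that) auto

lemma partial_\<psi>: "partial i (\<lambda>y. \<psi> t y $ c) = (\<lambda>x. D (t, x) i c)"
proof
  fix x
  have d: "\<eta> differentiable at x" using smooth_on_imp_differentiable[OF \<eta>(1)] by simp
  have "partial i (\<lambda>y. y $ c + t * \<eta> y * (axis k 1 :: real^2) $ c) x = D (t, x) i c"
    by (subst partial_add) (auto simp: D_def partial_mult d intro!: differentiable_mult differentiable_vec_nth)
  then show "partial i (\<lambda>y. \<psi> t y $ c) x = D (t, x) i c" by (simp add: \<psi>_def)
qed

lemma tension_\<psi>: "tension G G (\<psi> t) x $ c = tau (t, x) c"
proof -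
  have d: "partial j \<eta> differentiable at x" for j
    using smooth_on_imp_differentiable[OF smooth_on_partial[OF \<eta>(1)]] by simp
  have "partial i (\<lambda>x. D (t, x) j c) x = t * partial i (partial j \<eta>) x * (axis k 1 :: real^2) $ c" for i j c
    unfolding D_def by (subst partial_add) (auto simp: partial_mult d intro!: differentiable_mult)
  then show ?thesis
    by (simp add: tension_def hessian_map_def partial_\<psi> tau_def)
qed

text \<open>In the charts \<open>\<kappa>\<close> and \<open>\<nu>\<close> the varied map is
  \<open>F\<close> after \<open>\<psi> t\<close>. Umbilicity at \<open>\<psi> t x\<close> expresses
  its tension by data of \<open>\<psi> t\<close> alone and \<open>lam\<close>, which gives an
  explicit, jointly smooth integrand.\<close>

lemma tension_norm_sq_\<Phi>:
  assumes t: "\<bar>t\<bar> < r" and x: "x \<in> U"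
  shows "tension_norm_sq A g B h (\<Phi> t) (chart_inv \<kappa> x) = w0 (t, x)"
proof -
  have xr: "x \<in> chart_range \<kappa>" using x U_range by auto
  let ?p = "chart_inv \<kappa> x"
  have p: "?p \<in> fst \<kappa>" "snd \<kappa> ?p = x" using c xr by (simp_all add: chart_inv_in snd_chart_inv)
  have \<psi>x: "\<psi> t x \<in> U" by (rule \<psi>_U[OF t x])
  have \<psi>sub: "\<psi> t ` U \<subseteq> U" using \<psi>_U[OF t] by auto
  have s\<psi>: "smooth_on U (\<psi> t)" by (rule smooth_on_\<psi>_slice[OF open_U])
  obtain q where q: "q \<in> fst \<kappa>" "\<phi> q \<in> fst \<nu>" "\<psi> t x = snd \<kappa> q" using \<psi>x by (auto simp: U_def)
  have \<Phi>p: "\<Phi> t ?p = \<phi> q" using xr by (simp add: \<Phi>_chart_inv q chart_inv_snd c)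
  have Fq: "snd \<nu> (\<Phi> t ?p) = F (\<psi> t x)" by (simp add: \<Phi>p q local_rep_snd c)
  have "tension_norm_sq A g B h (\<Phi> t) ?p = metric_inner K (snd \<nu> (\<Phi> t ?p))
     (tension G K (local_rep \<kappa> \<nu> (\<Phi> t)) (snd \<kappa> ?p)) (tension G K (local_rep \<kappa> \<nu> (\<Phi> t)) (snd \<kappa> ?p))"
    by (rule riemannian_map.tension_norm_sq_charts[OF riemannian_map.intro[OF M N smooth_map_\<Phi>[OF t]] \<kappa> p(1) \<nu>])
      (simp add: \<Phi>p q)
  also have "tension G K (local_rep \<kappa> \<nu> (\<Phi> t)) (snd \<kappa> ?p) = tension G K (\<lambda>y. F (\<psi> t y)) x"
    unfolding p
    by (rule tension_cong[OF open_U x, symmetric])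
       (auto simp: local_rep_\<Phi> intro: smooth_on_compose[OF smooth_on_F open_U open_U s\<psi> \<psi>sub])
  also note Fq
  finally have 1: "tension_norm_sq A g B h (\<Phi> t) ?p = metric_inner K (F (\<psi> t x))
     (tension G K (\<lambda>y. F (\<psi> t y)) x) (tension G K (\<lambda>y. F (\<psi> t y)) x)" .
  obtain l X where lX: "\<And>i j. hessian_map G K F (\<psi> t x) i j = (l * G (\<psi> t x) $ i $ j) *\<^sub>R X"
    "metric_inner K (F (\<psi> t x)) X X = 1" "\<And>i. metric_inner K (F (\<psi> t x)) X (partial i F (\<psi> t x)) = 0"
    using hess[OF \<psi>x] by blast
  have pK: "posdef (K (F (\<psi> t x)))" using metric_on_posdef[OF metric_K] F_range \<psi>x by blast
  have P: "partial i (\<psi> t) x $ d = D (t, x) i d" for i d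
    using partial_vec_nth[OF smooth_on_imp_differentiable[OF s\<psi> x], of i d] by (simp add: partial_\<psi>)
  have e: "(\<Sum>c\<in>UNIV. \<Sum>d\<in>UNIV. (\<Sum>i\<in>UNIV. \<Sum>j\<in>UNIV. matrix_inv (G x) $ i $ j * partial i (\<psi> t) x $ c * partial j (\<psi> t) x $ d)
       * G (\<psi> t x) $ c $ d) = e (t, x)"
    by (simp add: e_def P)
  show ?thesis
    unfolding 1 tension_norm_umbilical_compose[OF open_U s\<psi> x \<psi>sub smooth_on_F isoF pK lX] e
    by (simp add: w0_def lam_eq[OF \<psi>x lX(1,2)] metric_inner_sum tension_\<psi>)
qed

lemma bienergy_\<Phi>:
  assumes t: "\<bar>t\<bar> < r"
  shows "bienergy A g B h \<Omega> (\<Phi> t) = 1/2 * integral (cbox a b) (\<lambda>x. w (t, x))"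
proof -
  have sub: "cbox a b \<subseteq> chart_range \<kappa>" using C_U U_range by auto
  have "continuous_on (cbox a b) (\<lambda>x. w0 (t, x))"
    using t C_U by (intro continuous_on_compose2[OF smooth_on_imp_continuous_on[OF smooth_on_w0]] continuous_intros) auto
  then have cont: "continuous_on (cbox a b) (\<lambda>x. tension_norm_sq A g B h (\<Phi> t) (chart_inv \<kappa> x))"
    by (rule continuous_on_eq) (use t C_U tension_norm_sq_\<Phi> in auto)
  have "set_lebesgue_integral (riemannian_volume A g) \<Omega> (tension_norm_sq A g B h (\<Phi> t)) =
    integral (cbox a b) (\<lambda>x. tension_norm_sq A g B h (\<Phi> t) (chart_inv \<kappa> x) * sqrt (det (g \<kappa> x)))"
    unfolding \<Omega>_def
    by (rule set_lebesgue_integral_chart[OF M _ \<kappa> C(1) sub cont])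
       (intro less_imp_le posdef_det_pos_2 metric_on_posdef[OF metric_on_chart[OF M]])
  also have "\<dots> = integral (cbox a b) (\<lambda>x. w (t, x))"
    by (rule integral_cong) (use t C_U tension_norm_sq_\<Phi> in \<open>auto simp: w_def s_def\<close>)
  finally show ?thesis by (simp add: bienergy_def)
qed

lemma integral_derivative_w: "integral (cbox a b) (\<lambda>x. frechet_derivative w (at (0, x)) (1, 0)) = 0"
proof -
  have "compact \<Omega>" by (rule compact_\<Omega>)
  then have "((\<lambda>t. bienergy A g B h \<Omega> (\<Phi> t)) has_real_derivative 0) (at 0)"
    using bih variation_in_\<Phi> unfolding biharmonic_def by blast
  then have "((\<lambda>t. 1/2 * integral (cbox a b) (\<lambda>x. w (t, x))) has_real_derivative 0) (at 0)"
    by (rule has_field_derivative_transform_within_open[of _ _ _ "{-r<..<r}"]) (use r(1) bienergy_\<Phi> in auto)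
  moreover have "((\<lambda>t. 1/2 * integral (cbox a b) (\<lambda>x. w (t, x))) has_real_derivative
     1/2 * integral (cbox a b) (\<lambda>x. frechet_derivative w (at (0, x)) (1, 0))) (at 0)"
    by (intro DERIV_cmult leibniz_smooth[OF smooth_on_w r(1) C_U])
  ultimately show ?thesis by (auto dest: DERIV_unique)
qed

lemma DERIV_slice:
  assumes "smooth_on W f" "x \<in> U"
  shows "((\<lambda>t. f (t, x)) has_real_derivative frechet_derivative f (at (0, x)) (1, 0)) (at 0)"
proof -
  have "((\<lambda>s. f ((0, x) + s *\<^sub>R (1, 0))) has_real_derivative frechet_derivative f (at ((0, x) + 0 *\<^sub>R (1, 0))) (1, 0)) (at 0)"
    using assms r by (intro smooth_on_has_real_derivative_line[OF assms(1)]) auto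
  then show ?thesis by simp
qed

lemma DERIV_\<psi>:
  assumes "smooth_on U f" "x \<in> U"
  shows "((\<lambda>t. f (\<psi> t x)) has_real_derivative \<eta> x * partial k f x) (at 0)"
proof -
  have "((\<lambda>t. f (x + t *\<^sub>R (\<eta> x *\<^sub>R axis k 1))) has_real_derivative
      frechet_derivative f (at (x + 0 *\<^sub>R (\<eta> x *\<^sub>R axis k 1))) (\<eta> x *\<^sub>R axis k 1)) (at 0)"
    using assms by (intro smooth_on_has_real_derivative_line) auto
  moreover have "linear (frechet_derivative f (at x))"
    using assms by (intro linear_frechet_derivative smooth_on_imp_differentiable)
  ultimately show ?thesis by (simp add: \<psi>_def partial_def linear_scale)
qed

lemma D_0: "D (0, x) i c = (if i = c then 1 else 0)" by (simp add: D_def)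

text \<open>At time zero the second derivatives of \<open>\<eta>\<close> carry the factor 0, and the
  two Christoffel sums agree: the identity is totally geodesic.\<close>

lemma tau_0: "tau (0, x) c = 0"
  by (simp add: tau_def D_0 \<psi>_0 if_distrib[of "\<lambda>t. _ * t"] if_distrib[of "\<lambda>t. t * _"] cong: if_cong)

lemma e_0:
  assumes "x \<in> U" shows "e (0, x) = 2"
proof -
  have pd: "posdef (G x)" by (rule metric_on_posdef[OF metric_G assms])
  have "e (0, x) = (\<Sum>c\<in>UNIV. \<Sum>d\<in>UNIV. matrix_inv (G x) $ c $ d * G x $ d $ c)"
    by (simp add: e_def D_0 \<psi>_0 if_distrib[of "\<lambda>t. _ * t"] posdef_nth_commute[OF pd] cong: if_cong)
  then show ?thesis by (simp add: matrix_inv_sums[OF posdef_invertible[OF pd]])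
qed

text \<open>The trace of the logarithmic derivative of the metric in direction \<open>k\<close>. By
  Jacobi's formula, \<open>s x * trd x\<close> is twice the \<open>k\<close>-th derivative of
  \<open>s\<close>.\<close>

definition trd where "trd x = (\<Sum>i\<in>UNIV. \<Sum>j\<in>UNIV. matrix_inv (G x) $ i $ j * partial k (\<lambda>y. G y $ i $ j) x)"

lemma DERIV_D: "((\<lambda>t. D (t, x) i c) has_real_derivative partial i \<eta> x * (axis k 1 :: real^2) $ c) (at 0)"
  unfolding D_def by (auto intro!: derivative_eq_intros)

text \<open>The value is the trace of the Lie derivative of \<open>G\<close> along X = \<eta> e_k,
  that is 2 div X. The moved argument of \<open>G\<close> gives the first summand, and each of the
  two factors \<open>D\<close> gives one copy of \<open>partial k \<eta> x\<close>.\<close>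

lemma DERIV_e:
  assumes x: "x \<in> U"
  shows "((\<lambda>t. e (t, x)) has_real_derivative \<eta> x * trd x + 2 * partial k \<eta> x) (at 0)"
proof -
  have pd: "posdef (G x)" by (rule metric_on_posdef[OF metric_G x])
  note inv = matrix_inv_sums[OF posdef_invertible[OF pd]]
  let ?I = "matrix_inv (G x)" and ?v = "axis k 1 :: real^2"
  let ?q = "\<lambda>i j c d. (?I $ i $ j * D (0, x) i c) * (partial j \<eta> x * ?v $ d)
      + (?I $ i $ j * (partial i \<eta> x * ?v $ c)) * D (0, x) j d"
  let ?Q = "\<lambda>c d. \<Sum>i\<in>UNIV. \<Sum>j\<in>UNIV. ?I $ i $ j * D (0, x) i c * D (0, x) j d"
  define E where "E = (\<Sum>c\<in>UNIV. \<Sum>d\<in>UNIV. (\<Sum>i\<in>UNIV. \<Sum>j\<in>UNIV. ?q i j c d) * G x $ c $ d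
      + ?Q c d * (\<eta> x * partial k (\<lambda>y. G y $ c $ d) x))"
  have D1: "((\<lambda>t. ?I $ i $ j * D (t, x) i c * D (t, x) j d) has_real_derivative ?q i j c d) (at 0)" for i j c d
    by (intro DERIV_mult' DERIV_cmult DERIV_D)
  have "((\<lambda>t. (\<Sum>i\<in>UNIV. \<Sum>j\<in>UNIV. ?I $ i $ j * D (t, x) i c * D (t, x) j d) * G (\<psi> t x) $ c $ d) has_real_derivative
     (?Q c d * (\<eta> x * partial k (\<lambda>y. G y $ c $ d) x) +
      (\<Sum>i\<in>UNIV. \<Sum>j\<in>UNIV. ?q i j c d) * G (\<psi> 0 x) $ c $ d)) (at 0)" for c d
    by (intro DERIV_mult' DERIV_sum D1 DERIV_\<psi> smooth_on_metric_nth[OF metric_G] x)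
  then have "((\<lambda>t. e (t, x)) has_real_derivative E) (at 0)"
    unfolding e_def E_def fst_conv snd_conv \<psi>_0
    by (intro DERIV_sum) (simp add: add.commute)
  moreover have "E = \<eta> x * trd x + 2 * partial k \<eta> x"
  proof -
    have A1: "(\<Sum>i\<in>UNIV. \<Sum>j\<in>UNIV. ?q i j c d) =
        (\<Sum>j\<in>UNIV. ?I $ c $ j * partial j \<eta> x) * ?v $ d + (\<Sum>i\<in>UNIV. ?I $ i $ d * partial i \<eta> x) * ?v $ c" for c d
      by (simp add: D_0 sum.distrib if_distrib[of "\<lambda>t. _ * t"] if_distrib[of "\<lambda>t. t * _"] sum_distrib_left sum_distrib_right mult_ac
          cong: if_cong) (simp add: sum.swap[of _ UNIV] if_distrib cong: if_cong)
    have A2: "?Q c d = ?I $ c $ d" for c d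
      by (simp add: D_0 if_distrib[of "\<lambda>t. _ * t"] if_distrib[of "\<lambda>t. t * _"] cong: if_cong)
    have vsum: "(\<Sum>d\<in>UNIV. y d * ?v $ d * z d) = y k * z k" for y z
      by (simp add: axis_def if_distrib[of "\<lambda>t. _ * t"] if_distrib[of "\<lambda>t. t * _"] cong: if_cong)
    \<comment> \<open>The metric contracts with its inverse, and only the derivative in direction
      \<open>k\<close> survives.\<close>
    have S1: "(\<Sum>c\<in>UNIV. \<Sum>d\<in>UNIV. (\<Sum>j\<in>UNIV. ?I $ c $ j * partial j \<eta> x) * ?v $ d * G x $ c $ d) = partial k \<eta> x"
    proof -
      have "(\<Sum>c\<in>UNIV. \<Sum>d\<in>UNIV. (\<Sum>j\<in>UNIV. ?I $ c $ j * partial j \<eta> x) * ?v $ d * G x $ c $ d) =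
         (\<Sum>c\<in>UNIV. \<Sum>j\<in>UNIV. (G x $ k $ c * ?I $ c $ j) * partial j \<eta> x)"
        by (simp only: vsum) (simp add: sum_distrib_right sum_distrib_left posdef_nth_commute[OF pd, of _ k] mult_ac)
      also have "\<dots> = (\<Sum>j\<in>UNIV. (\<Sum>c\<in>UNIV. G x $ k $ c * ?I $ c $ j) * partial j \<eta> x)"
        by (subst sum.swap) (simp add: sum_distrib_right)
      finally show ?thesis by (simp add: inv if_distrib[of "\<lambda>t. t * _"] cong: if_cong)
    qed
    have S2: "(\<Sum>c\<in>UNIV. \<Sum>d\<in>UNIV. (\<Sum>i\<in>UNIV. ?I $ i $ d * partial i \<eta> x) * ?v $ c * G x $ c $ d) = partial k \<eta> x"
    proof -
      have "(\<Sum>c\<in>UNIV. \<Sum>d\<in>UNIV. (\<Sum>i\<in>UNIV. ?I $ i $ d * partial i \<eta> x) * ?v $ c * G x $ c $ d) =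
         (\<Sum>d\<in>UNIV. \<Sum>c\<in>UNIV. (\<Sum>i\<in>UNIV. ?I $ i $ d * partial i \<eta> x) * ?v $ c * G x $ c $ d)"
        by (rule sum.swap)
      also have "\<dots> = (\<Sum>d\<in>UNIV. \<Sum>i\<in>UNIV. (?I $ i $ d * G x $ d $ k) * partial i \<eta> x)"
        by (simp only: vsum) (simp add: sum_distrib_right sum_distrib_left posdef_nth_commute[OF pd, of k] mult_ac)
      also have "\<dots> = (\<Sum>i\<in>UNIV. (\<Sum>d\<in>UNIV. ?I $ i $ d * G x $ d $ k) * partial i \<eta> x)"
        by (subst sum.swap) (simp add: sum_distrib_right)
      finally show ?thesis by (simp add: inv if_distrib[of "\<lambda>t. t * _"] cong: if_cong)
    qed
    show ?thesis
      unfolding E_def A1 A2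
      by (simp only: distrib_right sum.distrib S1 S2) (simp add: trd_def sum_distrib_left mult_ac)
  qed
  ultimately show ?thesis by simp
qed

text \<open>The raw derivative is s (4 X(lam) + 8 lam div X). As s div X is the \<open>k\<close>-th
  derivative of \<eta> s, completing to the derivative of the product lam \<eta> s takes 8 s X(lam)
  and leaves the coefficient 4 - 8 = -4.\<close>

lemma derivative_w:
  assumes x: "x \<in> U"
  shows "frechet_derivative w (at (0, x)) (1, 0) =
    8 * partial k (\<lambda>y. lam y * \<eta> y * s y) x - 4 * (\<eta> x * s x * partial k lam x)"
proof -
  \<comment> \<open>As \<open>\<psi>\<^sub>0\<close> is the identity, \<open>tau\<close> vanishes at \<open>t = 0\<close>, so the tangential term is of second order (\<open>T\<close>).\<close>
  note d = smooth_on_imp_differentiable[OF smooth_on_lam x] smooth_on_imp_differentiable[OF \<eta>_U x]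
    smooth_on_imp_differentiable[OF smooth_on_s x]
  have P: "partial k (\<lambda>y. lam y * \<eta> y * s y) x =
     partial k lam x * \<eta> x * s x + lam x * partial k \<eta> x * s x + lam x * \<eta> x * partial k s x"
    by (simp add: partial_mult d differentiable_mult algebra_simps)
  have S: "2 * partial k s x = s x * trd x"
    using partial_sqrt_det_2[OF metric_G x, of k] by (simp add: s_def[abs_def] trd_def)
  have T: "((\<lambda>t. (\<Sum>c\<in>UNIV. \<Sum>d\<in>UNIV. G (\<psi> t x) $ c $ d * tau (t, x) c * tau (t, x) d)) has_real_derivative
      (\<Sum>c\<in>(UNIV::2 set). \<Sum>d\<in>(UNIV::2 set). 0)) (at 0)"
  proof (intro DERIV_sum)
    fix c d :: 2
    from DERIV_mult'[OF DERIV_mult'[OF DERIV_\<psi>[OF smooth_on_metric_nth[OF metric_G] x, of c d] DERIV_slice[OF smooth_on_tau x, of c]]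
        DERIV_slice[OF smooth_on_tau x, of d]]
    show "((\<lambda>t. G (\<psi> t x) $ c $ d * tau (t, x) c * tau (t, x) d) has_real_derivative 0) (at 0)"
      by (simp add: tau_0)
  qed
  have L: "((\<lambda>t. lam (\<psi> t x) * (e (t, x))\<^sup>2) has_real_derivative
      lam x * (2 * 2 * (\<eta> x * trd x + 2 * partial k \<eta> x)) + \<eta> x * partial k lam x * 4) (at 0)"
    using DERIV_mult'[OF DERIV_\<psi>[OF smooth_on_lam x] DERIV_mult'[OF DERIV_e[OF x] DERIV_e[OF x]]]
    by (simp add: e_0[OF x] \<psi>_0 power2_eq_square algebra_simps)
  have "((\<lambda>t. w (t, x)) has_real_derivative
      (lam x * (2 * 2 * (\<eta> x * trd x + 2 * partial k \<eta> x)) + \<eta> x * partial k lam x * 4) * s x) (at 0)"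
    using DERIV_cmult_right[OF DERIV_add[OF T L], of "s x"] by (simp add: w_def w0_def)
  from DERIV_unique[OF DERIV_slice[OF smooth_on_w x] this]
  have "frechet_derivative w (at (0, x)) (1, 0) =
     4 * lam x * \<eta> x * (s x * trd x) + 8 * lam x * partial k \<eta> x * s x + 4 * \<eta> x * partial k lam x * s x"
    by (simp add: algebra_simps)
  then show ?thesis unfolding P S[symmetric] by (simp add: algebra_simps)
qed

lemma integral_zero: "integral (cbox a b) (\<lambda>x. \<eta> x * s x * partial k lam x) = 0"
proof -
  let ?f = "\<lambda>x. lam x * \<eta> x * s x"
  \<comment> \<open>Extended by zero off \<open>U\<close>, the product is smooth everywhere, as the
    partial integration asks.\<close>
  let ?u = "\<lambda>x. if x \<in> U then ?f x else 0"
  have sf: "smooth_on U ?f"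
    by (intro smooth_on_mult open_U smooth_on_lam \<eta>_U smooth_on_s)
  have ball: "ball x0 (2 * r) \<subseteq> U" using r C_U by auto
  have su: "smooth_on UNIV ?u"
  proof (rule smooth_on_UNIV_cutoff[OF open_U sf, of "cball x0 r"])
    show "cball x0 r \<subseteq> U" using ball r(1) by (auto simp: subset_iff)
    show "?f x = 0" if "x \<in> U - cball x0 r" for x using that \<eta>(4)[of x] by (simp add: dist_commute)
  qed simp
  have 0: "integral (cbox a b) (partial k ?u) = 0"
    by (rule integral_partial_eq_0[OF su r(1) _ r(2)]) (simp add: \<eta>(4))
  have pu: "partial k ?u x = partial k ?f x" if "x \<in> U" for x
    by (rule partial_cong[OF open_U that, symmetric]) (use smooth_on_imp_differentiable[OF sf that] in auto)
  let ?h = "\<lambda>x. \<eta> x * s x * partial k lam x"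
  have sh: "smooth_on U ?h" by (intro smooth_on_mult open_U \<eta>_U smooth_on_s smooth_on_partial smooth_on_lam)
  have i1: "partial k ?u integrable_on cbox a b"
    by (intro integrable_continuous smooth_on_imp_continuous_on smooth_on_partial smooth_on_subset[OF su]) auto
  have i2: "?h integrable_on cbox a b"
    by (intro integrable_continuous smooth_on_imp_continuous_on smooth_on_subset[OF sh] C_U)
  have "0 = integral (cbox a b) (\<lambda>x. frechet_derivative w (at (0, x)) (1, 0))" by (simp add: integral_derivative_w)
  also have "\<dots> = integral (cbox a b) (\<lambda>x. 8 * partial k ?u x - 4 * ?h x)"
    by (rule integral_cong) (use C_U in \<open>auto simp: derivative_w pu subset_iff\<close>)
  also have "\<dots> = 8 * integral (cbox a b) (partial k ?u) - 4 * integral (cbox a b) ?h"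
    by (subst integral_diff) (use i1 i2 in \<open>auto intro: integrable_on_cmult_left\<close>)
  finally show ?thesis by (simp add: 0)
qed

end

section \<open>Constancy of the mean curvature\<close>

lemma open_locally_constant_fibre:
  assumes "\<And>p. \<exists>V. open V \<and> p \<in> V \<and> (\<forall>q\<in>V. f q = f p)"
  shows "open {p. f p = c}"
  unfolding open_subopen[of "{p. f p = c}"] using assms by fastforce

lemma locally_constant_imp_constant:
  fixes f :: "'p::topological_space \<Rightarrow> 'b"
  assumes conn: "connected (UNIV :: 'p set)" and loc: "\<And>p. \<exists>V. open V \<and> p \<in> V \<and> (\<forall>q\<in>V. f q = f p)"
  shows "f p = f q"
proof (rule ccontr)
  assume "f p \<noteq> f q"
  have o: "open {x. f x = f p}" by (rule open_locally_constant_fibre[OF loc])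
  have o': "open {x. f x \<noteq> f p}"
    unfolding open_subopen[of "{x. f x \<noteq> f p}"] using loc by fastforce
  have "{x. f x = f p} \<inter> UNIV = {} \<or> {x. f x \<noteq> f p} \<inter> UNIV = {}"
    by (rule connectedD[OF conn o o']) auto
  moreover have "p \<in> {x. f x = f p}" "q \<in> {x. f x \<noteq> f p}" using \<open>f p \<noteq> f q\<close> by auto
  ultimately show False by blast
qed

context umbilical_surface
begin

text \<open>The fundamental lemma of the calculus of variations: radius, cube and bump, fixed so
  far, now vary. The function is described by \<open>f_eq\<close> because \<open>lam\<close> belongs
  to a single variation.\<close>

lemma umbilical_biharmonic_partial_eq_0:
  assumes bih: "biharmonic A g B h \<phi>"
    and \<kappa>: "\<kappa> \<in> A" and \<nu>: "\<nu> \<in> B" and x: "x0 \<in> snd \<kappa> ` (fst \<kappa> \<inter> \<phi> -` fst \<nu>)"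
    and f_eq: "\<And>x. f x = metric_inner (h \<nu>) (local_rep \<kappa> \<nu> \<phi> x) (tension (g \<kappa>) (h \<nu>) (local_rep \<kappa> \<nu> \<phi>) x)
      (tension (g \<kappa>) (h \<nu>) (local_rep \<kappa> \<nu> \<phi>) x) / 4"
  shows "f differentiable at x0 \<and> partial k f x0 = 0"
proof -
  let ?U = "snd \<kappa> ` (fst \<kappa> \<inter> \<phi> -` fst \<nu>)"
  have c: "is_chart \<kappa>" "is_chart \<nu>" using smooth_atlas_is_chart at \<kappa> \<nu> by blast+
  have oU: "open ?U" by (rule open_chart_image[OF c(1) open_vimage_chart[OF \<nu>]])
  have main: "smooth_on ?U f \<and> integral (cbox a b) (\<lambda>x. \<eta> x * sqrt (det (g \<kappa> x)) * partial k f x) = 0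
      \<and> smooth_on ?U (\<lambda>x. sqrt (det (g \<kappa> x))) \<and> (\<forall>x\<in>?U. sqrt (det (g \<kappa> x)) > 0)"
    if "r > 0" "ball x0 (2 * r) \<subseteq> cbox a b" "cbox a b \<subseteq> ?U" "smooth_on UNIV \<eta>"
      "\<And>x. \<eta> x \<ge> 0" "\<And>x. \<eta> x \<le> 1" "\<And>x. dist x x0 \<ge> r \<Longrightarrow> \<eta> x = 0" for r a b \<eta>
  proof -
    interpret umbilical_variation A g B h \<phi> \<kappa> \<nu> a b x0 r \<eta> k
      by unfold_locales (use at f \<kappa> \<nu> bih that in auto)
    have "f = lam" by (simp add: fun_eq_iff f_eq lam_def)
    then show ?thesis
      using integral_zero smooth_on_lam smooth_on_s s_pos by (simp add: s_def[abs_def] U_def)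
  qed
  obtain a b where ab: "cbox a b \<subseteq> ?U" "x0 \<in> box a b"
    by (rule open_contains_cbox[OF oU x])
  then obtain d where d: "d > 0" "ball x0 d \<subseteq> box a b" using open_box open_contains_ball by blast
  have bump: "\<exists>\<eta>. smooth_on UNIV \<eta> \<and> (\<forall>x. \<eta> x \<ge> 0) \<and> (\<forall>x. \<eta> x \<le> 1) \<and> \<eta> x0 > (0::real) \<and>
      (\<forall>x. dist x x0 \<ge> r \<longrightarrow> \<eta> x = 0)" if "r > 0" for r
    using ex_bump[OF that, of x0] by metis
  have rd: "r > 0 \<Longrightarrow> r \<le> d / 2 \<Longrightarrow> ball x0 (2 * r) \<subseteq> cbox a b" for r
    using d box_subset_cbox[of a b] by (auto simp: subset_iff)
  \<comment> \<open>These facts come with any admissible variation, so one bump of radius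
    \<open>d / 2\<close> is enough to extract them.\<close>
  have sf: "smooth_on ?U f" and ss: "smooth_on ?U (\<lambda>x. sqrt (det (g \<kappa> x)))" and spos: "\<And>x. x \<in> ?U \<Longrightarrow> sqrt (det (g \<kappa> x)) > 0"
  proof -
    have d2: "d / 2 > 0" using d by simp
    obtain \<eta> where \<eta>: "smooth_on UNIV \<eta>" "\<And>x. \<eta> x \<ge> 0" "\<And>x. \<eta> x \<le> 1"
      "\<And>x. dist x x0 \<ge> d / 2 \<Longrightarrow> \<eta> x = (0::real)" using bump[OF d2] by blast
    from main[OF d2 rd[OF d2 order_refl] ab(1) \<eta>]
    show "smooth_on ?U f" "smooth_on ?U (\<lambda>x. sqrt (det (g \<kappa> x)))" "\<And>x. x \<in> ?U \<Longrightarrow> sqrt (det (g \<kappa> x)) > 0"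
      by blast+
  qed
  have sp: "smooth_on ?U (partial k f)" by (rule smooth_on_partial[OF sf])
  have cp: "isCont (partial k f) x0"
    using smooth_on_imp_continuous_on[OF sp] oU x continuous_on_eq_continuous_at by blast
  have "partial k f x0 = 0"
  proof (rule ccontr)
    assume nz: "partial k f x0 \<noteq> 0"
    \<comment> \<open>With this sign the integrand becomes nonnegative on the support of a narrow
      bump.\<close>
    define \<sigma> where "\<sigma> = sgn (partial k f x0)"
    have pos: "\<sigma> * partial k f x0 > 0" using nz by (simp add: \<sigma>_def sgn_if)
    have ct: "isCont (\<lambda>x. \<sigma> * partial k f x) x0" using cp by (intro continuous_intros)
    have "\<forall>\<^sub>F x in nhds x0. 0 < \<sigma> * partial k f x"
      using ct pos tendsto_at_iff_tendsto_nhds[of "\<lambda>x. \<sigma> * partial k f x" x0]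
      by (auto simp: isCont_def intro: order_tendstoD(1))
    then obtain e where e: "e > 0" "\<And>x. dist x x0 < e \<Longrightarrow> \<sigma> * partial k f x > 0"
      unfolding eventually_nhds_metric by blast
    \<comment> \<open>The first bound keeps the sign of the derivative on the support of the bump,
      the second keeps the ball of radius \<open>2 * r\<close> in the cube.\<close>
    define r where "r = min e (d / 2)"
    have r: "r > 0" "r \<le> e" "r \<le> d / 2" using e d by (auto simp: r_def)
    obtain \<eta> where \<eta>: "smooth_on UNIV \<eta>" "\<And>x. \<eta> x \<ge> 0" "\<And>x. \<eta> x \<le> 1" "\<eta> x0 > (0::real)"
      "\<And>x. dist x x0 \<ge> r \<Longrightarrow> \<eta> x = 0" using bump[OF r(1)] by blast
    let ?h = "\<lambda>x. \<eta> x * sqrt (det (g \<kappa> x)) * partial k f x"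
    have int: "integral (cbox a b) ?h = 0"
      using main[OF r(1) rd[OF r(1,3)] ab(1) \<eta>(1-3,5)] by blast
    have "smooth_on ?U ?h"
      by (intro smooth_on_mult oU ss sp smooth_on_subset[OF \<eta>(1)]) auto
    then have cont: "continuous_on (cbox a b) ?h"
      using continuous_on_subset[OF smooth_on_imp_continuous_on ab(1)] by blast
    then have hi: "(?h has_integral 0) (cbox a b)"
      using int integrable_continuous has_integral_integral by metis
    then have "((\<lambda>x. \<sigma> * ?h x) has_integral \<sigma> * 0) (cbox a b)" by (rule has_integral_mult_right)
    then have hi': "((\<lambda>x. \<sigma> * ?h x) has_integral 0) (cbox a b)" by simp
    \<comment> \<open>A continuous nonnegative function with integral zero vanishes, while at
      \<open>x0\<close> all factors combine to a positive value.\<close>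
    have "\<sigma> * ?h x0 = 0"
    proof (rule has_integral_0_cbox_imp_0[OF _ _ hi'])
      show "continuous_on (cbox a b) (\<lambda>x. \<sigma> * ?h x)" by (rule continuous_on_mult[OF continuous_on_const cont])
      show "0 \<le> \<sigma> * ?h x" if "x \<in> box a b" for x
      proof (cases "dist x x0 < r")
        case True
        have xU: "x \<in> ?U" using that box_subset_cbox ab(1) by blast
        have "0 \<le> \<sigma> * partial k f x" using e(2)[of x] True r(2) by simp
        then have "0 \<le> \<eta> x * sqrt (det (g \<kappa> x)) * (\<sigma> * partial k f x)"
          by (rule mult_nonneg_nonneg[OF mult_nonneg_nonneg[OF \<eta>(2) less_imp_le[OF spos[OF xU]]]])
        then show ?thesis by (simp add: mult_ac)
      qed (simp add: \<eta>(5))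
      show "box a b \<noteq> {}" using ab by auto
      show "x0 \<in> cbox a b" using ab box_subset_cbox by blast
    qed
    moreover have "\<eta> x0 * sqrt (det (g \<kappa> x0)) * (\<sigma> * partial k f x0) > 0"
      by (rule mult_pos_pos[OF mult_pos_pos[OF \<eta>(4) spos[OF x]] pos])
    ultimately show False by auto
  qed
  then show ?thesis using smooth_on_imp_differentiable[OF sf x] by blast
qed

text \<open>In a chart all partial derivatives vanish, and in a ball, which is convex, this forces
  constancy.\<close>

lemma tension_norm_sq_locally_constant:
  assumes bih: "biharmonic A g B h \<phi>"
  shows "\<exists>V. open V \<and> p \<in> V \<and> (\<forall>q\<in>V. tension_norm_sq A g B h \<phi> q = tension_norm_sq A g B h \<phi> p)"
proof -
  obtain \<kappa> \<nu> where \<kappa>: "\<kappa> \<in> A" "p \<in> fst \<kappa>" and \<nu>: "\<nu> \<in> B" "\<phi> p \<in> fst \<nu>"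
    and c: "is_chart \<kappa>" "is_chart \<nu>" by (rule charts_at)
  let ?U = "snd \<kappa> ` (fst \<kappa> \<inter> \<phi> -` fst \<nu>)"
  define f where "f x = metric_inner (h \<nu>) (local_rep \<kappa> \<nu> \<phi> x) (tension (g \<kappa>) (h \<nu>) (local_rep \<kappa> \<nu> \<phi>) x)
      (tension (g \<kappa>) (h \<nu>) (local_rep \<kappa> \<nu> \<phi>) x) / 4" for x
  have o\<phi>: "open (\<phi> -` fst \<nu>)" by (rule open_vimage_chart[OF \<nu>(1)])
  have oU: "open ?U" by (rule open_chart_image[OF c(1) o\<phi>])
  have f: "tension_norm_sq A g B h \<phi> q = 4 * f (snd \<kappa> q)" if "q \<in> fst \<kappa>" "\<phi> q \<in> fst \<nu>" for q
    using tension_norm_sq_charts[OF \<kappa>(1) that(1) \<nu>(1) that(2)] that c by (simp add: f_def local_rep_snd)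
  have D: "(f has_derivative (\<lambda>v. 0)) (at x)" if "x \<in> ?U" for x
  proof -
    have *: "f differentiable at x" "partial k f x = 0" for k
      using umbilical_biharmonic_partial_eq_0[OF bih \<kappa>(1) \<nu>(1) that f_def, of k] by blast+
    show ?thesis using has_derivative_partial[OF *(1)] by (simp add: *(2))
  qed
  have "snd \<kappa> p \<in> ?U" using \<kappa> \<nu> by auto
  then obtain e where e: "e > 0" "ball (snd \<kappa> p) e \<subseteq> ?U" using oU open_contains_ball by blast
  have const: "f x = f (snd \<kappa> p)" if "x \<in> ball (snd \<kappa> p) e" for x
    using has_derivative_zero_constant[of "ball (snd \<kappa> p) e" f] D e that
    by (metis (no_types, lifting) centre_in_ball convex_ball has_derivative_at_withinI subsetD)
  let ?V = "fst \<kappa> \<inter> \<phi> -` fst \<nu> \<inter> (fst \<kappa> \<inter> snd \<kappa> -` ball (snd \<kappa> p) e)"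
  have "open ?V"
    by (intro open_Int o\<phi> is_chart_open c continuous_open_preimage continuous_on_chart open_ball)
  moreover have "p \<in> ?V" using \<kappa> \<nu> e by auto
  moreover have "tension_norm_sq A g B h \<phi> q = tension_norm_sq A g B h \<phi> p" if "q \<in> ?V" for q
    using that const[of "snd \<kappa> q"] f \<kappa> \<nu> by auto
  ultimately show ?thesis by blast
qed

text \<open>In codimension one \<open>X\<close> is plus or minus \<open>\<xi>\<close>, and squaring
  removes the sign. The length of the tension field thus serves as a global substitute for the mean
  curvature.\<close>

lemma mean_curvature_sq:
  assumes \<xi>: "unit_normal_on A B h \<phi> V \<xi>" "p \<in> V"
  shows "(mean_curvature A g B h \<phi> \<xi> p)\<^sup>2 = tension_norm_sq A g B h \<phi> p / 4"
proof -
  obtain \<kappa> \<nu> where \<kappa>: "\<kappa> \<in> A" "p \<in> fst \<kappa>" and \<nu>: "\<nu> \<in> B" "\<phi> p \<in> fst \<nu>"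
    and c: "is_chart \<kappa>" "is_chart \<nu>" by (rule charts_at)
  let ?x = "snd \<kappa> p" and ?y = "snd \<nu> (\<phi> p)" and ?F = "local_rep \<kappa> \<nu> \<phi>" and ?G = "g \<kappa>" and ?K = "h \<nu>"
  let ?m = "metric_inner ?K ?y"
  have pd: "posdef (?K ?y)" "posdef (?G ?x)"
    using \<kappa> \<nu> by (auto intro!: metric_on_posdef metric_on_chart M N chart_snd_in)
  have G: "?G ?x $ i $ j = ?m (partial i ?F ?x) (partial j ?F ?x)" for i j
    using isometric_on_local_rep[OF iso \<kappa>(1) \<nu>(1)] \<kappa> \<nu> c by (auto simp: isometric_on_def local_rep_snd)
  obtain l X where lX: "\<And>i j. hessian_map ?G ?K ?F ?x i j = (l * ?G ?x $ i $ j) *\<^sub>R X"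
    "?m X X = 1" "\<And>i. ?m X (partial i ?F ?x) = 0"
    using umbilical_hessian_charts[OF \<kappa> \<nu>] by blast
  have T: "tension ?G ?K ?F ?x = (l * 2) *\<^sub>R X"
    using tension_umbilical[of ?G ?x ?K ?F l X, OF pd(2) lX(1)] by simp
  define b where "b = ?m X (\<xi> \<nu> p)"
  have X: "X = b *\<^sub>R \<xi> \<nu> p" unfolding b_def
    by (rule orthogonal_to_hypersurface_frame[of ?K ?y, OF pd G])
       (use unit_normal_onD(1,2)[OF \<xi> \<nu>, of \<kappa>] \<kappa> lX in auto)
  have "?m X X = b\<^sup>2"
    using unit_normal_onD(1)[OF \<xi> \<nu> \<kappa>] by (simp add: X metric_inner_linear power2_eq_square)
  then have "(?m (\<xi> \<nu> p) X)\<^sup>2 = 1"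
    using lX(2) metric_inner_commute[of ?K ?y "\<xi> \<nu> p" X, OF pd(1)] by (simp add: b_def)
  moreover have "mean_curvature A g B h \<phi> \<xi> p = l * ?m (\<xi> \<nu> p) X"
    unfolding mean_curvature_charts[OF \<xi> \<kappa> \<nu>] T by (simp add: metric_inner_linear)
  moreover have "tension_norm_sq A g B h \<phi> p = 4 * l\<^sup>2"
    unfolding tension_norm_sq_charts[OF \<kappa> \<nu>] T by (simp add: metric_inner_linear lX(2) power2_eq_square)
  ultimately show ?thesis by (simp add: power_mult_distrib)
qed

text \<open>Continuity excludes jumps between the two possible values \<open>c\<close> and
  \<open>- c\<close> on a connected set.\<close>

lemma continuous_on_mean_curvature:
  assumes \<xi>: "unit_normal_on A B h \<phi> V \<xi>"
  shows "continuous_on V (mean_curvature A g B h \<phi> \<xi>)"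
proof -
  have oV: "open V" using \<xi> by (simp add: unit_normal_on_def)
  have "isCont (mean_curvature A g B h \<phi> \<xi>) p" if p: "p \<in> V" for p
  proof -
    obtain \<kappa> \<nu> where \<kappa>: "\<kappa> \<in> A" "p \<in> fst \<kappa>" and \<nu>: "\<nu> \<in> B" "\<phi> p \<in> fst \<nu>"
      and c: "is_chart \<kappa>" "is_chart \<nu>" by (rule charts_at)
    let ?O = "fst \<kappa> \<inter> V \<inter> \<phi> -` fst \<nu>" and ?F = "local_rep \<kappa> \<nu> \<phi>" and ?X = "\<xi> \<nu> \<circ> chart_inv \<kappa>"
    let ?U = "snd \<kappa> ` ?O"
    have oO: "open ?O" by (intro open_Int is_chart_open c oV open_vimage_chart \<nu>)
    note n = unit_normal_charts[OF \<xi> \<kappa>(1) \<nu>(1)]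
    note oU = n(1) and K = metric_on_chart[OF N \<nu>(1)]
    have T: "smooth_on ?U (\<lambda>x. tension (g \<kappa>) (h \<nu>) ?F x $ i)" for i
      by (rule smooth_on_tension[OF n(4) K n(2,3)])
    have Kc: "smooth_on ?U (\<lambda>x. h \<nu> (?F x) $ i $ j)" for i j
      by (rule smooth_on_compose[OF smooth_on_metric_nth[OF K] oU is_chart_open(2)[OF c(2)] n(2,3)])
    let ?m = "\<lambda>x. 1/2 * metric_inner (h \<nu>) (?F x) (?X x) (tension (g \<kappa>) (h \<nu>) ?F x)"
    have "smooth_on ?U ?m"
      unfolding metric_inner_sum
      by (intro smooth_on_mult[OF oU] smooth_on_sum[OF oU] smooth_on_const Kc T smooth_on_vec_nth[OF oU n(5)])
    then have "continuous_on ?O (\<lambda>q. ?m (snd \<kappa> q))"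
      by (intro continuous_on_compose2[OF smooth_on_imp_continuous_on continuous_on_subset[OF continuous_on_chart[OF c(1)]]]) auto
    then have "continuous_on ?O (mean_curvature A g B h \<phi> \<xi>)"
      by (rule continuous_on_eq)
         (use mean_curvature_charts[OF \<xi> _ \<kappa>(1) _ \<nu>(1)] c in \<open>auto simp: local_rep_snd chart_inv_snd\<close>)
    then show ?thesis using oO p \<kappa> \<nu> continuous_on_eq_continuous_at by blast
  qed
  then show ?thesis using oV by (simp add: continuous_on_eq_continuous_at)
qed

end

theorem theorem3p1:
  fixes A :: "('m::{t2_space,second_countable_topology}, 2) chart set"
    and g :: "('m, 2) chart_metric"
    and B :: "('n::{t2_space,second_countable_topology}, 3) chart set"
    and h :: "('n, 3) chart_metric"
    and \<phi> :: "'m \<Rightarrow> 'n"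
  assumes "riemannian_manifold A g"
    and "connected (UNIV :: 'm set)"
    and "riemannian_manifold B h"
    and "isometric_immersion A g B h \<phi>"
    and "biharmonic A g B h \<phi>"
    and "totally_umbilical A g B h \<phi>"
  shows "constant_mean_curvature A g B h \<phi>"
proof -
  interpret umbilical_surface A g B h \<phi>
    using assms by unfold_locales (simp_all add: isometric_immersion_def)
  \<comment> \<open>Types are inhabited, which supplies a base point.\<close>
  obtain p0 :: 'm where True by simp
  let ?f = "tension_norm_sq A g B h \<phi>"
  define c where "c = sqrt (?f p0 / 4)"
  have const: "?f p = ?f p0" for p
    by (rule locally_constant_imp_constant[OF assms(2) tension_norm_sq_locally_constant[OF assms(5)]])
  show ?thesis
    unfolding constant_mean_curvature_def
  proof (intro exI[of _ c] allI impI)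
    fix V \<xi> assume \<xi>: "unit_normal_on A B h \<phi> V \<xi>" and V: "connected V"
    let ?H = "mean_curvature A g B h \<phi> \<xi>"
    have sq: "(?H p)\<^sup>2 = ?f p0 / 4" if "p \<in> V" for p
      using mean_curvature_sq[OF \<xi> that] const[of p] by simp
    have val: "?H p = c \<or> ?H p = - c" if "p \<in> V" for p
      using sq[OF that] unfolding c_def by (metis abs_if minus_minus real_sqrt_abs)
    have "?H constant_on V"
    proof (rule continuous_finite_range_constant[OF V continuous_on_mean_curvature[OF \<xi>]])
      show "finite (?H ` V)" by (rule finite_subset[of _ "{c, - c}"]) (use val in auto)
    qed
    then show "(\<forall>p\<in>V. ?H p = c) \<or> (\<forall>p\<in>V. ?H p = - c)"
      unfolding constant_on_def using val by metis
  qed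
qed

end
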